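(* Let $m>1$. For $a>0$ consider the boundary value problem $$f'''+\frac{m+1}{2}ff''-mf'^2=0 \text{ on } [0,\infty),\qquad f(0)=a,\quad f'(0)=-1,\quad f'(\infty)=0.$$ Then there exist real numbers $0<a_1^*<a_2^*$ (depending on $m$) such that: (i) for $0<a<a_1^*$, the problem admits no solution; (ii) for $a=a_1^*$, the problem admits a unique solution, which is convex and such that $\lim_{t\to\infty}f(t)=\ell$ for some $\ell>0$; (iii) for $a_1^*<a\le a_2^*$, the problem admits exactly two convex solutions such that $\lim_{t\to\infty}f(t)=\ell$ for some $\ell>0$ (depending on the solution), and infinitely many convex solutions such that $\lim_{t\to\infty}f(t)=0$; (iv) for $a>a_2^*$, the problem admits exactly one concave-convex solution and exactly one convex solution such that $\lim_{t\to\infty}f(t)=\ell$ for some $\ell>0$ (depending on the solution), and infinitely many solutions, each concave-convex or convex, such that $\lim_{t\to\infty}f(t)=0$. All these solutions are decreasing and positive.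
   Context: A solution is a three times differentiable function $f:[0,\infty)\to\mathbb{R}$ satisfying the equation on $[0,\infty)$ and the boundary conditions, where $f'(\infty):=\lim_{t\to\infty}f'(t)$. A convex solution is a solution that is convex on all of $[0,\infty)$. A concave-convex solution is a solution with $f''(0)<0$ for which there exists $t_0>0$ such that $f$ is concave on $[0,t_0]$ and convex on $(t_0,\infty)$. *)

theory Defs
  imports "HOL-Analysis.Analysis"
begin

text \<open>
  Functions on \<open>[0,\<infinity>)\<close> are represented by extensional functions on \<^term>\<open>{0::real..}\<close>, so
  that counting solutions is not affected by values at negative arguments.  Derivatives are taken
  within \<^term>\<open>{0::real..}\<close>, hence they are one-sided at \<open>0\<close>.
\<close>

definition hderiv :: "(real \<Rightarrow> real) \<Rightarrow> real \<Rightarrow> real" where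
  "hderiv f t = vector_derivative f (at t within {0..})"

definition solution :: "real \<Rightarrow> real \<Rightarrow> (real \<Rightarrow> real) \<Rightarrow> bool" where
  "solution m a f \<longleftrightarrow>
     f \<in> extensional {0..} \<and>
     (\<forall>k<3. (hderiv ^^ k) f differentiable_on {0..}) \<and>
     (\<forall>t\<ge>0. (hderiv ^^ 3) f t + (m + 1) / 2 * f t * (hderiv ^^ 2) f t - m * (hderiv f t)\<^sup>2 = 0) \<and>
     f 0 = a \<and> hderiv f 0 = -1 \<and> (hderiv f \<longlongrightarrow> 0) at_top"

definition convex_solution :: "real \<Rightarrow> real \<Rightarrow> (real \<Rightarrow> real) \<Rightarrow> bool" where
  "convex_solution m a f \<longleftrightarrow> solution m a f \<and> convex_on {0..} f"

definition concave_convex_solution :: "real \<Rightarrow> real \<Rightarrow> (real \<Rightarrow> real) \<Rightarrow> bool" where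
  "concave_convex_solution m a f \<longleftrightarrow>
     solution m a f \<and> (hderiv ^^ 2) f 0 < 0 \<and>
     (\<exists>t\<^sub>0>0. concave_on {0..t\<^sub>0} f \<and> convex_on {t\<^sub>0<..} f)"

definition positive_limit :: "(real \<Rightarrow> real) \<Rightarrow> bool" where
  "positive_limit f \<longleftrightarrow> (\<exists>l>0. (f \<longlongrightarrow> l) at_top)"

definition zero_limit :: "(real \<Rightarrow> real) \<Rightarrow> bool" where
  "zero_limit f \<longleftrightarrow> (f \<longlongrightarrow> 0) at_top"

definition decreasing_positive :: "(real \<Rightarrow> real) \<Rightarrow> bool" where
  "decreasing_positive f \<longleftrightarrow> strict_antimono_on {0..} f \<and> (\<forall>t\<ge>0. 0 < f t)"

end

theory Submission
  imports Defs
begin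

text \<open>
  The scaling \<open>f \<mapsto> \<kappa> f (\<kappa> t)\<close> makes \<open>u = f' / f\<^sup>2\<close>, \<open>v = f'' / f\<^sup>3\<close> as functions of \<open>s = \<integral> f dt\<close> solve an
  autonomous planar system with the equilibria \<open>(0, 0)\<close> and \<open>A = (- 1/6, 1/18)\<close>.  Every solution of the boundary
  value problem is positive and decreasing, and solutions correspond to the bounded orbits in \<open>u < 0\<close> starting on
  the line \<open>u = - 1 / a\<^sup>2\<close>.  The limit of \<open>f\<close> is positive exactly on the strong stable manifold of the origin.
  Followed backwards, this curve leaves the origin above the parabola \<open>v = 2 u\<^sup>2\<close>, crosses it once at the
  abscissa \<open>u\<^sub>1 < - 1/4\<close>, passes below \<open>A\<close>, then crosses \<open>v = 0\<close> at \<open>u\<^sub>2\<close> and covers the rest of \<open>(u\<^sub>1, 0)\<close>;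
  this is where \<open>m > 1\<close> enters, because for \<open>m = 1\<close> the curve is the homoclinic loop
  \<open>v\<^sup>2 + u v - u\<^sup>3 = 0\<close>, which for \<open>m > 1\<close> is crossed inwards only.  Orbits starting between the two branches
  of the curve are trapped and give the solutions tending to \<open>0\<close>; all other orbits leave \<open>u < 0\<close> or are unbounded,
  since a bounded orbit along which \<open>u\<close> is monotone would have to end in an equilibrium.
  Hence \<open>a\<^sub>i = 1 / sqrt (- u\<^sub>i)\<close>.
\<close>

section \<open>Tools from analysis\<close>

text \<open>The equilibrium A is never linearised. Its Jacobian has determinant 1/6 and trace 7/6 -
  \<alpha> with \<alpha> = (m + 1)/2, so its stability changes with m, and trapped orbits need not
  converge to it. Only their boundedness is used: f always has a limit, and a positive limit would
  force f'/f^2 to tend to 0. The real obstacle is global: for m > 1 the stable curve has no closed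
  form, yet must be followed backwards past A. The function G = v^2 + u v - u^3 controls it. Near
  the origin it is positive on the curve, with leading factor \<alpha>^2 - \<alpha>; it equals -
  1/648 at A and u^3 (1 + 4 u) on the parabola; its positivity persists backwards while - 1/4 \<le>
  u \<le> 0 and v \<ge> 0. So the curve can neither end at A nor turn too early. The number - 1/4 is
  the abscissa where the loop G = 0 meets the parabola away from the origin. On the stable curve u
  decays like exp (- \<alpha> s), so it is integrable, and since df/ds = u f the limit of f is
  positive.\<close>

lemma picard_iterate_bound:
  fixes F :: "'a::euclidean_space \<Rightarrow> 'a"
  assumes L: "L > 0" and lip: "\<And>x y. norm (F x - F y) \<le> L * norm (x - y)"
    and Y0: "\<And>t. Y 0 t = y0"
    and YS: "\<And>n t. Y (Suc n) t = y0 + integral {0..t} (\<lambda>s. F (Y n s))"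
    and cont: "\<And>n T. continuous_on {0..T} (Y n)"
    and t: "t \<ge> 0"
  shows "norm (Y (Suc n) t - Y n t) \<le> (norm (F y0) / (2*L)) * exp (2*L*t) * (1/2)^n"
  using t
proof (induction n arbitrary: t)
  case 0
  have "integral {0..t} (\<lambda>s. F (Y 0 s)) = t *\<^sub>R F y0"
    using 0 by (simp add: Y0)
  then have "norm (Y (Suc 0) t - Y 0 t) = t * norm (F y0)"
    using 0 by (simp add: YS Y0)
  also have "\<dots> = (norm (F y0) / (2*L)) * (2*L*t)"
    using L by (simp add: field_simps)
  also have "\<dots> \<le> (norm (F y0) / (2*L)) * exp (2*L*t)"
    using L exp_ge_add_one_self[of "2*L*t"] by (intro mult_left_mono) (linarith, simp)
  finally show ?case by simp
next
  case (Suc n)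
  define C where "C = norm (F y0) / (2*L)"
  have contF: "continuous_on {0..t} (\<lambda>s. F (Y n s))" for n
  proof -
    have "continuous_on UNIV F"
      by (rule lipschitz_on_continuous_on[of L])
        (use lip L in \<open>auto simp: lipschitz_on_def dist_norm\<close>)
    then show ?thesis
      using cont[of t n] by (rule continuous_on_compose2) auto
  qed
  \<comment> \<open>The weight exp (2 L t) gains a factor 1/2 per iteration, since L times its
    integral over [0, t] is at most half of it. The increments are thus dominated by a geometric
    series on every bounded interval, however long.\<close>
  have int: "((\<lambda>s. L * (C * exp (2 * L * s) * (1/2)^n)) has_integral
     (C/2 * exp (2*L*t) * (1/2)^n - C/2 * exp (2*L*0) * (1/2)^n)) {0..t}"
    by (rule fundamental_theorem_of_calculus)
      (use Suc.prems in \<open>auto intro!: derivative_eq_intros simp flip: has_real_derivative_iff_has_vector_derivative\<close>)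
  have "Y (Suc (Suc n)) t - Y (Suc n) t = integral {0..t} (\<lambda>s. F (Y (Suc n) s) - F (Y n s))"
    unfolding YS[of "Suc n"] YS[of n t]
    by (subst Henstock_Kurzweil_Integration.integral_diff) (auto intro!: integrable_continuous_interval contF)
  also have "norm \<dots> \<le> integral {0..t} (\<lambda>s. L * (C * exp (2 * L * s) * (1/2)^n))"
  proof (rule integral_norm_bound_integral)
    show "(\<lambda>s. F (Y (Suc n) s) - F (Y n s)) integrable_on {0..t}"
      by (intro integrable_continuous_interval continuous_intros contF)
    show "(\<lambda>s. L * (C * exp (2 * L * s) * (1/2)^n)) integrable_on {0..t}"
      using int by blast
    show "norm (F (Y (Suc n) s) - F (Y n s)) \<le> L * (C * exp (2 * L * s) * (1/2)^n)" if "s \<in> {0..t}" for s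
      using Suc.IH[of s] that L lip[of "Y (Suc n) s" "Y n s"] unfolding C_def
      by (meson atLeastAtMost_iff less_imp_le mult_left_mono order_trans)
  qed
  also have "\<dots> = C/2 * exp (2*L*t) * (1/2)^n - C/2 * exp (2*L*0) * (1/2)^n"
    using int by (rule integral_unique)
  also have "\<dots> \<le> C * exp (2*L*t) * (1/2)^Suc n"
    using L by (simp add: C_def)
  finally show ?case by (simp add: C_def)
qed

text \<open>A global Lipschitz bound excludes blow-up, so no continuation argument is needed. The
  quadratic planar field has no such bound; the theorem is applied to a truncation of it.\<close>

theorem picard_lindeloef_global:
  fixes F :: "'a::euclidean_space \<Rightarrow> 'a"
  assumes lip: "\<And>x y. norm (F x - F y) \<le> L * norm (x - y)"
  obtains y where "y 0 = y0"
    "\<And>t. t \<ge> 0 \<Longrightarrow> (y has_vector_derivative F (y t)) (at t within {0..})"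
proof -
  \<comment> \<open>The constant \<open>L\<close> may be zero or negative, while the iterate bound
    divides by it.\<close>
  define L' where "L' = max L 1"
  have L: "L' > 0" by (simp add: L'_def)
  have lip: "norm (F x - F y) \<le> L' * norm (x - y)" for x y
    using lip[of x y] mult_right_mono[of L L' "norm (x - y)"] by (simp add: L'_def)
  define Y where "Y = rec_nat (\<lambda>t::real. y0) (\<lambda>n Yn t. y0 + integral {0..t} (\<lambda>s. F (Yn s)))"
  have Y0: "Y 0 t = y0" for t by (simp add: Y_def)
  have YS: "Y (Suc n) t = y0 + integral {0..t} (\<lambda>s. F (Y n s))" for n t by (simp add: Y_def)
  have contF: "continuous_on UNIV F"
    by (rule lipschitz_on_continuous_on[of L'])
      (use lip L in \<open>auto simp: lipschitz_on_def dist_norm\<close>)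
  have cont: "continuous_on {0..T} (Y n)" for n T
  proof (induction n)
    case 0
    then show ?case by (simp add: Y0[abs_def])
  next
    case (Suc n)
    have "continuous_on {0..T} (\<lambda>s. F (Y n s))"
      using contF Suc by (rule continuous_on_compose2) auto
    then have "continuous_on {0..T} (\<lambda>t. integral {0..t} (\<lambda>s. F (Y n s)))"
      using indefinite_integral_continuous_1 integrable_continuous_real by blast
    then show ?case unfolding YS[abs_def] by (intro continuous_intros)
  qed
  define C where "C = norm (F y0) / (2*L')"
  have bound: "norm (Y (Suc n) t - Y n t) \<le> C * exp (2*L'*t) * (1/2)^n" if "t \<ge> 0" for n t
    unfolding C_def by (rule picard_iterate_bound[OF L lip Y0 YS cont that])
  have C: "C \<ge> 0" using L by (simp add: C_def)
  define y where "y t = y0 + (\<Sum>n. Y (Suc n) t - Y n t)" for t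
  have ul: "uniform_limit {0..T} Y y sequentially" for T
  proof -
    have "uniform_limit {0..T} (\<lambda>n t. \<Sum>i<n. Y (Suc i) t - Y i t) (\<lambda>t. \<Sum>i. Y (Suc i) t - Y i t) sequentially"
    proof (rule Weierstrass_m_test)
      show "norm (Y (Suc n) t - Y n t) \<le> C * exp (2*L'*T) * (1/2)^n" if "t \<in> {0..T}" for n t
      proof -
        have "C * exp (2*L'*t) * (1/2)^n \<le> C * exp (2*L'*T) * (1/2)^n"
          using that L C by (intro mult_left_mono mult_right_mono) auto
        then show ?thesis using bound[of t n] that by auto
      qed
      show "summable (\<lambda>n. C * exp (2 * L' * T) * (1/2::real) ^ n)"
        by (intro summable_mult summable_geometric) simp
    qed
    then have "uniform_limit {0..T} (\<lambda>n t. y0 + (\<Sum>i<n. Y (Suc i) t - Y i t)) y sequentially"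
      unfolding y_def by (intro uniform_limit_intros)
    moreover have "y0 + (\<Sum>i<n. Y (Suc i) t - Y i t) = Y n t" for n t
      by (subst sum_lessThan_telescope) (simp add: Y0)
    ultimately show ?thesis by simp
  qed
  have conty: "continuous_on {0..T} y" for T
    by (rule uniform_limit_theorem[OF _ ul]) (use cont in auto)
  have contFy: "continuous_on {0..T} (\<lambda>s. F (y s))" for T
    using contF conty by (rule continuous_on_compose2) auto
  have eq: "y t = y0 + integral {0..t} (\<lambda>s. F (y s))" if "t \<ge> 0" for t
  proof -
    have unif: "uniform_limit {0..t} (\<lambda>n s. F (Y n s)) (\<lambda>s. F (y s)) sequentially"
    proof (rule uniform_limitI)
      fix e :: real assume e: "e > 0"
      have "\<forall>\<^sub>F n in sequentially. \<forall>s\<in>{0..t}. dist (Y n s) (y s) < e / L'"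
        using ul e L by (intro uniform_limitD) auto
      then show "\<forall>\<^sub>F n in sequentially. \<forall>s\<in>{0..t}. dist (F (Y n s)) (F (y s)) < e"
      proof eventually_elim
        case (elim n)
        then show ?case
          using L lip by (auto simp: dist_norm field_simps intro: order.strict_trans1)
      qed
    qed
    have "continuous_on {0..t} (\<lambda>s. F (Y n s))" for n
      using contF cont by (rule continuous_on_compose2) auto
    then obtain I J where IJ: "\<And>n. ((\<lambda>s. F (Y n s)) has_integral I n) {0..t}"
      "((\<lambda>s. F (y s)) has_integral J) {0..t}" "I \<longlonglongrightarrow> J"
      using uniform_limit_integral[OF unif] by auto
    have "(\<lambda>n. Y (Suc n) t) \<longlonglongrightarrow> y0 + J"
      unfolding YS integral_unique[OF IJ(1)] by (intro tendsto_intros IJ(3))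
    moreover have "(\<lambda>n. Y (Suc n) t) \<longlonglongrightarrow> y t"
      using tendsto_uniform_limitI[OF ul, of t t] that LIMSEQ_Suc by auto
    ultimately have "y t = y0 + J" by (metis LIMSEQ_unique)
    then show ?thesis using IJ(2) by (simp add: integral_unique)
  qed
  show ?thesis
  proof (rule that)
    show "y 0 = y0" using eq[of 0] by simp
    fix t :: real assume t: "t \<ge> 0"
    have "((\<lambda>u. y0 + integral {0..u} (\<lambda>s. F (y s))) has_vector_derivative F (y t)) (at t within {0..t+1})"
      using integral_has_vector_derivative[OF contFy, of t "t+1"] t
      by (auto intro!: derivative_eq_intros)
    then have "(y has_vector_derivative F (y t)) (at t within {0..t+1})"
      by (rule has_vector_derivative_transform[rotated 2]) (use t eq in auto)
    moreover have "at t within {0..t+1} = at t within {0..}"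
      using t by (intro at_within_nhd[of _ "{t-1<..<t+1}"]) auto
    ultimately show "(y has_vector_derivative F (y t)) (at t within {0..})" by simp
  qed
qed

section \<open>Gluing of derivatives, asymptotics and change of time\<close>

lemma has_real_derivative_two_sided:
  fixes f :: "real \<Rightarrow> real"
  assumes "(f has_real_derivative D) (at x within {..x})" "(f has_real_derivative D) (at x within {x..})"
  shows "(f has_real_derivative D) (at x)"
proof -
  have "{..x} \<union> {x..} = UNIV" by auto
  then show ?thesis using assms unfolding has_field_derivative_iff
    using Lim_within_Un[of _ D x "{..x}" "{x..}"] by simp
qed

text \<open>If x converges, the mean value theorem finds a point of small slope in every late window
  of length h, and y moves by at most h (|B| + 1) = e/2 within the window. This turns convergence of
  a coordinate into the vanishing of its derivative.\<close>

lemma barbalat: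
  fixes x y :: "real \<Rightarrow> real"
  assumes x: "\<And>s. s \<ge> a \<Longrightarrow> (x has_real_derivative y s) (at s within {a..})"
    and y: "\<And>s. s \<ge> a \<Longrightarrow> (y has_real_derivative z s) (at s within {a..})"
    and z: "\<And>s. s \<ge> a \<Longrightarrow> \<bar>z s\<bar> \<le> B"
    and lim: "(x \<longlongrightarrow> l) at_top"
  shows "(y \<longlongrightarrow> 0) at_top"
proof (rule tendstoI)
  fix e :: real assume e: "e > 0"
  define h where "h = e / (2 * (\<bar>B\<bar> + 1))"
  have h: "h > 0" "(\<bar>B\<bar>+1) * h = e/2" using e by (auto simp: h_def field_simps)
  have xat: "DERIV x s :> y s" if "s > a" for s
    using x[of s] that by (simp add: at_within_interior[of s "{a..}"])
  have yat: "DERIV y s :> z s" if "s > a" for s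
    using y[of s] that by (simp add: at_within_interior[of s "{a..}"])
  have "((\<lambda>s. x (s + h)) \<longlongrightarrow> l) at_top"
    using lim by (rule filterlim_compose)
      (use filterlim_tendsto_add_at_top[OF tendsto_const[of h] filterlim_ident] in \<open>simp add: add.commute\<close>)
  then have "((\<lambda>s. x (s + h) - x s) \<longlongrightarrow> l - l) at_top"
    using lim by (intro tendsto_intros)
  then have "\<forall>\<^sub>F s in at_top. dist (x (s+h) - x s) 0 < h * e / 2"
    using h e by (intro tendstoD) auto
  moreover have "\<forall>\<^sub>F s in at_top. s > a" by (rule eventually_gt_at_top)
  ultimately show "\<forall>\<^sub>F s in at_top. dist (y s) 0 < e"
  proof eventually_elim
    case (elim s)
    obtain r where r: "s < r" "r < s + h" "x (s+h) - x s = (s + h - s) * y r"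
      using MVT2[of s "s+h" x y] h xat elim by auto
    have "h * \<bar>y r\<bar> < h * e / 2" using elim r h by (simp add: dist_real_def abs_mult)
    then have 1: "\<bar>y r\<bar> < e / 2" using h by (simp add: field_simps)
    obtain q where q: "s < q" "q < r" "y r - y s = (r - s) * z q"
      using MVT2[of s r y z] r yat elim by auto
    have "\<bar>y r - y s\<bar> \<le> h * (\<bar>B\<bar> + 1)"
      unfolding q(3) abs_mult using r q elim z[of q] by (intro mult_mono) auto
    then show ?case using 1 h by (simp add: dist_real_def mult.commute)
  qed
qed

text \<open>\<open>T\<close> inverts the integral of g. With g = f it passes from a solution to the
  time s with ds = f dt; with g = 1/f as a function of s it goes back.\<close>

lemma time_change:
  fixes g :: "real \<Rightarrow> real"
  assumes cont: "continuous_on {0..} g" and pos: "\<And>t. t \<ge> 0 \<Longrightarrow> g t > 0"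
    and unbdd: "\<And>K. \<exists>t\<ge>0. integral {0..t} g \<ge> K"
  obtains T :: "real \<Rightarrow> real" where "T 0 = 0"
    "\<And>s. s \<ge> 0 \<Longrightarrow> T s \<ge> 0"
    "\<And>s. s \<ge> 0 \<Longrightarrow> (T has_real_derivative 1 / g (T s)) (at s within {0..})"
    "filterlim T at_top at_top"
    "\<And>t. t \<ge> 0 \<Longrightarrow> T (integral {0..t} g) = t"
proof -
  \<comment> \<open>Continuing the integral to t < 0 with the constant slope g 0 makes
    \<open>S\<close> a differentiable bijection of the whole line, so the inverse function rule
    applies at 0 as well.\<close>
  define S where "S t = (if t \<ge> 0 then integral {0..t} g else g 0 * t)" for t
  define h where "h t = g (max t 0)" for t
  have hpos: "h t > 0" for t by (simp add: h_def pos)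
  have SD: "DERIV S t :> h t" for t
  proof -
    have right: "(S has_real_derivative h t) (at t within {0..})" if "t \<ge> 0" for t
    proof -
      have "((\<lambda>x. integral {0..x} g) has_real_derivative g t) (at t within {0..t+1})"
        using that by (intro integral_has_real_derivative continuous_on_subset[OF cont]) auto
      then have "(S has_real_derivative g t) (at t within {0..t+1})"
        unfolding has_real_derivative_iff_has_vector_derivative
        by (rule has_vector_derivative_transform[rotated 2]) (use that in \<open>auto simp: S_def\<close>)
      moreover have "at t within {0..t+1} = at t within {0..}"
        using that by (intro at_within_nhd[of _ "{t-1<..<t+1}"]) auto
      ultimately show ?thesis using that by (simp add: h_def max_def)
    qed
    have left: "(S has_real_derivative h t) (at t within {..0})" if "t \<le> 0" for t
    proof -
      have "((\<lambda>t. g 0 * t) has_real_derivative g 0) (at t within {..0})"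
        by (auto intro!: derivative_eq_intros)
      then have "(S has_real_derivative g 0) (at t within {..0})"
        unfolding has_real_derivative_iff_has_vector_derivative
        by (rule has_vector_derivative_transform[rotated 2]) (use that in \<open>auto simp: S_def\<close>)
      then show ?thesis using that by (simp add: h_def max_def)
    qed
    consider "t > 0" | "t < 0" | "t = 0" by linarith
    then show ?thesis
    proof cases
      case 1
      then show ?thesis using right[of t] by (simp add: at_within_interior[of t "{0..}"])
    next
      case 2
      then show ?thesis using left[of t] by (simp add: at_within_interior[of t "{..0}"])
    next
      case 3
      then show ?thesis using left[of t] right[of t] by (auto intro: has_real_derivative_two_sided)
    qed
  qed
  have Smono: "strict_mono S"
    by (rule strict_monoI, rule DERIV_pos_imp_increasing) (use SD hpos in blast)+
  have Scont: "continuous_on A S" for A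
    using SD by (meson DERIV_isCont continuous_at_imp_continuous_on)
  have surj: "\<exists>t. S t = s" for s
  proof -
    obtain t1 where t1: "t1 \<ge> 0" "S t1 \<ge> s" using unbdd[of s] by (auto simp: S_def)
    define t0 where "t0 = min (-1) (s / g 0 - 1)"
    have "S t0 = g 0 * t0" by (simp add: S_def t0_def)
    also have "\<dots> \<le> g 0 * (s / g 0)"
      using pos[of 0] by (intro mult_left_mono) (auto simp: t0_def)
    finally have "S t0 \<le> g 0 * (s / g 0)" .
    then have "S t0 \<le> s" using pos[of 0] by simp
    moreover have "t0 \<le> t1" using t1 by (simp add: t0_def)
    ultimately show ?thesis using IVT'[of S t0 s t1] t1 Scont by blast
  qed
  define T where "T = inv S"
  have ST: "S (T s) = s" for s using surj[of s] by (auto simp: T_def intro: f_inv_into_f)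
  have TS: "T (S t) = t" for t
    using Smono by (simp add: T_def inv_f_f strict_mono_imp_inj_on)
  have Tmono: "T s \<le> T s' \<longleftrightarrow> s \<le> s'" for s s'
    by (metis ST Smono strict_mono_less_eq)
  have Tcont: "isCont T s" for s
  proof -
    have "isCont T (S (T s))"
    proof (rule isCont_inverse_function[of 1 _ T S])
      show "isCont S z" for z using SD[of z] by (rule DERIV_isCont)
    qed (simp_all add: TS)
    then show ?thesis by (simp add: ST)
  qed
  have T0: "T 0 = 0" using TS[of 0] by (simp add: S_def)
  have TD: "DERIV T s :> 1 / h (T s)" for s
  proof -
    have "DERIV T s :> inverse (h (T s))"
      by (rule DERIV_inverse_function[of S, where a = "s-1" and b = "s+1"])
        (use SD hpos[of "T s"] ST Tcont in auto)
    then show ?thesis by (simp add: inverse_eq_divide)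
  qed
  show ?thesis
  proof (rule that)
    show "T 0 = 0" by fact
    show nn: "T s \<ge> 0" if "s \<ge> 0" for s using Tmono[of 0 s] T0 that by simp
    show "(T has_real_derivative 1 / g (T s)) (at s within {0..})" if "s \<ge> 0" for s
      using TD[of s] nn[OF that] by (auto simp: h_def max_def intro: has_field_derivative_at_within)
    show "filterlim T at_top at_top"
      unfolding filterlim_at_top
    proof
      fix Z
      show "\<forall>\<^sub>F s in at_top. Z \<le> T s"
        using eventually_ge_at_top[of "S Z"]
        by eventually_elim (metis TS Tmono)
    qed
    show "T (integral {0..t} g) = t" if "t \<ge> 0" for t
      using TS[of t] that by (simp add: S_def)
  qed
qed

section \<open>Extremal zeros, monotone limits and consequences of the sign of a derivative\<close>

lemma isCont_le_right:
  fixes g :: "real \<Rightarrow> real"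
  assumes "isCont g q" "q < b" "\<And>r. q < r \<Longrightarrow> r < b \<Longrightarrow> g r \<le> B"
  shows "g q \<le> B"
proof (rule tendsto_upperbound)
  show "(g \<longlongrightarrow> g q) (at_right q)"
    using assms(1) continuous_at_imp_continuous_at_within continuous_within by blast
  show "\<forall>\<^sub>F r in at_right q. g r \<le> B"
    by (rule eventually_mono[OF eventually_at_right_real[OF assms(2)]]) (use assms(3) in auto)
qed simp

lemma last_zero:
  fixes g :: "real \<Rightarrow> real"
  assumes g: "continuous_on {a..b} g" and ab: "a \<le> b" "g a \<le> 0" "g b > 0"
  obtains t where "a \<le> t" "t < b" "g t = 0" "\<And>r. t < r \<Longrightarrow> r \<le> b \<Longrightarrow> g r > 0"
proof -
  define Z where "Z = {a..b} \<inter> g -` {..0}"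
  have "closed Z" unfolding Z_def by (rule continuous_closed_preimage[OF g]) auto
  moreover have "a \<in> Z" using ab by (simp add: Z_def)
  moreover have bZ: "bdd_above Z" by (auto simp: Z_def)
  ultimately have "Sup Z \<in> Z" using closed_contains_Sup by blast
  define t where "t = Sup Z"
  have t: "a \<le> t" "t \<le> b" "g t \<le> 0" using \<open>Sup Z \<in> Z\<close> unfolding t_def[symmetric] by (auto simp: Z_def)
  have after: "g r > 0" if "t < r" "r \<le> b" for r
  proof -
    have "r \<notin> Z" using that bZ cSup_upper[of r Z] by (auto simp: t_def)
    then show ?thesis using that t by (auto simp: Z_def)
  qed
  have "continuous_on {t..b} g" using g t(1) by (auto intro: continuous_on_subset)
  then obtain x where x: "t \<le> x" "x \<le> b" "g x = 0" using IVT'[of g t 0 b] t ab by auto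
  then have "x = t" using after[of x] by (cases "x = t") auto
  moreover have "t \<noteq> b" using t(3) ab(3) by auto
  ultimately show ?thesis using that[OF t(1)] t(2) x(3) after by simp
qed

lemma first_zero:
  fixes g :: "real \<Rightarrow> real"
  assumes g: "continuous_on {a..b} g" and ab: "a \<le> b" "g a > 0" "g b \<le> 0"
  obtains t where "a < t" "t \<le> b" "g t = 0" "\<And>r. a \<le> r \<Longrightarrow> r < t \<Longrightarrow> g r > 0"
proof -
  have "continuous_on {- b..- a} (\<lambda>r. g (- r))"
    by (rule continuous_on_compose2[OF g]) (auto intro: continuous_intros)
  then obtain t where t: "- b \<le> t" "t < - a" "g (- t) = 0" "\<And>r. t < r \<Longrightarrow> r \<le> - a \<Longrightarrow> g (- r) > 0"
    by (rule last_zero) (use ab in auto)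
  show ?thesis
  proof (rule that[of "- t"])
    show "g r > 0" if "a \<le> r" "r < - t" for r using t(4)[of "- r"] that by simp
  qed (use t in auto)
qed

lemma monotone_bounded_limit:
  fixes f :: "real \<Rightarrow> real"
  assumes mono: "\<And>x y. a \<le> x \<Longrightarrow> x \<le> y \<Longrightarrow> f x \<le> f y" and bd: "\<And>x. a \<le> x \<Longrightarrow> f x \<le> B"
  obtains l where "(f \<longlongrightarrow> l) at_top" "\<And>x. a \<le> x \<Longrightarrow> f x \<le> l" "l \<le> B"
proof -
  have bdd: "bdd_above (f ` {a..})" using bd by (auto simp: bdd_above_def)
  define l where "l = Sup (f ` {a..})"
  have le: "f x \<le> l" if "a \<le> x" for x
    unfolding l_def using that bdd by (intro cSup_upper) auto
  have "(f \<longlongrightarrow> l) at_top"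
  proof (rule increasing_tendsto)
    show "\<forall>\<^sub>F x in at_top. f x \<le> l" using le by (auto simp: eventually_at_top_linorder)
    fix y assume "y < l"
    then obtain x where x: "a \<le> x" "y < f x" using less_cSup_iff[OF _ bdd] by (auto simp: l_def)
    then have "y < f z" if "z \<ge> x" for z using mono[of x z] that by linarith
    then show "\<forall>\<^sub>F x in at_top. y < f x" by (auto simp: eventually_at_top_linorder)
  qed
  moreover have "l \<le> B" unfolding l_def using bd by (intro cSup_least) auto
  ultimately show ?thesis using le that by blast
qed

lemma antimono_bounded_limit:
  fixes f :: "real \<Rightarrow> real"
  assumes "\<And>x y. a \<le> x \<Longrightarrow> x \<le> y \<Longrightarrow> f y \<le> f x" "\<And>x. a \<le> x \<Longrightarrow> B \<le> f x"
  obtains l where "(f \<longlongrightarrow> l) at_top" "\<And>x. a \<le> x \<Longrightarrow> l \<le> f x" "B \<le> l"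
proof -
  obtain l where l: "((\<lambda>x. - f x) \<longlongrightarrow> l) at_top" "\<And>x. a \<le> x \<Longrightarrow> - f x \<le> l" "l \<le> - B"
    using monotone_bounded_limit[of a "\<lambda>x. - f x" "- B"] assms by auto
  show ?thesis
  proof (rule that[of "- l"])
    show "(f \<longlongrightarrow> - l) at_top" using tendsto_minus[OF l(1)] by simp
    show "- l \<le> f x" if "a \<le> x" for x using l(2)[OF that] by linarith
    show "B \<le> - l" using l(3) by linarith
  qed
qed

lemma DERIV_pos_less:
  fixes g g' :: "real \<Rightarrow> real"
  assumes "x < y" "continuous_on {x..y} g" "\<And>s. x < s \<Longrightarrow> s < y \<Longrightarrow> DERIV g s :> g' s \<and> g' s > 0"
  shows "g x < g y"
  by (rule DERIV_pos_imp_increasing_open[OF assms(1)]) (use assms in blast)+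

lemma DERIV_nonneg_le:
  fixes g g' :: "real \<Rightarrow> real"
  assumes "x \<le> y" "continuous_on {x..y} g" "\<And>s. x < s \<Longrightarrow> s < y \<Longrightarrow> DERIV g s :> g' s \<and> g' s \<ge> 0"
  shows "g x \<le> g y"
  by (rule DERIV_nonneg_imp_increasing_open[OF assms(1)]) (use assms in blast)+

lemma DERIV_neg_less:
  fixes g g' :: "real \<Rightarrow> real"
  assumes "x < y" "continuous_on {x..y} g" "\<And>s. x < s \<Longrightarrow> s < y \<Longrightarrow> DERIV g s :> g' s \<and> g' s < 0"
  shows "g y < g x"
  by (rule DERIV_neg_imp_decreasing_open[OF assms(1)]) (use assms in blast)+

lemma DERIV_nonpos_le:
  fixes g g' :: "real \<Rightarrow> real"
  assumes "x \<le> y" "continuous_on {x..y} g" "\<And>s. x < s \<Longrightarrow> s < y \<Longrightarrow> DERIV g s :> g' s \<and> g' s \<le> 0"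
  shows "g y \<le> g x"
  by (rule DERIV_nonpos_imp_decreasing_open[OF assms(1)]) (use assms in blast)+

text \<open>The derivative is required in the interior only, since convexity is needed on sets
  containing 0, where f has just a one-sided derivative. The mean value theorem compares the chords
  on both sides of z.\<close>

lemma convex_on_of_mono_deriv:
  fixes f f' :: "real \<Rightarrow> real"
  assumes A: "convex A" and cont: "continuous_on A f"
    and der: "\<And>x. x \<in> interior A \<Longrightarrow> DERIV f x :> f' x"
    and mono: "\<And>x y. x \<in> interior A \<Longrightarrow> y \<in> interior A \<Longrightarrow> x \<le> y \<Longrightarrow> f' x \<le> f' y"
  shows "convex_on A f"
proof (rule convex_on_linorderI)
  fix t x y :: real
  assume t: "t > 0" "t < 1" and xy: "x \<in> A" "y \<in> A" "x < y"
  define z where "z = (1 - t) *\<^sub>R x + t *\<^sub>R y"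
  have zx: "z - x = t * (y - x)" "y - z = (1 - t) * (y - x)" by (simp_all add: z_def algebra_simps)
  have "z - x > 0" "y - z > 0" unfolding zx using t xy by simp_all
  then have z: "x < z" "z < y" by simp_all
  have sub: "{x..y} \<subseteq> A"
    using A xy by (metis closed_segment_eq_real_ivl convex_contains_segment less_imp_le)
  then have int: "r \<in> interior A" if "x < r" "r < y" for r
    using that interior_mono[OF sub] by (auto simp: interior_atLeastAtMost_real)
  have subs: "{x..z} \<subseteq> A" "{z..y} \<subseteq> A" using sub z by auto
  have diff: "f differentiable at r" if "x < r" "r < y" for r
    using der[OF int[OF that]] real_differentiable_def by blast
  have diffs: "f differentiable at r" if "x < r" "r < z" for r using diff that z by simp
  have diffs': "f differentiable at r" if "z < r" "r < y" for r using diff that z by simp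
  obtain l1 c1 where c1: "x < c1" "c1 < z" "DERIV f c1 :> l1" "f z - f x = (z - x) * l1"
    using MVT[OF z(1) continuous_on_subset[OF cont subs(1)] diffs] by blast
  obtain l2 c2 where c2: "z < c2" "c2 < y" "DERIV f c2 :> l2" "f y - f z = (y - z) * l2"
    using MVT[OF z(2) continuous_on_subset[OF cont subs(2)] diffs'] by blast
  have "c1 \<in> interior A" "c2 \<in> interior A" using int c1 c2 z by auto
  then have "l1 \<le> l2"
    using mono[of c1 c2] DERIV_unique[OF c1(3) der] DERIV_unique[OF c2(3) der] c1 c2 by auto
  then have le: "((1 - t) * t * (y - x)) * l1 \<le> ((1 - t) * t * (y - x)) * l2"
    using t xy by (intro mult_left_mono) auto
  have eq1: "(1 - t) * (f z - f x) = ((1 - t) * t * (y - x)) * l1" using c1(4) zx by simp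
  have eq2: "t * (f y - f z) = ((1 - t) * t * (y - x)) * l2" using c2(4) zx by simp
  have "(1 - t) * (f z - f x) \<le> t * (f y - f z)" unfolding eq1 eq2 by (rule le)
  then show "f ((1 - t) *\<^sub>R x + t *\<^sub>R y) \<le> (1 - t) * f x + t * f y"
    unfolding z_def[symmetric] by (simp add: algebra_simps)
qed (rule A)

section \<open>Linear differential inequalities solved by an integrating factor\<close>

lemma DERIV_integrating_factor:
  fixes g p :: "real \<Rightarrow> real"
  assumes p: "continuous_on {a..b} p" and s: "a < s" "s < b" and g: "DERIV g s :> d"
  shows "DERIV (\<lambda>s. g s * exp (- integral {a..s} p)) s :> (d - p s * g s) * exp (- integral {a..s} p)"
proof -
  have "((\<lambda>s. integral {a..s} p) has_real_derivative p s) (at s within {a..b})"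
    using s by (intro integral_has_real_derivative p) auto
  then have "DERIV (\<lambda>s. integral {a..s} p) s :> p s"
    using s by (simp add: at_within_interior[of s "{a..b}"])
  then show ?thesis
    using g by (auto intro!: derivative_eq_intros simp: algebra_simps)
qed

text \<open>The bound holds for g of either sign, and upper bounds come from applying it to - g. Its
  main use is that the sign of g at one end decides the sign at the other.\<close>

lemma linear_growth:
  fixes g p :: "real \<Rightarrow> real"
  assumes ab: "a \<le> b" and g: "continuous_on {a..b} g" and p: "continuous_on {a..b} p"
    and der: "\<And>s. a < s \<Longrightarrow> s < b \<Longrightarrow> \<exists>d. DERIV g s :> d \<and> d \<ge> p s * g s"
  shows "g a * exp (integral {a..b} p) \<le> g b"
proof -
  have "g a * exp (- integral {a..a} p) \<le> g b * exp (- integral {a..b} p)"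
  proof (rule DERIV_nonneg_imp_increasing_open[OF ab])
    fix s assume s: "a < s" "s < b"
    then show "\<exists>y. DERIV (\<lambda>s. g s * exp (- integral {a..s} p)) s :> y \<and> y \<ge> 0"
      using der DERIV_integrating_factor[OF p s]
      by (meson diff_ge_0_iff_ge exp_ge_zero mult_nonneg_nonneg)
  qed (intro continuous_intros g indefinite_integral_continuous_1 integrable_continuous_real p)
  then show ?thesis by (simp add: exp_minus field_simps)
qed

lemma linear_growth_strict:
  fixes g p :: "real \<Rightarrow> real"
  assumes ab: "a < b" and g: "continuous_on {a..b} g" and p: "continuous_on {a..b} p"
    and der: "\<And>s. a < s \<Longrightarrow> s < b \<Longrightarrow> \<exists>d. DERIV g s :> d \<and> d > p s * g s"
  shows "g a * exp (integral {a..b} p) < g b"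
proof -
  have "g a * exp (- integral {a..a} p) < g b * exp (- integral {a..b} p)"
  proof (rule DERIV_pos_imp_increasing_open[OF ab])
    fix s assume s: "a < s" "s < b"
    then show "\<exists>y. DERIV (\<lambda>s. g s * exp (- integral {a..s} p)) s :> y \<and> y > 0"
      using der DERIV_integrating_factor[OF p s]
      by (meson diff_gt_0_iff_gt exp_gt_zero mult_pos_pos)
  qed (intro continuous_intros g indefinite_integral_continuous_1 integrable_continuous_real p)
  then show ?thesis by (simp add: exp_minus field_simps)
qed

lemma linear_growth_zero:
  fixes g p :: "real \<Rightarrow> real"
  assumes ab: "a \<le> b" and g: "continuous_on {a..b} g" and p: "continuous_on {a..b} p"
    and der: "\<And>s. a < s \<Longrightarrow> s < b \<Longrightarrow> DERIV g s :> p s * g s"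
  shows "g b = g a * exp (integral {a..b} p)"
proof -
  have "g a * exp (integral {a..b} p) \<le> g b"
    by (rule linear_growth[OF ab g p]) (use der in blast)
  moreover have "(- g a) * exp (integral {a..b} p) \<le> - g b"
    by (rule linear_growth[OF ab _ p, where g = "\<lambda>x. - g x"])
      (use der g in \<open>auto intro!: continuous_intros derivative_eq_intros\<close>)
  ultimately show ?thesis by simp
qed

lemma quadratic_form_bound:
  fixes x y :: real
  shows "\<bar>A * x\<^sup>2 + B * (x * y) + C * y\<^sup>2\<bar> \<le> (\<bar>A\<bar> + \<bar>B\<bar> + \<bar>C\<bar>) * (x\<^sup>2 + y\<^sup>2)"
proof -
  have "2 * \<bar>x * y\<bar> \<le> x\<^sup>2 + y\<^sup>2"
    using sum_squares_bound[of "\<bar>x\<bar>" "\<bar>y\<bar>"] by (simp add: abs_mult)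
  then have xy: "\<bar>x * y\<bar> \<le> x\<^sup>2 + y\<^sup>2" by linarith
  have "\<bar>A * x\<^sup>2 + B * (x * y) + C * y\<^sup>2\<bar> \<le> \<bar>A\<bar> * x\<^sup>2 + \<bar>B\<bar> * \<bar>x * y\<bar> + \<bar>C\<bar> * y\<^sup>2"
    by (rule order_trans[OF abs_triangle_ineq add_mono[OF order_trans[OF abs_triangle_ineq]]])
      (simp_all add: abs_mult)
  also have "\<dots> \<le> \<bar>A\<bar> * (x\<^sup>2 + y\<^sup>2) + \<bar>B\<bar> * (x\<^sup>2 + y\<^sup>2) + \<bar>C\<bar> * (x\<^sup>2 + y\<^sup>2)"
    using xy by (intro add_mono mult_left_mono) auto
  finally show ?thesis by (simp add: algebra_simps)
qed

lemma abs_mult_le_sum_squares: "2 * \<bar>x * y\<bar> \<le> x\<^sup>2 + (y::real)\<^sup>2"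
  using sum_squares_bound[of "\<bar>x\<bar>" "\<bar>y\<bar>"] by (simp add: abs_mult)

section \<open>The planar system\<close>

text \<open>\<open>\<alpha>\<close> = (m + 1)/2 is the coefficient of f f'' in the equation, and -
  \<open>\<alpha>\<close> is the nonzero eigenvalue of the planar system at the origin.\<close>

locale similarity_flow =
  fixes \<alpha> m :: real
  assumes alpha: "\<alpha> > 1" and m: "m = 2 * \<alpha> - 1"
begin

lemma m_gt: "m > 1" using alpha m by simp

text \<open>
  \<open>u' = P u v\<close>, \<open>v' = Q u v\<close> is the equation for \<open>u = f' / f\<^sup>2\<close>, \<open>v = f'' / f\<^sup>3\<close> in the new time \<open>s\<close> with
  \<open>ds = f dt\<close>; the initial data are \<open>u = - 1 / a\<^sup>2\<close>, \<open>v = f''(0) / a\<^sup>3\<close>.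
\<close>

definition P :: "real \<Rightarrow> real \<Rightarrow> real" where "P u v = v - 2 * u\<^sup>2"
definition Q :: "real \<Rightarrow> real \<Rightarrow> real" where "Q u v = m * u\<^sup>2 - \<alpha> * v - 3 * u * v"
definition G :: "real \<Rightarrow> real \<Rightarrow> real" where "G u v = v\<^sup>2 + u * v - u^3"

definition orbit :: "real set \<Rightarrow> (real \<Rightarrow> real) \<Rightarrow> (real \<Rightarrow> real) \<Rightarrow> bool" where
  "orbit I u v \<longleftrightarrow> (\<forall>s\<in>I. (u has_real_derivative P (u s) (v s)) (at s within I) \<and>
     (v has_real_derivative Q (u s) (v s)) (at s within I))"

section \<open>Orbits and the quantities followed along them\<close>

lemma orbit_subset: "orbit I u v \<Longrightarrow> J \<subseteq> I \<Longrightarrow> orbit J u v"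
  unfolding orbit_def by (meson DERIV_subset subsetD)

lemma orbit_shift:
  assumes "orbit I u v" "\<And>s. s \<in> J \<Longrightarrow> s + c \<in> I"
  shows "orbit J (\<lambda>s. u (s + c)) (\<lambda>s. v (s + c))"
  unfolding orbit_def
proof (intro ballI conjI)
  fix s assume s: "s \<in> J"
  have sub: "(\<lambda>s. s + c) ` J \<subseteq> I" using assms(2) by auto
  have d: "((\<lambda>s. s + c) has_real_derivative 1) (at s within J)"
    by (auto intro!: derivative_eq_intros)
  have "(u has_real_derivative P (u (s+c)) (v (s+c))) (at (s+c) within I)"
    "(v has_real_derivative Q (u (s+c)) (v (s+c))) (at (s+c) within I)"
    using assms(1) assms(2)[OF s] by (auto simp: orbit_def)
  from this[THEN DERIV_subset, OF sub]
  have "(u \<circ> (\<lambda>s. s + c) has_real_derivative P (u (s+c)) (v (s+c)) * 1) (at s within J)"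
    "(v \<circ> (\<lambda>s. s + c) has_real_derivative Q (u (s+c)) (v (s+c)) * 1) (at s within J)"
    using DERIV_image_chain[OF _ d, of u] DERIV_image_chain[OF _ d, of v] by blast+
  then show "((\<lambda>s. u (s + c)) has_real_derivative P (u (s + c)) (v (s + c))) (at s within J)"
    "((\<lambda>s. v (s + c)) has_real_derivative Q (u (s + c)) (v (s + c))) (at s within J)"
    by (simp_all add: o_def)
qed

lemma orbit_continuous:
  assumes "orbit I u v" shows "continuous_on I u" "continuous_on I v"
  using assms unfolding orbit_def by (auto intro!: DERIV_continuous_on)

lemma orbit_DERIV:
  assumes "orbit I u v" "s \<in> interior I"
  shows "DERIV u s :> P (u s) (v s)" "DERIV v s :> Q (u s) (v s)"
  using assms interior_subset[of I] unfolding orbit_def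
  by (metis at_within_interior subsetD)+

lemma orbit_DERIV_Icc:
  assumes "orbit {a..b} u v" "a < s" "s < b"
  shows "DERIV u s :> P (u s) (v s)" "DERIV v s :> Q (u s) (v s)"
  using orbit_DERIV[OF assms(1), of s] assms by auto

text \<open>On the parabola P = 0 only - u^2 (1 + 6 u) remains. In u < 0 an orbit therefore crosses
  from P < 0 to P > 0 to the left of A, and the other way to its right.\<close>

lemma DERIV_P:
  assumes "DERIV u s :> P (u s) (v s)" "DERIV v s :> Q (u s) (v s)"
  shows "DERIV (\<lambda>s. P (u s) (v s)) s :> - (\<alpha> + 7 * u s) * P (u s) (v s) - (u s)\<^sup>2 * (1 + 6 * u s)"
  using assms unfolding P_def Q_def
  by (auto intro!: derivative_eq_intros simp: m power2_eq_square algebra_simps)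

text \<open>The factor \<alpha> - 1 = (m - 1)/2 vanishes exactly for m = 1, when G = 0 is invariant.
  The term u v (1 + 4 u) has a fixed sign for - 1/4 \<le> u \<le> 0 and v \<ge> 0.\<close>

lemma DERIV_G:
  assumes "DERIV u s :> P (u s) (v s)" "DERIV v s :> Q (u s) (v s)"
  shows "DERIV (\<lambda>s. G (u s) (v s)) s :>
    - (m + 6 * u s) * G (u s) (v s) + (\<alpha> - 1) * (u s * v s * (1 + 4 * u s))"
  using assms unfolding P_def Q_def G_def
  by (auto intro!: derivative_eq_intros simp: m power2_eq_square power3_eq_cube algebra_simps)

text \<open>The line v = - \<alpha> u is the eigenline of - \<alpha> at the origin, hence tangent
  there to the strong stable manifold. In terms of f the quantity is (f'' + \<alpha> f f') /
  f^3.\<close>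

lemma DERIV_k:
  assumes "DERIV u s :> P (u s) (v s)" "DERIV v s :> Q (u s) (v s)"
  shows "DERIV (\<lambda>s. v s + \<alpha> * u s) s :> - 3 * u s * (v s + \<alpha> * u s) + (3 * \<alpha> - 1) * (u s)\<^sup>2"
  using assms unfolding P_def Q_def
  by (auto intro!: derivative_eq_intros simp: m power2_eq_square algebra_simps)

lemma orbit_difference:
  assumes ab: "a \<le> b" and o1: "orbit {a..b} u v" and o2: "orbit {a..b} u' v'"
  obtains K where "\<And>s. a < s \<Longrightarrow> s < b \<Longrightarrow>
    \<exists>d. DERIV (\<lambda>s. (u s - u' s)\<^sup>2 + (v s - v' s)\<^sup>2) s :> d \<and>
      \<bar>d\<bar> \<le> K * ((u s - u' s)\<^sup>2 + (v s - v' s)\<^sup>2)"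
proof -
  have bdd: "\<exists>B. \<forall>s\<in>{a..b}. \<bar>g s\<bar> \<le> B" if "continuous_on {a..b} g" for g :: "real \<Rightarrow> real"
    using compact_imp_bounded[OF compact_continuous_image[OF that]] by (auto simp: bounded_iff)
  obtain B1 where B1: "\<And>s. s \<in> {a..b} \<Longrightarrow> \<bar>u s\<bar> \<le> B1"
    using bdd[OF orbit_continuous(1)[OF o1]] by blast
  obtain B2 where B2: "\<And>s. s \<in> {a..b} \<Longrightarrow> \<bar>u' s\<bar> \<le> B2"
    using bdd[OF orbit_continuous(1)[OF o2]] by blast
  obtain B3 where B3: "\<And>s. s \<in> {a..b} \<Longrightarrow> \<bar>v' s\<bar> \<le> B3"
    using bdd[OF orbit_continuous(2)[OF o2]] by blast
  note B = B1 B2 B3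
  define K where "K = 4 * (B1 + B2) + (2 + 2 * m * (B1 + B2) + 6 * B3) + (2 * \<alpha> + 6 * B1)"
  show ?thesis
  proof (rule that)
    fix s assume s: "a < s" "s < b"
    define x y where "x = u s - u' s" and "y = v s - v' s"
    \<comment> \<open>The differences of the quadratic right-hand sides factor through x and y;
      these are the coefficients of the resulting quadratic form.\<close>
    define A C E where "A = -4 * (u s + u' s)" and "C = 2 + 2 * m * (u s + u' s) - 6 * v' s"
      and "E = - 2 * \<alpha> - 6 * u s"
    have "DERIV (\<lambda>s. (u s - u' s)\<^sup>2 + (v s - v' s)\<^sup>2) s :> A * x\<^sup>2 + C * (x * y) + E * y\<^sup>2"
      using orbit_DERIV_Icc[OF o1 s] orbit_DERIV_Icc[OF o2 s]
      by (auto intro!: derivative_eq_intros simp: A_def C_def E_def x_def y_def P_def Q_def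
          power2_eq_square algebra_simps)
    moreover have "\<bar>A * x\<^sup>2 + C * (x * y) + E * y\<^sup>2\<bar> \<le> K * (x\<^sup>2 + y\<^sup>2)"
    proof -
      have s': "s \<in> {a..b}" using s by auto
      have u: "\<bar>u s + u' s\<bar> \<le> B1 + B2" using B(1)[OF s'] B(2)[OF s'] by linarith
      then have mu: "\<bar>m * (u s + u' s)\<bar> \<le> m * (B1 + B2)" using m_gt by (simp add: abs_mult)
      have "\<bar>A\<bar> \<le> 4 * (B1 + B2)" using u by (simp add: A_def abs_mult)
      moreover have "\<bar>C\<bar> \<le> 2 + 2 * m * (B1 + B2) + 6 * B3"
        using mu B(3)[OF s'] unfolding C_def abs_le_iff by (simp add: algebra_simps)
      moreover have "\<bar>E\<bar> \<le> 2 * \<alpha> + 6 * B1"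
        using B(1)[OF s'] alpha unfolding E_def abs_le_iff by simp
      ultimately have "\<bar>A\<bar> + \<bar>C\<bar> + \<bar>E\<bar> \<le> K" unfolding K_def by linarith
      then show ?thesis
        using quadratic_form_bound[of A x C y E] mult_right_mono[of _ K "x\<^sup>2 + y\<^sup>2"]
        by (smt (verit) sum_power2_ge_zero)
    qed
    ultimately show "\<exists>d. DERIV (\<lambda>s. (u s - u' s)\<^sup>2 + (v s - v' s)\<^sup>2) s :> d \<and>
      \<bar>d\<bar> \<le> K * ((u s - u' s)\<^sup>2 + (v s - v' s)\<^sup>2)"
      unfolding x_def y_def by blast
  qed
qed

text \<open>The squared distance changes at most exponentially in both directions of time, so it
  vanishes at both ends or at neither.\<close>

lemma orbit_unique_ends:
  assumes ab: "a \<le> b" and o1: "orbit {a..b} u v" and o2: "orbit {a..b} u' v'"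
  shows "u a = u' a \<and> v a = v' a \<longleftrightarrow> u b = u' b \<and> v b = v' b"
proof -
  define D where "D s = (u s - u' s)\<^sup>2 + (v s - v' s)\<^sup>2" for s
  obtain K where K: "\<And>s. a < s \<Longrightarrow> s < b \<Longrightarrow> \<exists>d. DERIV D s :> d \<and> \<bar>d\<bar> \<le> K * D s"
    unfolding D_def using orbit_difference[OF assms] by blast
  have cont: "continuous_on {a..b} D"
    unfolding D_def by (intro continuous_intros orbit_continuous[OF o1] orbit_continuous[OF o2])
  have "D a * exp (integral {a..b} (\<lambda>_. - K)) \<le> D b"
  proof (rule linear_growth[OF ab cont])
    fix s assume "a < s" "s < b"
    from K[OF this] show "\<exists>d. DERIV D s :> d \<and> d \<ge> - K * D s" by (force simp: abs_le_iff)
  qed auto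
  moreover have "- D a * exp (integral {a..b} (\<lambda>_. K)) \<le> - D b"
  proof (rule linear_growth[OF ab, where g = "\<lambda>s. - D s"])
    fix s assume "a < s" "s < b"
    from K[OF this] obtain d where "DERIV D s :> d" "\<bar>d\<bar> \<le> K * D s" by blast
    then show "\<exists>d. DERIV (\<lambda>s. - D s) s :> d \<and> d \<ge> K * - D s"
      by (intro exI[of _ "- d"]) (auto intro!: derivative_eq_intros)
  qed (use cont in \<open>auto intro!: continuous_intros\<close>)
  ultimately have "D a = 0 \<longleftrightarrow> D b = 0"
    by (smt (verit) D_def exp_gt_zero mult_eq_0_iff mult_pos_pos sum_power2_ge_zero zero_less_mult_iff)
  then show ?thesis by (auto simp: D_def sum_power2_eq_zero_iff)
qed

lemma orbit_unique:
  assumes "orbit {a..b} u v" "orbit {a..b} u' v'" "c \<in> {a..b}" "u c = u' c" "v c = v' c" "s \<in> {a..b}"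
  shows "u s = u' s" "v s = v' s"
proof -
  have "u s = u' s \<and> v s = v' s"
  proof (cases "c \<le> s")
    case True
    have "orbit {c..s} u v" "orbit {c..s} u' v'"
      using assms by (auto intro: orbit_subset)
    from orbit_unique_ends[OF True this] show ?thesis using assms by simp
  next
    case False
    have "orbit {s..c} u v" "orbit {s..c} u' v'"
      using assms by (auto intro: orbit_subset)
    from orbit_unique_ends[OF _ this] show ?thesis using assms False by simp
  qed
  then show "u s = u' s" "v s = v' s" by auto
qed

lemma orbit_const:
  assumes "P p q = 0" "Q p q = 0" shows "orbit I (\<lambda>_. p) (\<lambda>_. q)"
  using assms by (auto simp: orbit_def)

text \<open>The equation reads v' = (- \<alpha> - 3 u) v + m u^2 with a positive inhomogeneity. This
  is the planar form of the fact that f'', once nonnegative, stays so.\<close>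

lemma v_positive_forward:
  assumes ab: "a < b" and o: "orbit {a..b} u v" and v: "v a \<ge> 0" and u: "\<And>s. s \<in> {a..b} \<Longrightarrow> u s < 0"
  shows "v b > 0"
proof -
  have "v a * exp (integral {a..b} (\<lambda>s. - \<alpha> - 3 * u s)) < v b"
  proof (rule linear_growth_strict[OF ab])
    fix s assume s: "a < s" "s < b"
    have "(- \<alpha> - 3 * u s) * v s < Q (u s) (v s)"
      using u[of s] s m_gt by (simp add: Q_def algebra_simps)
    then show "\<exists>d. DERIV v s :> d \<and> (- \<alpha> - 3 * u s) * v s < d"
      using orbit_DERIV_Icc[OF o s] by blast
  qed (auto intro!: continuous_intros orbit_continuous[OF o])
  moreover have "v a * exp (integral {a..b} (\<lambda>s. - \<alpha> - 3 * u s)) \<ge> 0" using v by simp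
  ultimately show ?thesis by linarith
qed

text \<open>For \<open>m = 1\<close> the curve \<open>G = 0\<close> is an orbit homoclinic to the origin; for \<open>m > 1\<close> it is crossed inwards.\<close>

lemma G_positive_backward:
  assumes ab: "a \<le> b" and o: "orbit {a..b} u v" and G: "G (u b) (v b) > 0"
    and u: "\<And>s. s \<in> {a..b} \<Longrightarrow> u s \<le> 0" "\<And>s. s \<in> {a..b} \<Longrightarrow> u s \<ge> - 1/4"
    and v: "\<And>s. s \<in> {a..b} \<Longrightarrow> v s \<ge> 0"
  shows "G (u a) (v a) > 0"
proof -
  have "- G (u a) (v a) * exp (integral {a..b} (\<lambda>s. - (m + 6 * u s))) \<le> - G (u b) (v b)"
  proof (rule linear_growth[OF ab, where g = "\<lambda>s. - G (u s) (v s)"])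
    fix s assume s: "a < s" "s < b"
    have "u s * v s * (1 + 4 * u s) \<le> 0"
      using u[of s] v[of s] s by (auto simp: mult_le_0_iff)
    then have le: "(\<alpha> - 1) * (u s * v s * (1 + 4 * u s)) \<le> 0"
      using alpha by (simp add: mult_le_0_iff)
    show "\<exists>d. DERIV (\<lambda>s. - G (u s) (v s)) s :> d \<and> d \<ge> - (m + 6 * u s) * - G (u s) (v s)"
      by (rule exI, rule conjI, rule DERIV_minus[OF DERIV_G[OF orbit_DERIV_Icc[OF o s]]])
        (use le in auto)
  qed (auto intro!: continuous_intros orbit_continuous[OF o] simp: G_def)
  then have "G (u a) (v a) * exp (integral {a..b} (\<lambda>s. - (m + 6 * u s))) > 0"
    using G by linarith
  then show ?thesis by (simp add: zero_less_mult_iff)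
qed

text \<open>For u \<ge> - 1/6 the coefficient m + 6 u is at least m - 1 > 0, so both terms of the
  derivative are nonpositive once G > 0 is known on the whole interval. A positive value of G thus
  cannot fade away backwards, which later forces the lower branch below v = 0.\<close>

lemma G_decreasing:
  assumes ab: "a \<le> b" and o: "orbit {a..b} u v" and G: "G (u b) (v b) > 0"
    and u: "\<And>s. s \<in> {a..b} \<Longrightarrow> u s \<le> 0" "\<And>s. s \<in> {a..b} \<Longrightarrow> u s \<ge> - 1/6"
    and v: "\<And>s. s \<in> {a..b} \<Longrightarrow> v s \<ge> 0"
  shows "G (u b) (v b) \<le> G (u a) (v a)"
proof (rule DERIV_nonpos_imp_decreasing_open[OF ab])
  show "continuous_on {a..b} (\<lambda>s. G (u s) (v s))"
    unfolding G_def by (intro continuous_intros orbit_continuous[OF o])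
  fix s assume s: "a < s" "s < b"
  have "G (u s) (v s) > 0"
  proof (rule G_positive_backward[OF _ orbit_subset[OF o] G])
    show "u r \<ge> -1/4" if "r \<in> {s..b}" for r using u(2)[of r] that s by simp
  qed (use s u v in auto)
  then have "- (m + 6 * u s) * G (u s) (v s) \<le> 0"
    using u(2)[of s] m_gt s by (intro mult_nonpos_nonneg) auto
  moreover have "u s * v s * (1 + 4 * u s) \<le> 0"
    using u[of s] v[of s] s by (auto simp: mult_le_0_iff)
  then have "(\<alpha> - 1) * (u s * v s * (1 + 4 * u s)) \<le> 0"
    using alpha by (simp add: mult_le_0_iff)
  ultimately have "- (m + 6 * u s) * G (u s) (v s) + (\<alpha> - 1) * (u s * v s * (1 + 4 * u s)) \<le> 0"
    by linarith
  then show "\<exists>y. DERIV (\<lambda>s. G (u s) (v s)) s :> y \<and> y \<le> 0"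
    using DERIV_G[OF orbit_DERIV_Icc[OF o s]] by blast
qed

text \<open>The sign \<open>\<sigma> = \<plusminus>1\<close> covers both directions of time.\<close>

lemma equilibrium_limit:
  assumes \<sigma>: "\<sigma> = 1 \<or> \<sigma> = - 1"
    and u: "\<And>s. s \<ge> a \<Longrightarrow> (u has_real_derivative \<sigma> * P (u s) (v s)) (at s within {a..})"
    and v: "\<And>s. s \<ge> a \<Longrightarrow> (v has_real_derivative \<sigma> * Q (u s) (v s)) (at s within {a..})"
    and B: "\<And>s. s \<ge> a \<Longrightarrow> \<bar>u s\<bar> \<le> B" "\<And>s. s \<ge> a \<Longrightarrow> \<bar>v s\<bar> \<le> B"
    and lim: "(u \<longlongrightarrow> l) at_top"
  shows "(v \<longlongrightarrow> 2 * l\<^sup>2) at_top" "l = 0 \<or> l = - 1/6"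
proof -
  have B0: "B \<ge> 0" using B(1)[of a] by linarith
  define S where "S = cball (0::real) B \<times> cball (0::real) B"
  have S: "(u s, v s) \<in> S" if "s \<ge> a" for s using B that by (auto simp: S_def)
  have bdd: "\<exists>C. \<forall>s\<ge>a. \<bar>h (u s) (v s)\<bar> \<le> C" if "continuous_on S (\<lambda>(x, y). h x y)" for h :: "real \<Rightarrow> real \<Rightarrow> real"
  proof -
    have "compact ((\<lambda>(x, y). h x y) ` S)"
      by (rule compact_continuous_image[OF that]) (auto simp: S_def intro: compact_Times)
    then obtain C where "\<forall>z\<in>(\<lambda>(x, y). h x y) ` S. norm z \<le> C"
      using compact_imp_bounded bounded_iff by metis
    then show ?thesis using S by fastforce
  qed
  have \<sigma>\<sigma>: "\<sigma> * \<sigma> = 1" using \<sigma> by auto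
  obtain C1 where C1: "\<And>s. s \<ge> a \<Longrightarrow> \<bar>Q (u s) (v s) - 4 * u s * P (u s) (v s)\<bar> \<le> C1"
  proof -
    have "continuous_on S (\<lambda>(x, y). Q x y - 4 * x * P x y)"
      unfolding P_def Q_def case_prod_unfold by (intro continuous_intros)
    from bdd[OF this] show ?thesis using that by blast
  qed
  obtain C2 where C2: "\<And>s. s \<ge> a \<Longrightarrow> \<bar>(2 * m * u s - 3 * v s) * P (u s) (v s) - (\<alpha> + 3 * u s) * Q (u s) (v s)\<bar> \<le> C2"
  proof -
    have "continuous_on S (\<lambda>(x, y). (2 * m * x - 3 * y) * P x y - (\<alpha> + 3 * x) * Q x y)"
      unfolding P_def Q_def case_prod_unfold by (intro continuous_intros)
    from bdd[OF this] show ?thesis using that by blast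
  qed
  \<comment> \<open>Convergence of u makes P tend to 0 and gives the limit of v; the same argument
    applied to v makes Q tend to 0, so the limit point is an equilibrium.\<close>
  have "((\<lambda>s. \<sigma> * P (u s) (v s)) \<longlongrightarrow> 0) at_top"
  proof (rule barbalat[OF u _ _ lim])
    fix s assume s: "s \<ge> a"
    have "((\<lambda>s. \<sigma> * P (u s) (v s)) has_real_derivative
      (\<sigma> * \<sigma>) * (Q (u s) (v s) - 4 * u s * P (u s) (v s))) (at s within {a..})"
      unfolding P_def[of "u _"] using u[OF s] v[OF s]
      by (auto intro!: derivative_eq_intros simp: P_def Q_def power2_eq_square algebra_simps)
    then show "((\<lambda>s. \<sigma> * P (u s) (v s)) has_real_derivative
      (Q (u s) (v s) - 4 * u s * P (u s) (v s))) (at s within {a..})" by (simp add: \<sigma>\<sigma>)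
  qed (use C1 in auto)
  then have "((\<lambda>s. \<sigma> * (\<sigma> * P (u s) (v s)) + 2 * (u s)\<^sup>2) \<longlongrightarrow> \<sigma> * 0 + 2 * l\<^sup>2) at_top"
    by (intro tendsto_intros lim)
  then show vlim: "(v \<longlongrightarrow> 2 * l\<^sup>2) at_top"
    using \<sigma>\<sigma> by (simp add: P_def flip: mult.assoc)
  have Q0: "((\<lambda>s. \<sigma> * Q (u s) (v s)) \<longlongrightarrow> 0) at_top"
  proof (rule barbalat[OF v _ _ vlim])
    fix s assume s: "s \<ge> a"
    have "((\<lambda>s. \<sigma> * Q (u s) (v s)) has_real_derivative
      (\<sigma> * \<sigma>) * ((2 * m * u s - 3 * v s) * P (u s) (v s) - (\<alpha> + 3 * u s) * Q (u s) (v s))) (at s within {a..})"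
      unfolding Q_def[of "u _"] using u[OF s] v[OF s]
      by (auto intro!: derivative_eq_intros simp: P_def Q_def power2_eq_square algebra_simps)
    then show "((\<lambda>s. \<sigma> * Q (u s) (v s)) has_real_derivative
      ((2 * m * u s - 3 * v s) * P (u s) (v s) - (\<alpha> + 3 * u s) * Q (u s) (v s))) (at s within {a..})"
      by (simp add: \<sigma>\<sigma>)
  qed (use C2 in auto)
  have "((\<lambda>s. \<sigma> * Q (u s) (v s)) \<longlongrightarrow> \<sigma> * (m * l\<^sup>2 - \<alpha> * (2 * l\<^sup>2) - 3 * l * (2 * l\<^sup>2))) at_top"
    unfolding Q_def by (intro tendsto_mult tendsto_diff tendsto_power tendsto_const lim vlim)
  then have "\<sigma> * (m * l\<^sup>2 - \<alpha> * (2 * l\<^sup>2) - 3 * l * (2 * l\<^sup>2)) = 0"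
    by (rule tendsto_unique[OF trivial_limit_at_top_linorder _ Q0])
  then have "m * l\<^sup>2 - \<alpha> * (2 * l\<^sup>2) - 3 * l * (2 * l\<^sup>2) = 0" using \<sigma> by auto
  then have "l * l * (1 + 6 * l) = 0" by (simp add: m power2_eq_square algebra_simps)
  then have "l = 0 \<or> 1 + 6 * l = 0" by simp
  then show "l = 0 \<or> l = - 1/6" by auto
qed

text \<open>Projection to [- M, M] for M > 0. Composed with the quadratic field it gives a globally
  Lipschitz field that is unchanged on the square |u|, |v| \<le> M.\<close>

definition clip :: "real \<Rightarrow> real \<Rightarrow> real" where "clip M x = max (- M) (min M x)"

lemma clip_id: "\<bar>x\<bar> \<le> M \<Longrightarrow> clip M x = x"
  by (auto simp: clip_def)

text \<open>With \<sigma> = - 1 this continues the stable curve backwards, with \<sigma> = 1 it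
  produces trapped orbits. In both cases a priori bounds must then show that the truncation is not
  felt where the orbit is used.\<close>

lemma clipped_orbit_exists:
  assumes M: "M > 0" and \<sigma>: "\<bar>\<sigma>\<bar> = 1"
  obtains u v where "u 0 = u0" "v 0 = v0"
    "\<And>s. s \<ge> 0 \<Longrightarrow> (u has_real_derivative \<sigma> * P (clip M (u s)) (clip M (v s))) (at s within {0..})"
    "\<And>s. s \<ge> 0 \<Longrightarrow> (v has_real_derivative \<sigma> * Q (clip M (u s)) (clip M (v s))) (at s within {0..})"
proof -
  define F where "F z = (\<sigma> * P (clip M (fst z)) (clip M (snd z)), \<sigma> * Q (clip M (fst z)) (clip M (snd z)))" for z
  \<comment> \<open>The two brackets are Lipschitz constants of P and Q on the square of half-width
    M.\<close>
  define L where "L = (1 + 4 * M) + (2 * m * M + \<alpha> + 6 * M)"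
  have lip: "norm (F z - F z') \<le> L * norm (z - z')" for z z'
  proof -
    define x y x' y' where "x = clip M (fst z)" "y = clip M (snd z)" "x' = clip M (fst z')" "y' = clip M (snd z')"
    note d = this
    define n where "n = norm (z - z')"
    have n0: "n \<ge> 0" by (simp add: n_def)
    have "\<bar>fst z - fst z'\<bar> \<le> n" "\<bar>snd z - snd z'\<bar> \<le> n"
      using norm_fst_le[of "fst (z - z')" "snd (z - z')"] norm_snd_le[of "snd (z - z')" "fst (z - z')"]
      by (auto simp: n_def minus_prod_def)
    then have n: "\<bar>x - x'\<bar> \<le> n" "\<bar>y - y'\<bar> \<le> n" by (auto simp: d clip_def)
    have b: "\<bar>x\<bar> \<le> M" "\<bar>x'\<bar> \<le> M" "\<bar>y\<bar> \<le> M" "\<bar>y'\<bar> \<le> M" using M by (auto simp: d clip_def)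
    have xx: "\<bar>(x + x') * (x - x')\<bar> \<le> (2 * M) * n"
      unfolding abs_mult using b n M by (intro mult_mono) auto
    have xy: "\<bar>x * (y - y')\<bar> \<le> M * n" "\<bar>y' * (x - x')\<bar> \<le> M * n"
      unfolding abs_mult using b n M by (auto intro!: mult_mono)
    have mxx: "\<bar>m * ((x + x') * (x - x'))\<bar> \<le> m * ((2 * M) * n)"
      unfolding abs_mult[of m] using xx m_gt by (intro mult_mono) auto
    have ay: "\<bar>\<alpha> * (y - y')\<bar> \<le> \<alpha> * n"
      unfolding abs_mult using n alpha by (intro mult_mono) auto
    have "P x y - P x' y' = (y - y') - 2 * ((x + x') * (x - x'))"
      by (simp add: P_def power2_eq_square algebra_simps)
    then have p: "\<bar>P x y - P x' y'\<bar> \<le> (1 + 4 * M) * n"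
      using xx n by (simp add: algebra_simps abs_le_iff)
    have "Q x y - Q x' y' = m * ((x + x') * (x - x')) - \<alpha> * (y - y') - 3 * (x * (y - y')) - 3 * (y' * (x - x'))"
      by (simp add: Q_def power2_eq_square algebra_simps)
    then have q: "\<bar>Q x y - Q x' y'\<bar> \<le> m * ((2 * M) * n) + \<alpha> * n + 6 * (M * n)"
      using mxx ay xy by linarith
    have "F z - F z' = (\<sigma> * (P x y - P x' y'), \<sigma> * (Q x y - Q x' y'))"
      by (simp add: F_def d algebra_simps)
    then have "norm (F z - F z') \<le> \<bar>P x y - P x' y'\<bar> + \<bar>Q x y - Q x' y'\<bar>"
      using norm_Pair_le[of "\<sigma> * (P x y - P x' y')" "\<sigma> * (Q x y - Q x' y')"] \<sigma> by (simp add: abs_mult)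
    also have "\<dots> \<le> L * n" using p q by (simp add: L_def algebra_simps)
    finally show ?thesis by (simp add: n_def)
  qed
  obtain z where z: "z 0 = (u0, v0)"
    "\<And>t. t \<ge> 0 \<Longrightarrow> (z has_vector_derivative F (z t)) (at t within {0..})"
    using picard_lindeloef_global[OF lip] by blast
  show ?thesis
  proof (rule that[of "fst \<circ> z" "snd \<circ> z"])
    fix s :: real assume s: "s \<ge> 0"
    note * = z(2)[OF s, unfolded has_vector_derivative_def]
    from has_derivative_fst[OF *] has_derivative_snd[OF *]
    show "(fst \<circ> z has_real_derivative \<sigma> * P (clip M ((fst \<circ> z) s)) (clip M ((snd \<circ> z) s))) (at s within {0..})"
      "(snd \<circ> z has_real_derivative \<sigma> * Q (clip M ((fst \<circ> z) s)) (clip M ((snd \<circ> z) s))) (at s within {0..})"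
      by (simp_all add: has_field_derivative_def F_def o_def mult_commute_abs mult.commute)
  qed (simp_all add: z)
qed

end

section \<open>The strong stable manifold of the origin\<close>

context similarity_flow
begin

text \<open>
  Coefficients of \<open>p\<close> and \<open>q\<close> such that \<open>u = x p(x)\<close>, \<open>v = x q(x)\<close> with \<open>x = exp (- \<alpha> s)\<close> is an orbit:
  since \<open>x' = - \<alpha> x\<close>, the system becomes \<open>- \<alpha> (p + x p') = q - 2 x p\<^sup>2\<close>, \<open>- \<alpha> q' = m p\<^sup>2 - 3 p q\<close>.
\<close>

function stable_coeff :: "nat \<Rightarrow> real \<times> real" where
  "stable_coeff 0 = (-1, \<alpha>)"
| "stable_coeff (Suc k) =
    (let pp = (\<Sum>i\<in>{0..k}. fst (stable_coeff i) * fst (stable_coeff (k - i)));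
         pq = (\<Sum>i\<in>{0..k}. fst (stable_coeff i) * snd (stable_coeff (k - i)));
         r = (3 * pq - m * pp) / (\<alpha> * (real k + 1))
     in ((2 * pp - r) / (\<alpha> * (real k + 2)), r))"
  by pat_completeness auto
termination by (relation "Wellfounded.measure id") auto

text \<open>Each convolution has k + 1 terms, a factor cancelled by the divisor \<alpha> (k + 1).
  The base 5 comes from 3 |pq| + m |pp| with m \<le> 2 \<alpha>, that is 3 \<alpha> + 2
  \<alpha>.\<close>

lemma stable_coeff_bound:
  "\<bar>fst (stable_coeff n)\<bar> \<le> 5 ^ n \<and> \<bar>snd (stable_coeff n)\<bar> \<le> \<alpha> * 5 ^ n"
proof (induction n rule: less_induct)
  case (less n)
  show ?case
  proof (cases n)
    case 0
    then show ?thesis using alpha by simp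
  next
    case (Suc k)
    define pp where "pp = (\<Sum>i\<in>{0..k}. fst (stable_coeff i) * fst (stable_coeff (k - i)))"
    define pq where "pq = (\<Sum>i\<in>{0..k}. fst (stable_coeff i) * snd (stable_coeff (k - i)))"
    define r where "r = (3 * pq - m * pp) / (\<alpha> * (real k + 1))"
    have eq: "stable_coeff n = ((2 * pp - r) / (\<alpha> * (real k + 2)), r)"
      using Suc by (simp add: pp_def pq_def r_def Let_def)
    have pw: "(5::real) ^ i * 5 ^ (k - i) = 5 ^ k" if "i \<le> k" for i
      using that by (simp flip: power_add)
    have "\<bar>pp\<bar> \<le> (\<Sum>i\<in>{0..k}. 5 ^ k)"
      unfolding pp_def
    proof (rule order_trans[OF sum_abs sum_mono])
      fix i assume i: "i \<in> {0..k}"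
      have "\<bar>fst (stable_coeff i) * fst (stable_coeff (k - i))\<bar> \<le> 5 ^ i * 5 ^ (k - i)"
        unfolding abs_mult using less[of i] less[of "k - i"] i Suc by (intro mult_mono) auto
      then show "\<bar>fst (stable_coeff i) * fst (stable_coeff (k - i))\<bar> \<le> 5 ^ k" using pw i by simp
    qed
    then have pp: "\<bar>pp\<bar> \<le> (real k + 1) * 5 ^ k" by (simp add: algebra_simps)
    have "\<bar>pq\<bar> \<le> (\<Sum>i\<in>{0..k}. \<alpha> * 5 ^ k)"
      unfolding pq_def
    proof (rule order_trans[OF sum_abs sum_mono])
      fix i assume i: "i \<in> {0..k}"
      have "\<bar>fst (stable_coeff i) * snd (stable_coeff (k - i))\<bar> \<le> 5 ^ i * (\<alpha> * 5 ^ (k - i))"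
        unfolding abs_mult using less[of i] less[of "k - i"] i Suc by (intro mult_mono) auto
      also have "\<dots> = \<alpha> * (5 ^ i * 5 ^ (k - i))" by simp
      finally show "\<bar>fst (stable_coeff i) * snd (stable_coeff (k - i))\<bar> \<le> \<alpha> * 5 ^ k" using pw i by simp
    qed
    then have pq: "\<bar>pq\<bar> \<le> (real k + 1) * (\<alpha> * 5 ^ k)" by (simp add: algebra_simps)
    have "\<bar>m * pp\<bar> \<le> m * ((real k + 1) * 5 ^ k)"
      unfolding abs_mult using pp m_gt by (intro mult_mono) auto
    also have "\<dots> \<le> (2 * \<alpha>) * ((real k + 1) * 5 ^ k)"
      using m by (intro mult_right_mono) auto
    finally have "\<bar>3 * pq - m * pp\<bar> \<le> (\<alpha> * (real k + 1)) * 5 ^ Suc k"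
      using pq by (simp add: algebra_simps)
    then have r: "\<bar>r\<bar> \<le> 5 ^ Suc k"
      using alpha by (simp add: r_def abs_divide abs_mult pos_divide_le_eq mult.commute)
    also have "\<dots> \<le> \<alpha> * 5 ^ Suc k" using alpha by simp
    finally have r2: "\<bar>r\<bar> \<le> \<alpha> * 5 ^ Suc k" .
    have "\<bar>2 * pp - r\<bar> \<le> 2 * ((real k + 1) * 5 ^ k) + \<alpha> * 5 ^ Suc k" using pp r2 by linarith
    also have "\<dots> \<le> (real k + 1) * (\<alpha> * 5 ^ Suc k) + \<alpha> * 5 ^ Suc k"
    proof -
      have "2 * 5 ^ k \<le> \<alpha> * 5 ^ Suc k" using alpha by (simp add: mult_right_mono)
      then have "(real k + 1) * (2 * 5 ^ k) \<le> (real k + 1) * (\<alpha> * 5 ^ Suc k)"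
        by (rule mult_left_mono) simp
      then show ?thesis by (simp only: algebra_simps)
    qed
    also have "\<dots> = (\<alpha> * (real k + 2)) * 5 ^ Suc k" by (simp add: algebra_simps)
    finally have "\<bar>(2 * pp - r) / (\<alpha> * (real k + 2))\<bar> \<le> 5 ^ Suc k"
      using alpha by (simp add: abs_divide abs_mult pos_divide_le_eq mult.commute)
    then show ?thesis using eq r2 Suc by simp
  qed
qed

definition stable_p :: "real fps" where "stable_p = Abs_fps (\<lambda>n. fst (stable_coeff n))"
definition stable_q :: "real fps" where "stable_q = Abs_fps (\<lambda>n. snd (stable_coeff n))"

text \<open>Coefficients of size 5^n leave room for any radius below 1/5; the choice 1/6 gives the
  convergent ratio 5/6.\<close>

lemma stable_radius: "fps_conv_radius stable_p \<ge> ereal (1/6)" "fps_conv_radius stable_q \<ge> ereal (1/6)"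
proof -
  have gen: "fps_conv_radius (Abs_fps c) \<ge> ereal (1/6)" if "\<And>n. \<bar>c n\<bar> \<le> C * 5 ^ n" for c :: "nat \<Rightarrow> real" and C
  proof -
    have "summable (\<lambda>n. c n * (1/6) ^ n)"
    proof (rule summable_comparison_test')
      show "summable (\<lambda>n. C * (5/6::real) ^ n)" by (intro summable_mult summable_geometric) simp
      show "norm (c n * (1/6) ^ n) \<le> C * (5/6) ^ n" if "n \<ge> 0" for n
        using mult_right_mono[OF \<open>\<And>n. \<bar>c n\<bar> \<le> C * 5 ^ n\<close>[of n], of "(1/6)^n"]
        by (simp add: abs_mult power_divide)
    qed
    from conv_radius_geI[OF this] show ?thesis by (simp add: fps_conv_radius_def)
  qed
  show "fps_conv_radius stable_p \<ge> ereal (1/6)"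
    unfolding stable_p_def by (rule gen[of _ 1]) (use stable_coeff_bound in auto)
  show "fps_conv_radius stable_q \<ge> ereal (1/6)"
    unfolding stable_q_def by (rule gen[of _ \<alpha>]) (use stable_coeff_bound in auto)
qed

lemma stable_fps_eqs:
  "fps_const (- \<alpha>) * (stable_p + fps_X * fps_deriv stable_p) = stable_q - fps_const 2 * (fps_X * (stable_p * stable_p))"
  "fps_const (- \<alpha>) * fps_deriv stable_q = fps_const m * (stable_p * stable_p) - fps_const 3 * (stable_p * stable_q)"
proof -
  have pp: "fps_nth (stable_p * stable_p) k = (\<Sum>i\<in>{0..k}. fst (stable_coeff i) * fst (stable_coeff (k - i)))" for k
    by (simp add: fps_mult_nth stable_p_def)
  have pq: "fps_nth (stable_p * stable_q) k = (\<Sum>i\<in>{0..k}. fst (stable_coeff i) * snd (stable_coeff (k - i)))" for k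
    by (simp add: fps_mult_nth stable_p_def stable_q_def)
  have nth: "fps_nth stable_p n = fst (stable_coeff n)" "fps_nth stable_q n = snd (stable_coeff n)" for n
    by (simp_all add: stable_p_def stable_q_def)
  have q: "fps_nth stable_q (Suc k) = (3 * fps_nth (stable_p * stable_q) k - m * fps_nth (stable_p * stable_p) k) / (\<alpha> * (real k + 1))" for k
    by (simp add: nth pp pq Let_def)
  have p: "fps_nth stable_p (Suc k) = (2 * fps_nth (stable_p * stable_p) k - fps_nth stable_q (Suc k)) / (\<alpha> * (real k + 2))" for k
    by (simp add: nth pp pq Let_def)
  show "fps_const (- \<alpha>) * (stable_p + fps_X * fps_deriv stable_p) = stable_q - fps_const 2 * (fps_X * (stable_p * stable_p))"
  proof (rule fps_ext)
    fix n
    show "fps_nth (fps_const (- \<alpha>) * (stable_p + fps_X * fps_deriv stable_p)) n =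
      fps_nth (stable_q - fps_const 2 * (fps_X * (stable_p * stable_p))) n"
    proof (cases n)
      case 0
      then show ?thesis by (simp add: stable_p_def stable_q_def)
    next
      case (Suc k)
      have "\<alpha> * (real k + 2) * fps_nth stable_p (Suc k) = 2 * fps_nth (stable_p * stable_p) k - fps_nth stable_q (Suc k)"
      proof -
        have nz: "\<alpha> * (real k + 2) \<noteq> 0" using alpha by auto
        show ?thesis unfolding p[of k] times_divide_eq_right by (rule nonzero_mult_div_cancel_left[OF nz])
      qed
      then have "- \<alpha> * (fps_nth stable_p (Suc k) + (real k + 1) * fps_nth stable_p (Suc k)) =
        fps_nth stable_q (Suc k) - 2 * fps_nth (stable_p * stable_p) k"
        by (simp only: algebra_simps)
      then show ?thesis using Suc by (simp add: add.commute)
    qed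
  qed
  show "fps_const (- \<alpha>) * fps_deriv stable_q = fps_const m * (stable_p * stable_p) - fps_const 3 * (stable_p * stable_q)"
  proof (rule fps_ext)
    fix k
    have "\<alpha> * (real k + 1) * fps_nth stable_q (Suc k) = 3 * fps_nth (stable_p * stable_q) k - m * fps_nth (stable_p * stable_p) k"
    proof -
      have nz: "\<alpha> * (real k + 1) \<noteq> 0" using alpha by auto
      show ?thesis unfolding q[of k] times_divide_eq_right by (rule nonzero_mult_div_cancel_left[OF nz])
    qed
    then have "- \<alpha> * ((real k + 1) * fps_nth stable_q (Suc k)) =
      m * fps_nth (stable_p * stable_p) k - 3 * fps_nth (stable_p * stable_q) k"
      by (simp only: algebra_simps)
    then show "fps_nth (fps_const (- \<alpha>) * fps_deriv stable_q) k =
      fps_nth (fps_const m * (stable_p * stable_p) - fps_const 3 * (stable_p * stable_q)) k"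
      by (simp add: add.commute)
  qed
qed

lemma stable_eval_eqs:
  fixes x :: real
  assumes x: "\<bar>x\<bar> < 1/6"
  defines "p \<equiv> eval_fps stable_p" and "q \<equiv> eval_fps stable_q"
  shows "- \<alpha> * (p x + x * eval_fps (fps_deriv stable_p) x) = q x - 2 * (x * (p x * p x))"
    "- \<alpha> * eval_fps (fps_deriv stable_q) x = m * (p x * p x) - 3 * (p x * q x)"
proof -
  have gt: "ereal \<bar>x\<bar> < R" if "R \<ge> ereal (1/6)" for R
    using x that by (meson ereal_less(2) less_ereal.simps(1) order_less_le_trans)
  note R = stable_radius
  have rp: "ereal (1/6) \<le> fps_conv_radius (fps_deriv stable_p)"
    "ereal (1/6) \<le> fps_conv_radius (fps_deriv stable_q)"
    using fps_conv_radius_deriv[of stable_p] fps_conv_radius_deriv[of stable_q] R by (auto intro: order_trans)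
  have mul: "ereal (1/6) \<le> fps_conv_radius (f * g)"
    if "ereal (1/6) \<le> fps_conv_radius f" "ereal (1/6) \<le> fps_conv_radius g" for f g :: "real fps"
    using fps_conv_radius_mult[of f g] that by (meson min.boundedI order_trans)
  have add: "ereal (1/6) \<le> fps_conv_radius (f + g)"
    if "ereal (1/6) \<le> fps_conv_radius f" "ereal (1/6) \<le> fps_conv_radius g" for f g :: "real fps"
    using fps_conv_radius_add[of f g] that by (meson min.boundedI order_trans)
  have c: "ereal (1/6) \<le> fps_conv_radius (fps_const c)" "ereal (1/6) \<le> fps_conv_radius (fps_X :: real fps)" for c :: real
    by simp_all
  have emul: "eval_fps (f * g) x = eval_fps f x * eval_fps g x"
    if "ereal (1/6) \<le> fps_conv_radius f" "ereal (1/6) \<le> fps_conv_radius g" for f g :: "real fps"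
    using that by (intro eval_fps_mult) (auto intro: gt)
  have eadd: "eval_fps (f + g) x = eval_fps f x + eval_fps g x"
    if "ereal (1/6) \<le> fps_conv_radius f" "ereal (1/6) \<le> fps_conv_radius g" for f g :: "real fps"
    using that by (intro eval_fps_add) (auto intro: gt)
  have ediff: "eval_fps (f - g) x = eval_fps f x - eval_fps g x"
    if "ereal (1/6) \<le> fps_conv_radius f" "ereal (1/6) \<le> fps_conv_radius g" for f g :: "real fps"
    using that by (intro eval_fps_diff) (auto intro: gt)
  show "- \<alpha> * (p x + x * eval_fps (fps_deriv stable_p) x) = q x - 2 * (x * (p x * p x))"
    using arg_cong[OF stable_fps_eqs(1), of "\<lambda>f. eval_fps f x"]
    by (simp only: emul eadd ediff mul add c rp R eval_fps_const eval_fps_X p_def q_def)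
  show "- \<alpha> * eval_fps (fps_deriv stable_q) x = m * (p x * p x) - 3 * (p x * q x)"
    using arg_cong[OF stable_fps_eqs(2), of "\<lambda>f. eval_fps f x"]
    by (simp only: emul eadd ediff mul add c rp R eval_fps_const eval_fps_X p_def q_def)
qed

lemma local_stable_orbit:
  obtains S u v where "orbit {S..} u v"
    "\<And>s. s \<ge> S \<Longrightarrow> - 1/6 < u s \<and> u s < 0 \<and> v s > 0 \<and> P (u s) (v s) > 0 \<and> G (u s) (v s) > 0"
    "\<And>s. s \<ge> S \<Longrightarrow> \<bar>u s\<bar> \<le> 2 * exp (- \<alpha> * s)"
    "(u \<longlongrightarrow> 0) at_top" "(v \<longlongrightarrow> 0) at_top"
proof -
  define p q where "p = eval_fps stable_p" and "q = eval_fps stable_q"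
  have gt: "ereal \<bar>x\<bar> < R" if "R \<ge> ereal (1/6)" "\<bar>x\<bar> < 1/6" for R x
    using that by (meson less_ereal.simps(1) order_less_le_trans)
  have pD: "DERIV p x :> eval_fps (fps_deriv stable_p) x" "DERIV q x :> eval_fps (fps_deriv stable_q) x"
    if "\<bar>x\<bar> < 1/6" for x
    unfolding p_def q_def using that stable_radius
    by (auto intro!: has_field_derivative_eval_fps gt)
  \<comment> \<open>The leading coefficient - 1 selects the side u < 0. Its size is immaterial,
    since rescaling x amounts to a shift of time.\<close>
  have p0: "p 0 = - 1" "q 0 = \<alpha>" by (simp_all add: p_def q_def eval_fps_at_0 stable_p_def stable_q_def)
  have cont: "isCont p 0" "isCont q 0" using pD[of 0] by (auto intro: DERIV_isCont)
  define E where "E s = exp (- \<alpha> * s)" for s :: real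
  define u v where "u s = E s * p (E s)" and "v s = E s * q (E s)" for s
  have E0: "(E \<longlongrightarrow> 0) at_top"
    unfolding E_def
    by (rule filterlim_compose[OF exp_at_bot filterlim_tendsto_neg_mult_at_bot[OF tendsto_const _ filterlim_ident]])
      (use alpha in simp)
  have pE: "((\<lambda>s. p (E s)) \<longlongrightarrow> - 1) at_top" "((\<lambda>s. q (E s)) \<longlongrightarrow> \<alpha>) at_top"
    using isCont_tendsto_compose[OF cont(1) E0] isCont_tendsto_compose[OF cont(2) E0] p0 by auto
  have ulim: "(u \<longlongrightarrow> 0) at_top" "(v \<longlongrightarrow> 0) at_top"
    using tendsto_mult[OF E0 pE(1)] tendsto_mult[OF E0 pE(2)] unfolding u_def v_def by auto
  have "((\<lambda>s. q (E s) - 2 * E s * (p (E s))\<^sup>2) \<longlongrightarrow> \<alpha> - 2 * 0 * (- 1)\<^sup>2) at_top"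
    by (intro tendsto_mult tendsto_diff tendsto_power tendsto_const pE E0)
  then have ev1: "\<forall>\<^sub>F s in at_top. q (E s) - 2 * E s * (p (E s))\<^sup>2 > 0"
    using alpha by (intro order_tendstoD) auto
  \<comment> \<open>This is G divided by x^2. Its limit \<alpha>^2 - \<alpha> is positive because m
    > 1; for m = 1 the leading term would cancel.\<close>
  have "((\<lambda>s. (q (E s))\<^sup>2 + p (E s) * q (E s) - E s * (p (E s))^3) \<longlongrightarrow> \<alpha>\<^sup>2 + (- 1) * \<alpha> - 0 * (- 1)^3) at_top"
    by (intro tendsto_mult tendsto_diff tendsto_add tendsto_power tendsto_const pE E0)
  moreover have "\<alpha>\<^sup>2 + (- 1) * \<alpha> - 0 * (- 1)^3 > 0" using alpha by (simp add: power2_eq_square)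
  ultimately have ev2: "\<forall>\<^sub>F s in at_top. (q (E s))\<^sup>2 + p (E s) * q (E s) - E s * (p (E s))^3 > 0"
    by (rule order_tendstoD)
  have ev3: "\<forall>\<^sub>F s in at_top. p (E s) > - 2" "\<forall>\<^sub>F s in at_top. p (E s) < 0" "\<forall>\<^sub>F s in at_top. q (E s) > 0"
    using pE alpha by (auto intro!: order_tendstoD)
  have ev4: "\<forall>\<^sub>F s in at_top. u s > - 1/6" "\<forall>\<^sub>F s in at_top. E s < 1/6"
    using order_tendstoD(1)[OF ulim(1), of "- 1/6"] order_tendstoD(2)[OF E0, of "1/6"] by simp_all
  have "\<forall>\<^sub>F s in at_top. q (E s) - 2 * E s * (p (E s))\<^sup>2 > 0 \<and>
    (q (E s))\<^sup>2 + p (E s) * q (E s) - E s * (p (E s))^3 > 0 \<and> p (E s) > - 2 \<and> p (E s) < 0 \<and> q (E s) > 0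
    \<and> u s > - 1/6 \<and> E s < 1/6"
    using ev1 ev2 ev3 ev4 by eventually_elim auto
  then obtain S where S: "\<And>s. s \<ge> S \<Longrightarrow> q (E s) - 2 * E s * (p (E s))\<^sup>2 > 0 \<and>
    (q (E s))\<^sup>2 + p (E s) * q (E s) - E s * (p (E s))^3 > 0 \<and> p (E s) > - 2 \<and> p (E s) < 0 \<and> q (E s) > 0
    \<and> u s > - 1/6 \<and> E s < 1/6"
    unfolding eventually_at_top_linorder by blast
  have Epos: "E s > 0" for s by (simp add: E_def)
  show ?thesis
  proof (rule that[of S u v])
    show "orbit {S..} u v"
      unfolding orbit_def
    proof (intro ballI conjI)
      fix s assume "s \<in> {S..}"
      then have x: "\<bar>E s\<bar> < 1/6" using S[of s] Epos[of s] by auto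
      note eqs = stable_eval_eqs[OF x, folded p_def q_def]
      have ED: "DERIV E s :> - \<alpha> * E s" unfolding E_def by (auto intro!: derivative_eq_intros)
      have "DERIV u s :> (- \<alpha> * E s) * p (E s) + (eval_fps (fps_deriv stable_p) (E s) * (- \<alpha> * E s)) * E s"
        unfolding u_def by (rule DERIV_mult[OF ED DERIV_chain2[OF pD(1)[OF x] ED]])
      also have "(- \<alpha> * E s) * p (E s) + (eval_fps (fps_deriv stable_p) (E s) * (- \<alpha> * E s)) * E s
        = E s * (- \<alpha> * (p (E s) + E s * eval_fps (fps_deriv stable_p) (E s)))"
        by (simp add: algebra_simps)
      also have "\<dots> = P (u s) (v s)"
        unfolding eqs(1) by (simp add: P_def u_def v_def power2_eq_square algebra_simps)
      finally show "(u has_real_derivative P (u s) (v s)) (at s within {S..})"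
        by (rule has_field_derivative_at_within)
      have "DERIV v s :> (- \<alpha> * E s) * q (E s) + (eval_fps (fps_deriv stable_q) (E s) * (- \<alpha> * E s)) * E s"
        unfolding v_def by (rule DERIV_mult[OF ED DERIV_chain2[OF pD(2)[OF x] ED]])
      also have "(- \<alpha> * E s) * q (E s) + (eval_fps (fps_deriv stable_q) (E s) * (- \<alpha> * E s)) * E s
        = - \<alpha> * (E s * q (E s)) + E s * E s * (- \<alpha> * eval_fps (fps_deriv stable_q) (E s))"
        by (simp add: algebra_simps)
      also have "\<dots> = Q (u s) (v s)"
        unfolding eqs(2) by (simp add: Q_def u_def v_def power2_eq_square algebra_simps)
      finally show "(v has_real_derivative Q (u s) (v s)) (at s within {S..})"
        by (rule has_field_derivative_at_within)
    qed
    fix s assume s: "s \<ge> S"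
    have "P (u s) (v s) = E s * (q (E s) - 2 * E s * (p (E s))\<^sup>2)"
      by (simp add: P_def u_def v_def power2_eq_square algebra_simps)
    moreover have "G (u s) (v s) = (E s)\<^sup>2 * ((q (E s))\<^sup>2 + p (E s) * q (E s) - E s * (p (E s))^3)"
      by (simp add: G_def u_def v_def power2_eq_square power3_eq_cube algebra_simps)
    ultimately show "- 1/6 < u s \<and> u s < 0 \<and> v s > 0 \<and> P (u s) (v s) > 0 \<and> G (u s) (v s) > 0"
      using S[OF s] Epos[of s] by (auto simp: u_def v_def mult_pos_neg intro!: mult_pos_pos)
    have "\<bar>u s\<bar> \<le> E s * 2"
      unfolding u_def abs_mult using S[OF s] Epos[of s] by (intro mult_mono) auto
    then show "\<bar>u s\<bar> \<le> 2 * exp (- \<alpha> * s)" by (simp add: E_def)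
  qed (fact ulim)+
qed

section \<open>A priori bounds for the manifold continued backwards\<close>

lemma k_nonneg_forward:
  assumes ab: "a \<le> b" and o: "orbit {a..b} u v" and u: "\<And>s. s \<in> {a..b} \<Longrightarrow> u s \<le> 0"
    and k: "v a + \<alpha> * u a \<ge> 0"
  shows "v a + \<alpha> * u a \<le> v b + \<alpha> * u b"
proof -
  let ?I = "integral {a..b} (\<lambda>s. - 3 * u s)"
  have h1: "(v a + \<alpha> * u a) * exp ?I \<le> v b + \<alpha> * u b"
  proof (rule linear_growth[OF ab])
    fix s assume s: "a < s" "s < b"
    have "(3 * \<alpha> - 1) * (u s)\<^sup>2 \<ge> 0" using alpha by simp
    then show "\<exists>d. DERIV (\<lambda>s. v s + \<alpha> * u s) s :> d \<and> d \<ge> - 3 * u s * (v s + \<alpha> * u s)"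
      using DERIV_k[OF orbit_DERIV_Icc[OF o s]] by force
  qed (auto intro!: continuous_intros orbit_continuous[OF o])
  have "?I \<ge> 0"
    by (rule Henstock_Kurzweil_Integration.integral_nonneg)
      (use u in \<open>auto intro!: integrable_continuous_real continuous_intros orbit_continuous[OF o]\<close>)
  then have h2: "(v a + \<alpha> * u a) * 1 \<le> (v a + \<alpha> * u a) * exp ?I"
    using k by (intro mult_left_mono) auto
  from order_trans[OF h2 h1] show ?thesis by simp
qed

text \<open>Once v + \<alpha> u is nonnegative it becomes positive and never decreases again, so it
  could not tend to 0. An orbit converging to the origin in u < 0 thus stays below the tangent
  line.\<close>

lemma k_negative:
  assumes o: "orbit {a..} u v" and u: "\<And>s. s \<ge> a \<Longrightarrow> u s < 0"
    and lim: "(u \<longlongrightarrow> 0) at_top" "(v \<longlongrightarrow> 0) at_top" and s: "s \<ge> a"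
  shows "v s + \<alpha> * u s < 0"
proof (rule ccontr)
  assume "\<not> v s + \<alpha> * u s < 0"
  then have k: "v s + \<alpha> * u s \<ge> 0" by simp
  define k where "k = (\<lambda>s. v s + \<alpha> * u s)"
  have sub: "orbit {s..b} u v" for b using o s by (auto intro: orbit_subset)
  let ?I = "integral {s..s+1} (\<lambda>s. - 3 * u s)"
  have "k s * exp ?I < k (s + 1)"
    unfolding k_def
  proof (rule linear_growth_strict)
    fix r assume r: "s < r" "r < s + 1"
    have "(3 * \<alpha> - 1) * (u r)\<^sup>2 > 0" using alpha u[of r] r s by simp
    then show "\<exists>d. DERIV (\<lambda>s. v s + \<alpha> * u s) r :> d \<and> - 3 * u r * (v r + \<alpha> * u r) < d"
      using DERIV_k[OF orbit_DERIV_Icc[OF sub r]] by force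
  qed (auto intro!: continuous_intros orbit_continuous[OF sub])
  moreover have "k s * exp ?I \<ge> 0" using k by (simp add: k_def)
  ultimately have pos: "k (s + 1) > 0" by linarith
  have "k (s+1) \<le> k r" if "r \<ge> s + 1" for r
    unfolding k_def
    by (rule k_nonneg_forward[OF that orbit_subset[OF sub[of r]]])
      (use pos u s in \<open>auto simp: k_def intro: less_imp_le\<close>)
  then have "\<forall>\<^sub>F r in at_top. k (s+1) \<le> k r" by (auto simp: eventually_at_top_linorder)
  moreover have "(k \<longlongrightarrow> 0 + \<alpha> * 0) at_top" unfolding k_def by (intro tendsto_intros lim)
  ultimately have "k (s+1) \<le> 0 + \<alpha> * 0"
    by (intro tendsto_lowerbound[of k]) auto
  then show False using pos by simp
qed

text \<open>Below the line v = - \<alpha> u one has u' < - 2 u (u + \<alpha>/2), so u = - \<alpha>/2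
  cannot be passed going backwards.\<close>

lemma u_lower_backward:
  assumes ab: "a \<le> b" and o: "orbit {a..b} u v"
    and k: "\<And>s. s \<in> {a..b} \<Longrightarrow> v s + \<alpha> * u s < 0" and ub: "u b > - \<alpha> / 2"
  shows "u a > - \<alpha> / 2"
proof -
  have "- (u a + \<alpha>/2) * exp (integral {a..b} (\<lambda>s. - 2 * u s)) \<le> - (u b + \<alpha>/2)"
  proof (rule linear_growth[OF ab, where g = "\<lambda>s. - (u s + \<alpha>/2)"])
    fix s assume s: "a < s" "s < b"
    have "DERIV (\<lambda>s. - (u s + \<alpha>/2)) s :> - P (u s) (v s)"
      using orbit_DERIV_Icc[OF o s] by (auto intro!: derivative_eq_intros)
    moreover have "- P (u s) (v s) \<ge> - 2 * u s * - (u s + \<alpha>/2)"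
      using k[of s] s by (simp add: P_def power2_eq_square algebra_simps)
    ultimately show "\<exists>d. DERIV (\<lambda>s. - (u s + \<alpha>/2)) s :> d \<and> d \<ge> - 2 * u s * - (u s + \<alpha>/2)" by blast
  qed (auto intro!: continuous_intros orbit_continuous[OF o])
  then have "(u a + \<alpha>/2) * exp (integral {a..b} (\<lambda>s. - 2 * u s)) > 0" using ub by (simp add: algebra_simps)
  then show ?thesis by (simp add: zero_less_mult_iff)
qed

lemma v_lower_backward:
  assumes ab: "a \<le> b" and o: "orbit {a..b} u v"
    and u: "\<And>s. s \<in> {a..b} \<Longrightarrow> - \<alpha> / 2 < u s \<and> u s < 0" and vb: "v b > 0"
  shows "v a > - 5/4 * \<alpha>\<^sup>2"
proof (cases "v a > 0")
  case True
  then show ?thesis using zero_le_power2[of \<alpha>] by linarith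
next
  case False
  then obtain r where r: "a \<le> r" "r \<le> b" "v r = 0"
    using IVT'[of v a 0 b] vb ab orbit_continuous(2)[OF o] by auto
  have le: "v s \<le> 0" if "a \<le> s" "s < r" for s
  proof (rule ccontr)
    assume "\<not> v s \<le> 0"
    then have "v r > 0"
      by (intro v_positive_forward[OF that(2) orbit_subset[OF o]]) (use that r u in auto)
    then show False using r by simp
  qed
  \<comment> \<open>While v \<le> 0, \<open>W\<close> does not increase: its derivative is v (3/2
    \<alpha> - 3 u) - (5 \<alpha> - m) u^2. At time r one has v = 0 and u > - \<alpha>/2, whence the
    constant 5/2 \<alpha> * \<alpha>/2 = 5/4 \<alpha>^2.\<close>
  define W where "W s = v s + 5/2 * \<alpha> * u s" for s
  have or: "orbit {a..r} u v" using o r by (auto intro: orbit_subset)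
  have "W r \<le> W a"
  proof (rule DERIV_nonpos_imp_decreasing_open[OF r(1)])
    show "continuous_on {a..r} W"
      unfolding W_def by (intro continuous_intros orbit_continuous[OF or])
    fix s assume s: "a < s" "s < r"
    have "DERIV W s :> Q (u s) (v s) + 5/2 * \<alpha> * P (u s) (v s)"
      unfolding W_def using orbit_DERIV_Icc[OF or s] by (auto intro!: derivative_eq_intros)
    moreover have "Q (u s) (v s) + 5/2 * \<alpha> * P (u s) (v s) \<le> 0"
    proof -
      have "v s * (3/2 * \<alpha> - 3 * u s) \<le> 0"
        using le[of s] s u[of s] r alpha by (intro mult_nonpos_nonneg) auto
      moreover have "(u s)\<^sup>2 * (5 * \<alpha> - m) \<ge> 0" using m alpha by (intro mult_nonneg_nonneg) auto
      moreover have "Q (u s) (v s) + 5/2 * \<alpha> * P (u s) (v s) = v s * (3/2 * \<alpha> - 3 * u s) - (u s)\<^sup>2 * (5 * \<alpha> - m)"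
        by (simp add: P_def Q_def algebra_simps)
      ultimately show ?thesis by linarith
    qed
    ultimately show "\<exists>y. DERIV W s :> y \<and> y \<le> 0" by blast
  qed
  moreover have "5/2 * \<alpha> * u r > 5/2 * \<alpha> * (- \<alpha> / 2)" using u[of r] r alpha by (intro mult_strict_left_mono) auto
  moreover have "5/2 * \<alpha> * u a < 0" using u[of a] ab alpha by (simp add: mult_pos_neg)
  ultimately show ?thesis using r(3) by (simp add: W_def power2_eq_square)
qed

text \<open>Followed backwards, the curve may leave u < 0 after finite time through u = 0, hence the
  alternative for \<open>J\<close>. Continuity of U and V on the whole line makes U close to 0 near
  such an end.\<close>

theorem global_stable_orbit:
  obtains U V :: "real \<Rightarrow> real" and J S where
    "J = UNIV \<or> (\<exists>\<sigma>. J = {\<sigma><..} \<and> U \<sigma> = 0)" "{S..} \<subseteq> J" "continuous_on UNIV U" "continuous_on UNIV V"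
    "orbit J U V"
    "\<And>s. s \<in> J \<Longrightarrow> - \<alpha> / 2 < U s \<and> U s < 0 \<and> - 5/4 * \<alpha>\<^sup>2 < V s \<and> V s < - \<alpha> * U s"
    "\<And>s. s \<ge> S \<Longrightarrow> - 1/6 < U s \<and> V s > 0 \<and> P (U s) (V s) > 0 \<and> G (U s) (V s) > 0"
    "\<And>s. s \<ge> S \<Longrightarrow> \<bar>U s\<bar> \<le> 2 * exp (- \<alpha> * s)"
    "(U \<longlongrightarrow> 0) at_top" "(V \<longlongrightarrow> 0) at_top"
proof -
  obtain S u v where ouv: "orbit {S..} u v"
    and tail: "\<And>s. s \<ge> S \<Longrightarrow> - 1/6 < u s \<and> u s < 0 \<and> v s > 0 \<and> P (u s) (v s) > 0 \<and> G (u s) (v s) > 0"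
    and dec: "\<And>s. s \<ge> S \<Longrightarrow> \<bar>u s\<bar> \<le> 2 * exp (- \<alpha> * s)"
    and lim: "(u \<longlongrightarrow> 0) at_top" "(v \<longlongrightarrow> 0) at_top"
    using local_stable_orbit by blast
  \<comment> \<open>The box must contain strictly the a priori bounds \<alpha>/2 for |u| and
    \<alpha>^2/2 and 5/4 \<alpha>^2 for |v|, as well as the tail given by the series.\<close>
  define M where "M = 2 * \<alpha>\<^sup>2"
  have a2: "\<alpha>\<^sup>2 > \<alpha>" using alpha by (simp add: power2_eq_square)
  have M: "M > 2" "M > \<alpha>" using a2 alpha by (auto simp: M_def)
  obtain x y where x0: "x 0 = u S" "y 0 = v S"
    and xD: "\<And>s. s \<ge> 0 \<Longrightarrow> (x has_real_derivative - 1 * P (clip M (x s)) (clip M (y s))) (at s within {0..})"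
    and yD: "\<And>s. s \<ge> 0 \<Longrightarrow> (y has_real_derivative - 1 * Q (clip M (x s)) (clip M (y s))) (at s within {0..})"
    using clipped_orbit_exists[of M "-1" "u S" "v S"] M by auto
  define U where "U s = (if s \<ge> S then u s else x (S - s))" for s
  define V where "V s = (if s \<ge> S then v s else y (S - s))" for s
  have kS: "v s + \<alpha> * u s < 0" if "s \<ge> S" for s
    by (rule k_negative[OF ouv _ lim that]) (use tail in auto)
  have bdS: "\<bar>u s\<bar> < M" "\<bar>v s\<bar> < M" if "s \<ge> S" for s
  proof -
    show "\<bar>u s\<bar> < M" using tail[OF that] M by linarith
    have "\<alpha> * - u s \<le> \<alpha> * 1" using tail[OF that] alpha by (intro mult_left_mono) auto
    then show "\<bar>v s\<bar> < M" using tail[OF that] kS[OF that] M by linarith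
  qed
  \<comment> \<open>One statement for both coordinates, with \<open>F\<close> standing for P or Q:
    the forward piece and the time-reversed backward piece fit together differentiably at
    \<open>S\<close>.\<close>
  have glue: "DERIV W s :> F (clip M (U s)) (clip M (V s))"
    if W: "\<And>s. W s = (if s \<ge> S then w s else z (S - s))" "z 0 = w S"
      and w: "\<And>s. s \<ge> S \<Longrightarrow> (w has_real_derivative F (u s) (v s)) (at s within {S..})"
      and z: "\<And>s. s \<ge> 0 \<Longrightarrow> (z has_real_derivative - 1 * F (clip M (x s)) (clip M (y s))) (at s within {0..})"
    for W w z :: "real \<Rightarrow> real" and F :: "real \<Rightarrow> real \<Rightarrow> real" and s
  proof -
    have right: "(W has_real_derivative F (clip M (U s)) (clip M (V s))) (at s within {S..})" if "s \<ge> S" for s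
    proof -
      have "(w has_real_derivative F (clip M (U s)) (clip M (V s))) (at s within {S..})"
        using w[OF that] bdS[OF that] that by (simp add: U_def V_def clip_id)
      then show ?thesis unfolding has_real_derivative_iff_has_vector_derivative
        by (rule has_vector_derivative_transform[rotated 2]) (use that W in auto)
    qed
    have left: "(W has_real_derivative F (clip M (U s)) (clip M (V s))) (at s within {..S})" if "s \<le> S" for s
    proof -
      have "(z has_real_derivative - 1 * F (clip M (x (S - s))) (clip M (y (S - s)))) (at (S - s) within (\<lambda>s. S - s) ` {..S})"
        using z[of "S - s"] that by (auto intro: DERIV_subset)
      moreover have "((\<lambda>s. S - s) has_real_derivative - 1) (at s within {..S})"
        by (auto intro!: derivative_eq_intros)
      ultimately have "(z \<circ> (\<lambda>s. S - s) has_real_derivative - 1 * F (clip M (x (S - s))) (clip M (y (S - s))) * - 1) (at s within {..S})"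
        by (rule DERIV_image_chain)
      moreover have "U s = x (S - s)" "V s = y (S - s)" using that x0 by (auto simp: U_def V_def)
      ultimately have "(z \<circ> (\<lambda>s. S - s) has_real_derivative F (clip M (U s)) (clip M (V s))) (at s within {..S})"
        by simp
      then show ?thesis unfolding has_real_derivative_iff_has_vector_derivative
        by (rule has_vector_derivative_transform[rotated 2]) (use that W in auto)
    qed
    consider "s > S" | "s < S" | "s = S" by linarith
    then show ?thesis
    proof cases
      case 1
      then show ?thesis using right[of s] by (simp add: at_within_interior[of s "{S..}"])
    next
      case 2
      then show ?thesis using left[of s] by (simp add: at_within_interior[of s "{..S}"])
    next
      case 3
      then show ?thesis using left[of s] right[of s] by (auto intro: has_real_derivative_two_sided)
    qed
  qed
  have UD: "DERIV U s :> P (clip M (U s)) (clip M (V s))" for s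
    by (rule glue[OF U_def x0(1) _ xD]) (use ouv in \<open>auto simp: orbit_def\<close>)
  have VD: "DERIV V s :> Q (clip M (U s)) (clip M (V s))" for s
    by (rule glue[OF V_def x0(2) _ yD]) (use ouv in \<open>auto simp: orbit_def\<close>)
  have cont: "continuous_on A U" "continuous_on A V" for A
    using UD VD by (meson DERIV_isCont continuous_at_imp_continuous_on)+
  have orb: "orbit I U V" if "\<And>s. s \<in> I \<Longrightarrow> \<bar>U s\<bar> \<le> M \<and> \<bar>V s\<bar> \<le> M" for I
    unfolding orbit_def using UD VD that by (metis clip_id has_field_derivative_at_within)
  have apriori: "- \<alpha> / 2 < U s \<and> V s < - \<alpha> * U s \<and> - 5/4 * \<alpha>\<^sup>2 < V s"
    if sS: "s \<le> S" and neg: "\<And>r. r \<in> {s..S} \<Longrightarrow> U r < 0" and o: "orbit {s..S} U V" for s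
  proof -
    have k: "V r + \<alpha> * U r < 0" if r: "r \<in> {s..S}" for r
    proof (rule ccontr)
      assume "\<not> V r + \<alpha> * U r < 0"
      then have k0: "V r + \<alpha> * U r \<ge> 0" by simp
      have "V r + \<alpha> * U r \<le> V S + \<alpha> * U S"
        by (rule k_nonneg_forward[OF _ orbit_subset[OF o] _ k0]) (use neg r in \<open>auto intro: less_imp_le\<close>)
      then have "0 \<le> V S + \<alpha> * U S" using k0 by linarith
      then show False using kS[of S] by (simp add: U_def V_def)
    qed
    have low: "- \<alpha> / 2 < U r" if r: "r \<in> {s..S}" for r
    proof (rule u_lower_backward[OF _ orbit_subset[OF o]])
      show "V r' + \<alpha> * U r' < 0" if "r' \<in> {r..S}" for r' using k[of r'] that r by simp
      show "- \<alpha> / 2 < U S" using tail[of S] alpha by (simp add: U_def)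
    qed (use r in auto)
    have "V s > - 5/4 * \<alpha>\<^sup>2"
      by (rule v_lower_backward[OF sS o]) (use low neg tail[of S] in \<open>auto simp: V_def\<close>)
    then show ?thesis using k[of s] low[of s] sS by auto
  qed
  \<comment> \<open>Let q be the last time before \<open>S\<close> at which the boundary of the box
    is met. On [q, S] the truncation is inactive, so the a priori bounds hold at q, and they place q
    strictly inside.\<close>
  have inbox: "\<bar>U r\<bar> < M \<and> \<bar>V r\<bar> < M"
    if neg: "\<And>r. r \<in> {s..S} \<Longrightarrow> U r < 0" and r: "r \<in> {s..S}" for s r
  proof (rule ccontr)
    assume bad: "\<not> (\<bar>U r\<bar> < M \<and> \<bar>V r\<bar> < M)"
    have c: "continuous_on {r..S} (\<lambda>x. M - max \<bar>U x\<bar> \<bar>V x\<bar>)" by (intro continuous_intros cont)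
    have rS: "r \<le> S" "M - max \<bar>U r\<bar> \<bar>V r\<bar> \<le> 0" using bad r by auto
    have "M - max \<bar>U S\<bar> \<bar>V S\<bar> > 0" using bdS[of S] by (simp add: U_def V_def)
    then obtain q where q: "r \<le> q" "q < S" "M - max \<bar>U q\<bar> \<bar>V q\<bar> = 0"
      "\<And>x. q < x \<Longrightarrow> x \<le> S \<Longrightarrow> M - max \<bar>U x\<bar> \<bar>V x\<bar> > 0"
      using last_zero[OF c rS] by blast
    have qZ: "s \<le> q" "q \<le> S" "M \<le> max \<bar>U q\<bar> \<bar>V q\<bar>" and qS: "q < S" using q r by auto
    have after: "\<bar>U x\<bar> < M \<and> \<bar>V x\<bar> < M" if "q < x" "x \<le> S" for x using q(4)[OF that] by simp
    have contr: "isCont (\<lambda>r. \<bar>U r\<bar>) q" "isCont (\<lambda>r. \<bar>V r\<bar>) q"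
      using DERIV_isCont[OF UD[of q]] DERIV_isCont[OF VD[of q]] by (auto intro: continuous_intros)
    have Mq: "\<bar>U q\<bar> \<le> M" "\<bar>V q\<bar> \<le> M"
      by (rule isCont_le_right[OF contr(1) qS], use after in force)
        (rule isCont_le_right[OF contr(2) qS], use after in force)
    have "orbit {q..S} U V"
    proof (rule orb)
      fix r assume "r \<in> {q..S}"
      then show "\<bar>U r\<bar> \<le> M \<and> \<bar>V r\<bar> \<le> M"
        using after[of r] Mq by (cases "r = q") auto
    qed
    moreover have "U r < 0" if "r \<in> {q..S}" for r using neg[of r] that qZ by auto
    ultimately have ap: "- \<alpha> / 2 < U q \<and> V q < - \<alpha> * U q \<and> - 5/4 * \<alpha>\<^sup>2 < V q"
      using qS by (intro apriori) auto
    have "U q < 0" using neg[of q] qZ by auto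
    then have "\<bar>U q\<bar> < M" using ap M by linarith
    moreover have "\<alpha> * - U q \<le> \<alpha> * (\<alpha> / 2)" using ap alpha by (intro mult_left_mono) auto
    then have "\<bar>V q\<bar> < M" using ap a2 alpha unfolding M_def power2_eq_square by linarith
    ultimately show False using qZ(3) by auto
  qed
  \<comment> \<open>The times from which on u stays negative. The set is defined through the
    truncated curve, but on it the truncation is not felt.\<close>
  define J where "J = {s. \<forall>r\<ge>s. U r < 0}"
  have SJ: "{S..} \<subseteq> J" using tail by (auto simp: J_def U_def)
  have Jbox: "\<bar>U s\<bar> < M \<and> \<bar>V s\<bar> < M" if "s \<in> J" for s
    using inbox[of s s] bdS[of s] that by (cases "s \<le> S") (auto simp: J_def U_def V_def)
  have JU: "J = UNIV \<or> (\<exists>\<sigma>. J = {\<sigma><..} \<and> U \<sigma> = 0)"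
  proof (cases "J = UNIV")
    case False
    obtain s where "s \<notin> J" using False by auto
    then obtain r where "U r \<ge> 0" by (auto simp: J_def not_less)
    then have r: "r \<le> S" "- U r \<le> 0" using tail[of r] by (cases "r \<ge> S"; auto simp: U_def)+
    have c: "continuous_on {r..S} (\<lambda>x. - U x)" by (intro continuous_intros cont)
    have "- U S > 0" using tail[of S] by (simp add: U_def)
    then obtain q where q: "- U q = 0" "\<And>x. q < x \<Longrightarrow> x \<le> S \<Longrightarrow> - U x > 0"
      using last_zero[OF c r] by blast
    have after: "U x < 0" if "q < x" for x
      using q(2)[OF that] tail[of x] by (cases "x \<le> S") (auto simp: U_def)
    have "U q = 0" using q(1) by simp
    moreover have "J = {q<..}"
    proof (intro set_eqI iffI)
      fix r assume "r \<in> J"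
      then have "r \<le> q \<Longrightarrow> U q < 0" by (simp add: J_def)
      then show "r \<in> {q<..}" using \<open>U q = 0\<close> by force
    qed (use after in \<open>auto simp: J_def\<close>)
    ultimately show ?thesis by blast
  qed simp
  show ?thesis
  proof (rule that[OF JU SJ cont])
    show oJ: "orbit J U V" by (rule orb) (use Jbox in \<open>auto intro: less_imp_le\<close>)
    show "- \<alpha> / 2 < U s \<and> U s < 0 \<and> - 5/4 * \<alpha>\<^sup>2 < V s \<and> V s < - \<alpha> * U s" if s: "s \<in> J" for s
    proof -
      have up: "r \<in> J" if "r \<ge> s" for r using that s by (auto simp: J_def)
      have "U s < 0" using s by (auto simp: J_def)
      moreover have "- \<alpha> / 2 < U s \<and> V s < - \<alpha> * U s \<and> - 5/4 * \<alpha>\<^sup>2 < V s"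
      proof (cases "s \<le> S")
        case True
        show ?thesis
          by (rule apriori[OF True _ orbit_subset[OF oJ]]) (use up in \<open>auto simp: J_def\<close>)
      next
        case False
        then have "V s > 0" "U s > - 1/6" "V s + \<alpha> * U s < 0" using tail[of s] kS[of s] by (auto simp: U_def V_def)
        moreover have "- 5/4 * \<alpha>\<^sup>2 \<le> 0" by simp
        ultimately show ?thesis using alpha by linarith
      qed
      ultimately show ?thesis by blast
    qed
    show "- 1/6 < U s \<and> V s > 0 \<and> P (U s) (V s) > 0 \<and> G (U s) (V s) > 0" if "s \<ge> S" for s
      using tail[OF that] that by (simp add: U_def V_def)
    show "\<bar>U s\<bar> \<le> 2 * exp (- \<alpha> * s)" if "s \<ge> S" for s
      using dec[OF that] that by (simp add: U_def)
    have "\<forall>\<^sub>F s in at_top. u s = U s" "\<forall>\<^sub>F s in at_top. v s = V s"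
      by (auto simp: eventually_at_top_linorder U_def V_def)
    then show "(U \<longlongrightarrow> 0) at_top" "(V \<longlongrightarrow> 0) at_top"
      using lim by (auto intro: Lim_transform_eventually)
  qed
qed

end

section \<open>The shape of the stable curve\<close>

locale stable_curve = similarity_flow +
  fixes U V :: "real \<Rightarrow> real" and J :: "real set" and S :: real
  assumes J: "J = UNIV \<or> (\<exists>\<sigma>. J = {\<sigma><..} \<and> U \<sigma> = 0)" and SJ: "{S..} \<subseteq> J"
    and contU: "continuous_on UNIV U" and contV: "continuous_on UNIV V"
    and oJ: "orbit J U V"
    and bounds: "\<And>s. s \<in> J \<Longrightarrow> - \<alpha> / 2 < U s \<and> U s < 0 \<and> - 5/4 * \<alpha>\<^sup>2 < V s \<and> V s < - \<alpha> * U s"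
    and tail: "\<And>s. s \<ge> S \<Longrightarrow> - 1/6 < U s \<and> V s > 0 \<and> P (U s) (V s) > 0 \<and> G (U s) (V s) > 0"
    and decay: "\<And>s. s \<ge> S \<Longrightarrow> \<bar>U s\<bar> \<le> 2 * exp (- \<alpha> * s)"
    and U0: "(U \<longlongrightarrow> 0) at_top" and V0: "(V \<longlongrightarrow> 0) at_top"
begin

section \<open>Elementary properties of the curve and its backward limit\<close>

lemma J_up: "s \<in> J \<Longrightarrow> s \<le> r \<Longrightarrow> r \<in> J"
  using J by auto

lemma J_Icc: "s \<in> J \<Longrightarrow> {s..r} \<subseteq> J"
  using J_up by auto

lemma open_J: "open J"
  using J by auto

lemma contP: "continuous_on A (\<lambda>s. P (U s) (V s))"
  unfolding P_def using contU contV by (auto intro!: continuous_intros intro: continuous_on_subset)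

lemma contA: "continuous_on A U" "continuous_on A V"
  using contU contV by (auto intro: continuous_on_subset)

lemma J_DERIV:
  assumes "s \<in> J"
  shows "DERIV U s :> P (U s) (V s)" "DERIV V s :> Q (U s) (V s)"
  using orbit_DERIV[OF oJ] assms open_J by (auto simp: interior_open)

lemma J_orbit: "s \<in> J \<Longrightarrow> orbit {s..r} U V"
  using orbit_subset[OF oJ J_Icc] .

text \<open>At a finite left end of \<open>J\<close> the continuous function U vanishes, so it would
  exceed c just after that end.\<close>

lemma J_UNIV:
  assumes c: "c < 0" and r: "r \<in> J" and le: "\<And>s. s \<in> J \<Longrightarrow> s \<le> r \<Longrightarrow> U s \<le> c"
  shows "J = UNIV"
proof (rule ccontr)
  assume "J \<noteq> UNIV"
  then obtain \<sigma> where \<sigma>: "J = {\<sigma><..}" "U \<sigma> = 0" using J by auto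
  have "U \<sigma> \<le> c"
    by (rule isCont_le_right[of _ _ r])
      (use contU \<sigma> r le in \<open>auto simp: continuous_on_eq_continuous_at\<close>)
  then show False using \<sigma> c by simp
qed

text \<open>A is the only equilibrium with u \<le> c < 0. It lies inside the loop, as the negative
  value of G shows; convergence to A is later refuted by G > 0 propagated backwards.\<close>

lemma backward_limit:
  assumes U: "J = UNIV" and c: "c < 0" and le: "\<And>s. s \<le> r \<Longrightarrow> U s \<le> c"
    and lim: "((\<lambda>s. U (- s)) \<longlongrightarrow> l) at_top"
  shows "l = - 1/6" "((\<lambda>s. V (- s)) \<longlongrightarrow> 1/18) at_top"
    "((\<lambda>s. G (U (- s)) (V (- s))) \<longlongrightarrow> - 1/648) at_top"
proof -
  have D: "((\<lambda>s. U (- s)) has_real_derivative - 1 * P (U (- s)) (V (- s))) (at s within {- r..})"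
    "((\<lambda>s. V (- s)) has_real_derivative - 1 * Q (U (- s)) (V (- s))) (at s within {- r..})" for s
  proof -
    have "DERIV (\<lambda>s. U (- s)) s :> P (U (- s)) (V (- s)) * - 1"
      "DERIV (\<lambda>s. V (- s)) s :> Q (U (- s)) (V (- s)) * - 1"
      by (rule DERIV_chain2[OF J_DERIV(1)] DERIV_chain2[OF J_DERIV(2)];
          use U in \<open>auto intro!: derivative_eq_intros\<close>)+
    then show "((\<lambda>s. U (- s)) has_real_derivative - 1 * P (U (- s)) (V (- s))) (at s within {- r..})"
      "((\<lambda>s. V (- s)) has_real_derivative - 1 * Q (U (- s)) (V (- s))) (at s within {- r..})"
      by (simp_all add: has_field_derivative_at_within)
  qed
  have "\<bar>U (- s)\<bar> \<le> \<alpha> + 5/4 * \<alpha>\<^sup>2 + \<alpha>\<^sup>2" for s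
  proof -
    have "\<alpha>\<^sup>2 \<ge> 0" by simp
    then show ?thesis using bounds[of "- s"] U alpha unfolding abs_le_iff by (simp, linarith)
  qed
  moreover have "\<bar>V (- s)\<bar> \<le> \<alpha> + 5/4 * \<alpha>\<^sup>2 + \<alpha>\<^sup>2" for s
  proof -
    have "\<alpha> * - U (- s) \<le> \<alpha> * \<alpha>" using bounds[of "- s"] U alpha by (intro mult_left_mono) auto
    moreover have "\<alpha>\<^sup>2 \<ge> 0" by simp
    ultimately show ?thesis using bounds[of "- s"] U alpha
      by (simp add: abs_le_iff power2_eq_square)
  qed
  ultimately have eq: "((\<lambda>s. V (- s)) \<longlongrightarrow> 2 * l\<^sup>2) at_top" "l = 0 \<or> l = - 1/6"
    using equilibrium_limit[of "-1" "- r" "\<lambda>s. U (- s)" "\<lambda>s. V (- s)", OF _ D _ _ lim] by blast+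
  have "l \<le> c"
    using lim
  proof (rule tendsto_upperbound)
    show "\<forall>\<^sub>F s in at_top. U (- s) \<le> c"
      using eventually_ge_at_top[of "- r"] by eventually_elim (use le in auto)
  qed simp
  then show l: "l = - 1/6" using eq c by auto
  show V: "((\<lambda>s. V (- s)) \<longlongrightarrow> 1/18) at_top" using eq(1) by (simp add: l power2_eq_square)
  have "((\<lambda>s. G (U (- s)) (V (- s))) \<longlongrightarrow> G l (1/18)) at_top"
    unfolding G_def by (intro tendsto_intros lim V)
  then show "((\<lambda>s. G (U (- s)) (V (- s))) \<longlongrightarrow> - 1/648) at_top"
    by (simp add: G_def l power2_eq_square power3_eq_cube)
qed

lemma P_nonneg_v: "P u v \<ge> 0 \<Longrightarrow> v \<ge> 0"
  using zero_le_power2[of u] unfolding P_def by linarith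

text \<open>For - 1/4 \<le> u < 0 the value is at most 0, so that part of the parabola cannot be met
  where G > 0.\<close>

lemma G_on_parabola: "P u v = 0 \<Longrightarrow> G u v = u^3 * (1 + 4 * u)"
  by (simp add: P_def G_def power2_eq_square power3_eq_cube algebra_simps)

lemma U_strict_mono_on:
  assumes "a < b" "a \<in> J" "\<And>s. a < s \<Longrightarrow> s < b \<Longrightarrow> P (U s) (V s) > 0"
  shows "U a < U b"
proof (rule DERIV_pos_imp_increasing_open[OF assms(1)])
  show "\<exists>y. DERIV U s :> y \<and> y > 0" if "a < s" "s < b" for s
    using J_DERIV[of s] J_up[OF assms(2), of s] assms(3) that by force
qed (use contA in auto)

lemma U_strict_antimono_on:
  assumes "a < b" "a \<in> J" "\<And>s. a < s \<Longrightarrow> s < b \<Longrightarrow> P (U s) (V s) < 0"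
  shows "U b < U a"
proof (rule DERIV_neg_imp_decreasing_open[OF assms(1)])
  show "\<exists>y. DERIV U s :> y \<and> y < 0" if "a < s" "s < b" for s
    using J_DERIV[of s] J_up[OF assms(2), of s] assms(3) that by force
qed (use contA in auto)

lemma isCont_P: "isCont (\<lambda>s. P (U s) (V s)) s"
  using contP[of UNIV] by (simp add: continuous_on_eq_continuous_at)

text \<open>Without a turning point u would be monotone and converge backwards to A with G > 0 all
  along, against G < 0 at A. At a turning point with u \<ge> - 1/4 the propagated inequality G > 0
  contradicts the sign of G on the parabola.\<close>

lemma turning_point_exists:
  "\<exists>t\<in>J. P (U t) (V t) = 0 \<and> (\<forall>s>t. P (U s) (V s) > 0) \<and> U t < - 1/4"
proof -
  have "\<exists>s\<in>J. P (U s) (V s) \<le> 0"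
  proof (rule ccontr)
    assume "\<not> (\<exists>s\<in>J. P (U s) (V s) \<le> 0)"
    then have pos: "P (U s) (V s) > 0" if "s \<in> J" for s using that by force
    have mono: "U a \<le> U b" if "a \<in> J" "a \<le> b" for a b
    proof (cases "a = b")
      case False
      have "U a < U b"
        by (rule U_strict_mono_on) (use that False pos J_up[OF that(1)] in auto)
      then show ?thesis by simp
    qed simp
    have US: "U S < 0" "S \<in> J" using bounds[of S] SJ by auto
    have J1: "J = UNIV" by (rule J_UNIV[OF US]) (use mono in auto)
    obtain l where l: "((\<lambda>s. U (- s)) \<longlongrightarrow> l) at_top" "\<And>s. - S \<le> s \<Longrightarrow> l \<le> U (- s)"
      by (rule antimono_bounded_limit[of "- S" "\<lambda>s. U (- s)" "- \<alpha> / 2"])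
        (use mono bounds J1 in \<open>auto intro: less_imp_le\<close>)
    note lim = backward_limit[OF J1 US(1) _ l(1), of S]
    have l6: "l = - 1/6" using lim(1) mono J1 by auto
    have low: "U s \<ge> - 1/6" if "s \<le> S" for s using l(2)[of "- s"] that l6 by simp
    have "G (U s) (V s) > 0" if "s \<le> S" for s
    proof (rule G_positive_backward[OF that J_orbit])
      show "- 1/4 \<le> U r" if "r \<in> {s..S}" for r using low[of r] that by auto
      show "V r \<ge> 0" for r using pos[of r] J1 by (auto intro: P_nonneg_v less_imp_le)
    qed (use tail[of S] bounds J1 in \<open>auto intro: less_imp_le\<close>)
    then have "\<forall>\<^sub>F s in at_top. G (U (- s)) (V (- s)) \<ge> 0"
      unfolding eventually_at_top_linorder by (intro exI[of _ "- S"]) (auto intro: less_imp_le)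
    moreover have "((\<lambda>s. G (U (- s)) (V (- s))) \<longlongrightarrow> - 1/648) at_top" using lim(3) mono J1 by auto
    ultimately have "0 \<le> (- 1/648 :: real)" using tendsto_lowerbound trivial_limit_at_top_linorder by blast
    then show False by simp
  qed
  then obtain s1 where s1: "s1 \<in> J" "P (U s1) (V s1) \<le> 0" by blast
  have s1S: "s1 < S" using tail[of s1] s1 by force
  have "P (U S) (V S) > 0" using tail[of S] by simp
  then obtain t where t: "s1 \<le> t" "t < S" "P (U t) (V t) = 0"
    "\<And>r. t < r \<Longrightarrow> r \<le> S \<Longrightarrow> P (U r) (V r) > 0"
    using last_zero[OF contP less_imp_le[OF s1S] s1(2)] by blast
  note P0 = t(3)
  have tS: "t \<le> S" using t(2) by simp
  have tJ: "t \<in> J" using J_up[OF s1(1)] t by blast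
  have after: "P (U s) (V s) > 0" if "s > t" for s using t(4)[OF that] tail[of s] by (cases "s \<le> S") auto
  have "U t < - 1/4"
  proof (rule ccontr)
    assume "\<not> U t < - 1/4"
    then have ge: "U t \<ge> - 1/4" by simp
    have "G (U t) (V t) > 0"
    proof (rule G_positive_backward[OF tS J_orbit[OF tJ]])
      fix r assume r: "r \<in> {t..S}"
      show "U r \<ge> - 1/4"
        using U_strict_mono_on[OF _ tJ, of r] r after ge by (cases "r = t") force+
      show "U r \<le> 0" using bounds[OF J_up[OF tJ]] r by force
      have "P (U r) (V r) \<ge> 0" using after[of r] P0 r by (cases "r = t") auto
      then show "V r \<ge> 0" by (rule P_nonneg_v)
    qed (use tail[of S] in auto)
    moreover have "(U t)^3 * (1 + 4 * U t) \<le> 0"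
      using bounds[OF tJ] ge by (intro mult_nonpos_nonneg) (auto simp: power_le_zero_eq)
    ultimately show False using G_on_parabola[OF P0] by simp
  qed
  then show ?thesis using tJ P0 after by blast
qed

definition t1 :: real where
  "t1 = (SOME t. t \<in> J \<and> P (U t) (V t) = 0 \<and> (\<forall>s>t. P (U s) (V s) > 0) \<and> U t < - 1/4)"

lemma t1: "t1 \<in> J" "P (U t1) (V t1) = 0" "\<And>s. s > t1 \<Longrightarrow> P (U s) (V s) > 0" "U t1 < - 1/4"
  using someI_ex[OF turning_point_exists[unfolded Bex_def]] unfolding t1_def[symmetric] by auto

lemma J_P_deriv:
  "s \<in> J \<Longrightarrow> P (U s) (V s) = 0 \<Longrightarrow> DERIV (\<lambda>s. P (U s) (V s)) s :> - ((U s)\<^sup>2 * (1 + 6 * U s))"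
  using DERIV_P[OF J_DERIV] by fastforce

text \<open>Take the last zero t of P before \<open>t1\<close>. As P is negative right after it, its
  derivative is not positive, so U t \<ge> - 1/6. Between t and \<open>t1\<close> the curve passes u
  = - 1/4 below the parabola, where G = (v - 1/8)^2 > 0; carried back to t this contradicts the sign
  of G on the parabola.\<close>

lemma P_negative_before:
  assumes s: "s \<in> J" "s < t1" shows "P (U s) (V s) < 0"
proof (rule ccontr)
  assume "\<not> P (U s) (V s) < 0"
  then have Ps: "P (U s) (V s) \<ge> 0" by simp
  have "- ((U t1)\<^sup>2 * (1 + 6 * U t1)) > 0" using t1(4) by (auto simp: mult_less_0_iff)
  from DERIV_pos_inc_left[OF J_P_deriv[OF t1(1,2)] this] obtain d where
    d: "d > 0" "\<And>h. 0 < h \<Longrightarrow> h < d \<Longrightarrow> P (U (t1 - h)) (V (t1 - h)) < 0" using t1(2) by auto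
  \<comment> \<open>A time so close to \<open>t1\<close> that P is already negative there; it
    separates the zero sought from the one at \<open>t1\<close>.\<close>
  define b where "b = max ((s + t1) / 2) (t1 - d / 2)"
  have b: "s \<le> b" "b < t1" "t1 - b < d" using d(1) s by (auto simp: b_def max_def field_simps)
  have "continuous_on {s..b} (\<lambda>s. - P (U s) (V s))" by (intro continuous_intros contP)
  then obtain t where t: "s \<le> t" "t < b" "- P (U t) (V t) = 0"
    "\<And>r. t < r \<Longrightarrow> r \<le> b \<Longrightarrow> - P (U r) (V r) > 0"
    by (rule last_zero) (use b Ps d(2)[of "t1 - b"] in simp_all)
  have tJ: "t \<in> J" using J_up[OF s(1)] t by blast
  have tt1: "t < t1" using t b by simp
  have after: "P (U r) (V r) < 0" if "t < r" "r < t1" for r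
    using t(4)[of r] d(2)[of "t1 - r"] that b by (cases "r \<le> b") auto
  have P0: "P (U t) (V t) = 0" using t(3) by simp
  have Ut: "U t \<ge> - 1/6"
  proof (rule ccontr)
    assume "\<not> U t \<ge> - 1/6"
    then have "- ((U t)\<^sup>2 * (1 + 6 * U t)) > 0" by (auto simp: mult_less_0_iff)
    from DERIV_pos_inc_right[OF J_P_deriv[OF tJ P0] this] obtain e where
      e: "e > 0" "\<And>h. 0 < h \<Longrightarrow> h < e \<Longrightarrow> P (U (t + h)) (V (t + h)) > 0" using P0 by auto
    define h where "h = min (e / 2) ((t1 - t) / 2)"
    have "0 < h" "h < e" "t + h < t1" using e tt1 by (auto simp: h_def min_def field_simps)
    then show False using e(2)[of h] after[of "t + h"] by auto
  qed
  obtain r where r: "t \<le> r" "r \<le> t1" "U r = - 1/4"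
    using IVT2'[of U t1 "- 1/4" t] Ut t1(4) tt1 contA by auto
  then have r': "t < r" "r < t1" using Ut t1(4) by (auto simp: less_le)
  have "G (U t) (V t) > 0"
  proof (rule G_positive_backward[OF r(1) J_orbit[OF tJ]])
    have "V r < 1/8" using after[OF r'] r(3) by (simp add: P_def power2_eq_square)
    moreover have "G (U r) (V r) = (V r - 1/8)\<^sup>2"
      by (simp add: G_def r(3) power2_eq_square power3_eq_cube algebra_simps)
    ultimately show "G (U r) (V r) > 0" by simp
    fix q assume q: "q \<in> {t..r}"
    have neg: "U x < 0" if "x \<in> {t..q}" for x using bounds[OF J_up[OF tJ]] that by auto
    show "U q \<le> 0" using neg[of q] q by auto
    show "- 1/4 \<le> U q"
      using U_strict_antimono_on[of q r, OF _ J_up[OF tJ]] q after r r' by (cases "q = r") force+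
    have "V t > 0" using P0 bounds[OF tJ] by (auto simp: P_def)
    then show "V q \<ge> 0"
      using v_positive_forward[of t q, OF _ J_orbit[OF tJ]] neg q by (cases "q = t") force+
  qed
  moreover have "(U t)^3 * (1 + 4 * U t) \<le> 0"
    using bounds[OF tJ] Ut by (intro mult_nonpos_nonneg) (auto simp: power_le_zero_eq)
  ultimately show False using G_on_parabola[OF P0] by simp
qed

lemma U_inc: "t1 \<le> a \<Longrightarrow> a < b \<Longrightarrow> U a < U b"
  by (rule U_strict_mono_on) (use t1 J_up in auto)

lemma U_dec: "a \<in> J \<Longrightarrow> a < b \<Longrightarrow> b \<le> t1 \<Longrightarrow> U b < U a"
  by (rule U_strict_antimono_on) (use P_negative_before J_up in auto)

lemma U_ge: "s \<in> J \<Longrightarrow> U t1 \<le> U s"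
  using U_inc[of t1 s] U_dec[of s t1] by (cases s t1 rule: linorder_cases) auto

lemma right_value:
  assumes u: "U t1 < u" "u < 0"
  obtains s where "s > t1" "U s = u"
proof -
  have "\<forall>\<^sub>F s in at_top. U s > u \<and> s > t1"
    using order_tendstoD(1)[OF U0 u(2)] eventually_gt_at_top[of t1] by eventually_elim auto
  then obtain b where b: "U b > u" "b > t1" by (auto simp: eventually_at_top_linorder)
  then obtain s where "t1 \<le> s" "s \<le> b" "U s = u" using IVT'[of U t1 u b] u contA by auto
  then show ?thesis using that[of s] u by (cases "s = t1") auto
qed

lemma G_pos_quarter:
  assumes "r \<in> J" "r < t1" "U r = - 1/4" shows "G (U r) (V r) > 0"
proof -
  have "V r < 1/8" using P_negative_before[OF assms(1,2)] assms(3) by (simp add: P_def power2_eq_square)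
  moreover have "G (U r) (V r) = (V r - 1/8)\<^sup>2"
    by (simp add: G_def assms(3) power2_eq_square power3_eq_cube algebra_simps)
  ultimately show ?thesis by simp
qed

text \<open>If u were not reached going backwards, U would be monotone and bounded away from 0, so
  it would converge to A. But G is positive from the passage of - 1/4 backwards.\<close>

lemma left_value:
  assumes u: "U t1 < u" "u < 0"
  obtains s where "s \<in> J" "s < t1" "U s = u"
proof -
  have "\<exists>s\<in>J. s \<le> t1 \<and> U s \<ge> u"
  proof (rule ccontr)
    assume "\<not> (\<exists>s\<in>J. s \<le> t1 \<and> U s \<ge> u)"
    then have le: "U s \<le> u" if "s \<in> J" "s \<le> t1" for s using that by force
    have J1: "J = UNIV" by (rule J_UNIV[OF u(2) t1(1) le])
    have mono: "U b \<le> U a" if "a \<le> b" "b \<le> t1" for a b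
      using U_dec[of a b] that J1 by (cases "a = b") auto
    obtain l where l: "((\<lambda>s. U (- s)) \<longlongrightarrow> l) at_top"
      by (rule monotone_bounded_limit[of "- t1" "\<lambda>s. U (- s)" u]) (use mono le J1 in auto)
    note lim = backward_limit[OF J1 u(2) _ l, of t1]
    have l6: "l = - 1/6" using lim(1) le J1 by auto
    have Vlim: "((\<lambda>s. V (- s)) \<longlongrightarrow> 1/18) at_top" using lim(2) le J1 by auto
    have "\<forall>\<^sub>F s in at_top. U (- s) > - 1/4 \<and> s > - t1"
      using order_tendstoD(1)[OF l, of "- 1/4"] eventually_gt_at_top[of "- t1"] l6
      by (simp add: eventually_conj_iff)
    then obtain N where "U (- N) > - 1/4 \<and> N > - t1" unfolding eventually_at_top_linorder by blast
    then obtain b where b: "U b > - 1/4" "b < t1" by (metis minus_less_iff)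
    obtain r where r: "b \<le> r" "r \<le> t1" "U r = - 1/4"
      using IVT2'[of U t1 "- 1/4" b] b t1(4) contA by auto
    have rt: "r < t1" using r t1(4) by (auto simp: less_le)
    \<comment> \<open>Arbitrarily far back v is close to 1/18, and positivity is inherited forwards.
      This supplies the hypothesis v \<ge> 0 for propagating G.\<close>
    have Vpos: "V s > 0" for s
    proof -
      have "\<forall>\<^sub>F x in at_top. V (- x) > 0 \<and> x > - s"
        using order_tendstoD(1)[OF Vlim, of 0] eventually_gt_at_top[of "- s"] by (simp add: eventually_conj_iff)
      then obtain N where "V (- N) > 0 \<and> N > - s" unfolding eventually_at_top_linorder by blast
      then obtain x where x: "V x > 0" "x < s" by (metis minus_less_iff)
      show ?thesis
        by (rule v_positive_forward[OF x(2) J_orbit]) (use x J1 bounds in auto)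
    qed
    have "G (U s) (V s) > 0" if "s \<le> r" for s
    proof (rule G_positive_backward[OF that J_orbit])
      show "- 1/4 \<le> U q" if "q \<in> {s..r}" for q using mono[of q r] that r rt by auto
      show "G (U r) (V r) > 0" by (rule G_pos_quarter) (use J1 rt r in auto)
    qed (use J1 bounds Vpos in \<open>auto intro: less_imp_le\<close>)
    then have "\<forall>\<^sub>F s in at_top. G (U (- s)) (V (- s)) \<ge> 0"
      unfolding eventually_at_top_linorder by (intro exI[of _ "- r"]) (auto intro: less_imp_le)
    moreover have "((\<lambda>s. G (U (- s)) (V (- s))) \<longlongrightarrow> - 1/648) at_top" using lim(3) le J1 by auto
    ultimately have "0 \<le> (- 1/648 :: real)" using tendsto_lowerbound trivial_limit_at_top_linorder by blast
    then show False by simp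
  qed
  then obtain b where b: "b \<in> J" "b \<le> t1" "U b \<ge> u" by blast
  then obtain s where "b \<le> s" "s \<le> t1" "U s = u" using IVT2'[of U t1 u b] u contA by auto
  then show ?thesis using that[of s] u J_up[OF b(1)] by (cases "s = t1") auto
qed

text \<open>If v stayed nonnegative, the curve would return to the origin between v = 0 and the
  parabola, where G tends to 0 with u. But backwards from u = - 1/6 the positive value of G does not
  decrease.\<close>

lemma V_negative_exists: "\<exists>s\<in>J. s < t1 \<and> V s < 0"
proof (rule ccontr)
  assume "\<not> (\<exists>s\<in>J. s < t1 \<and> V s < 0)"
  then have V0: "V s \<ge> 0" if "s \<in> J" "s < t1" for s using that by force
  obtain r where r: "r \<in> J" "r < t1" "U r = - 1/4" using left_value[of "- 1/4"] t1(4) by auto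
  have mono: "U b \<le> U a" if "a \<in> J" "a \<le> b" "b \<le> t1" for a b
    using U_dec[of a b] that by (cases "a = b") auto
  have less: "s < r'" if "s \<in> J" "r' \<in> J" "s < t1" "r' < t1" "U s > U r'" for s r'
    using mono[of r' s] that by (force simp: not_less[symmetric])
  have Gpos: "G (U s) (V s) > 0" if "s \<in> J" "s \<le> r" for s
  proof (rule G_positive_backward[OF that(2) J_orbit[OF that(1)] G_pos_quarter[OF r]])
    fix q assume q: "q \<in> {s..r}"
    have qJ: "q \<in> J" using J_up[OF that(1)] q by auto
    show "U q \<le> 0" using bounds[OF qJ] by simp
    show "- 1/4 \<le> U q" using mono[OF qJ, of r] q r by auto
    show "0 \<le> V q" using V0[OF qJ] q r by auto
  qed
  obtain r6 where r6: "r6 \<in> J" "r6 < t1" "U r6 = - 1/6" using left_value[of "- 1/6"] t1(4) by auto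
  have "r6 < r" using less[OF r6(1) r(1)] r r6 by simp
  define c where "c = G (U r6) (V r6)"
  have c: "c > 0" using Gpos[OF r6(1)] \<open>r6 < r\<close> by (simp add: c_def)
  \<comment> \<open>At u = - e the inequality 0 \<le> v \<le> 2 e^2 gives G \<le> 5 e \<le> c/2, and
    1/7 < 1/6 places this point before \<open>r6\<close>.\<close>
  define e where "e = min (1/7) (c / 10)"
  have e: "e > 0" "e \<le> 1/7" "10 * e \<le> c" using c by (auto simp: e_def min_def)
  obtain s where s: "s \<in> J" "s < t1" "U s = - e" using left_value[of "- e"] t1(4) e by auto
  have sr6: "s < r6" using less[OF s(1) r6(1)] s r6 e by simp
  have "c \<le> G (U s) (V s)"
    unfolding c_def
  proof (rule G_decreasing[OF less_imp_le[OF sr6] J_orbit[OF s(1)]])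
    show "0 < G (U r6) (V r6)" using c by (simp add: c_def)
    fix q assume q: "q \<in> {s..r6}"
    have qJ: "q \<in> J" using J_up[OF s(1)] q by auto
    show "U q \<le> 0" using bounds[OF qJ] by simp
    show "- 1/6 \<le> U q" using mono[OF qJ, of r6] q r6 by auto
    show "0 \<le> V q" using V0[OF qJ] q r6 by auto
  qed
  moreover have "G (U s) (V s) \<le> 5 * e"
  proof -
    have v: "0 \<le> V s" "V s \<le> 2 * e\<^sup>2" using V0[OF s(1,2)] P_negative_before[OF s(1,2)] s(3) by (auto simp: P_def)
    have e1: "e\<^sup>2 \<le> e" using e by (simp add: power2_eq_square mult_le_cancel_left1)
    have "V s * V s \<le> (2 * e\<^sup>2) * (2 * e\<^sup>2)" using v by (intro mult_mono) auto
    also have "\<dots> \<le> (2 * e) * 2" using e1 e by (intro mult_mono) auto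
    finally have 1: "(V s)\<^sup>2 \<le> 4 * e" by (simp add: power2_eq_square)
    have "e * V s \<ge> 0" using e v by simp
    moreover have "e ^ 3 \<le> e * 1" unfolding power3_eq_cube using e1 e by (intro mult_mono) (auto simp: power2_eq_square mult_le_one)
    ultimately show ?thesis using 1 by (simp add: G_def s(3))
  qed
  ultimately show False using e c by linarith
qed

lemma V_sign_change: "\<exists>t\<in>J. t < t1 \<and> V t = 0 \<and> (\<forall>s\<in>J. s < t \<longrightarrow> V s < 0) \<and> (\<forall>s>t. V s > 0)"
proof -
  obtain b where b: "b \<in> J" "b < t1" "V b < 0" using V_negative_exists by blast
  have "V t1 > 0" using t1(2,4) by (auto simp: P_def)
  then obtain t where t: "b \<le> t" "t \<le> t1" "V t = 0" using IVT'[of V b 0 t1] b contA by auto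
  have tJ: "t \<in> J" using J_up[OF b(1)] t by simp
  have fwd: "V y > 0" if "x \<in> J" "x < y" "V x \<ge> 0" for x y
    by (rule v_positive_forward[OF that(2) J_orbit[OF that(1)] that(3)])
      (use bounds J_up[OF that(1)] in auto)
  have "V s < 0" if "s \<in> J" "s < t" for s using fwd[OF that] t(3) by (force simp: not_less[symmetric])
  moreover have "V s > 0" if "s > t" for s using fwd[OF tJ that] t by simp
  ultimately show ?thesis using tJ t \<open>V t1 > 0\<close> by (intro bexI[of _ t]) (auto simp: less_le)
qed

definition t2 :: real where
  "t2 = (SOME t. t \<in> J \<and> t < t1 \<and> V t = 0 \<and> (\<forall>s\<in>J. s < t \<longrightarrow> V s < 0) \<and> (\<forall>s>t. V s > 0))"

lemma t2: "t2 \<in> J" "t2 < t1" "V t2 = 0" "\<And>s. s \<in> J \<Longrightarrow> s < t2 \<Longrightarrow> V s < 0" "\<And>s. s > t2 \<Longrightarrow> V s > 0"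
  using someI_ex[OF V_sign_change[unfolded Bex_def]] unfolding t2_def[symmetric] by auto

end

section \<open>Classification of the orbits in the left half plane\<close>

context similarity_flow
begin

text \<open>The orbits that correspond to solutions. Boundedness is the planar counterpart of f'
  tending to 0: it bounds f'', and f converges, so f' vanishes at infinity.\<close>

definition good_orbit :: "(real \<Rightarrow> real) \<Rightarrow> (real \<Rightarrow> real) \<Rightarrow> bool" where
  "good_orbit u v \<longleftrightarrow> orbit {0..} u v \<and> (\<forall>s\<ge>0. u s < 0) \<and> (\<exists>B. \<forall>s\<ge>0. \<bar>u s\<bar> \<le> B \<and> \<bar>v s\<bar> \<le> B)"

end

context stable_curve
begin

text \<open>\<open>hp\<close> and \<open>hm\<close> follow u along the two branches and continue it
  linearly beyond \<open>t1\<close>. Both become strictly monotone bijections onto u < 0, so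
  continuity of the inverses \<open>cp\<close> and \<open>cm\<close> needs no special treatment of
  the turning point.\<close>

definition hp :: "real \<Rightarrow> real" where "hp s = (if s \<le> t1 then U t1 + (s - t1) else U s)"
definition hm :: "real \<Rightarrow> real" where "hm s = (if s \<le> t1 then U s else U t1 - (s - t1))"
definition cp :: "real \<Rightarrow> real" where "cp = the_inv_into UNIV hp"
definition cm :: "real \<Rightarrow> real" where "cm = the_inv_into J hm"

text \<open>The curve consists of the graphs of \<open>gp\<close> and \<open>gm\<close> over \<open>[U t1, 0)\<close>; to the left of \<open>U t1\<close> both
  functions are continued by the nullcline \<open>P = 0\<close>.\<close>

definition gp :: "real \<Rightarrow> real" where
  "gp u = (if cp u \<le> t1 then 2 * (U t1 + (cp u - t1))\<^sup>2 else V (cp u))"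
definition gm :: "real \<Rightarrow> real" where
  "gm u = (if cm u \<le> t1 then V (cm u) else 2 * (U t1 - (cm u - t1))\<^sup>2)"

lemma isCont_U: "isCont U s"
  using contU by (rule continuous_on_interior) simp

lemma V_t1: "V t1 = 2 * (U t1)\<^sup>2" using t1(2) by (simp add: P_def)

lemma hp_mono: "a < b \<Longrightarrow> hp a < hp b"
  using U_inc[of a b] U_inc[of t1 b] by (auto simp: hp_def)

lemma hm_mono: "a \<in> J \<Longrightarrow> a < b \<Longrightarrow> hm b < hm a"
  using U_dec[of a b] U_dec[of a t1] by (cases "a = t1") (auto simp: hm_def)

lemma hp_inj: "inj_on hp UNIV"
  by (rule inj_onI) (metis hp_mono less_irrefl linorder_cases)

lemma hm_inj: "inj_on hm J"
  by (rule inj_onI) (metis hm_mono less_irrefl linorder_cases)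

lemma hp_range: "range hp = {..<0}"
proof (intro set_eqI iffI)
  fix u assume "u \<in> {..<0::real}"
  then have u: "u < 0" by simp
  show "u \<in> range hp"
  proof (cases "u \<le> U t1")
    case True
    then have "hp (t1 + (u - U t1)) = u" by (simp add: hp_def)
    then show ?thesis by (metis rangeI)
  next
    case False
    then have "U t1 < u" by simp
    then obtain s where "s > t1" "U s = u" using right_value[OF _ u] by blast
    then have "hp s = u" by (simp add: hp_def)
    then show ?thesis by (metis rangeI)
  qed
next
  fix u assume "u \<in> range hp"
  then obtain s where s: "u = hp s" by blast
  show "u \<in> {..<0}"
    using bounds[OF t1(1)] bounds[OF J_up[OF t1(1), of s]] by (auto simp: s hp_def)
qed

lemma hm_range: "hm ` J = {..<0}"
proof (intro set_eqI iffI)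
  fix u assume "u \<in> {..<0::real}"
  then have u: "u < 0" by simp
  show "u \<in> hm ` J"
  proof (cases "u \<le> U t1")
    case True
    then have "hm (t1 + (U t1 - u)) = u" "t1 + (U t1 - u) \<in> J"
      using J_up[OF t1(1)] by (auto simp: hm_def)
    then show ?thesis by (metis imageI)
  next
    case False
    then have "U t1 < u" by simp
    then obtain s where "s \<in> J" "s < t1" "U s = u" using left_value[OF _ u] by blast
    then have "hm s = u" "s \<in> J" by (auto simp: hm_def)
    then show ?thesis by (metis imageI)
  qed
next
  fix u assume "u \<in> hm ` J"
  then obtain s where s: "u = hm s" "s \<in> J" by blast
  show "u \<in> {..<0}"
    using bounds[OF t1(1)] bounds[OF s(2)] by (auto simp: s hm_def)
qed

lemma cp_hp: "cp (hp s) = s"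
  unfolding cp_def by (rule the_inv_into_f_f[OF hp_inj]) simp

lemma cm_hm: "s \<in> J \<Longrightarrow> cm (hm s) = s"
  unfolding cm_def by (rule the_inv_into_f_f[OF hm_inj])

lemma hp_cp: "u < 0 \<Longrightarrow> hp (cp u) = u"
  unfolding cp_def by (rule f_the_inv_into_f[OF hp_inj]) (simp add: hp_range)

lemma hm_cm: "u < 0 \<Longrightarrow> hm (cm u) = u" "u < 0 \<Longrightarrow> cm u \<in> J"
  unfolding cm_def using f_the_inv_into_f[OF hm_inj] the_inv_into_into[OF hm_inj _ order_refl]
  by (auto simp: hm_range)

lemma cont_cp: "continuous_on {..<0} cp"
proof (rule continuous_onI_mono)
  have "cp ` {..<0} = UNIV" using cp_hp hp_range by (metis (no_types, lifting) UNIV_eq_I image_eqI rangeI)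
  then show "open (cp ` {..<0})" by simp
  fix x y :: real assume "x \<in> {..<0}" "y \<in> {..<0}" "x \<le> y"
  then show "cp x \<le> cp y" using hp_cp[of x] hp_cp[of y] hp_mono[of "cp y" "cp x"] by force
qed

lemma cont_cm: "continuous_on {..<0} cm"
proof -
  have "continuous_on {..<0} (\<lambda>u. - cm u)"
  proof (rule continuous_onI_mono)
    have "cm ` {..<0} = J" using cm_hm hm_range hm_cm by force
    then have "(\<lambda>u. - cm u) ` {..<0} = uminus ` J" by (metis image_image)
    then show "open ((\<lambda>u. - cm u) ` {..<0})" using open_J by (simp add: open_negations)
    fix x y :: real assume "x \<in> {..<0}" "y \<in> {..<0}" "x \<le> y"
    then show "- cm x \<le> - cm y"
      using hm_cm[of x] hm_cm[of y] hm_mono[of "cm x" "cm y"] by force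
  qed
  from continuous_on_minus[OF this] show ?thesis by simp
qed

lemma cont_gp: "continuous_on {..<0} gp"
proof -
  have 1: "continuous_on {s \<in> UNIV. s \<le> t1} (\<lambda>s. 2 * (U t1 + (s - t1))\<^sup>2)" by (intro continuous_intros)
  have "continuous_on UNIV (\<lambda>s. if s \<le> t1 then 2 * (U t1 + (s - t1))\<^sup>2 else V s)"
    by (rule continuous_on_cases_le[where h = "\<lambda>s. s", OF 1 contA(2) continuous_on_id]) (simp add: V_t1)
  then have "continuous_on {..<0} (\<lambda>u. (\<lambda>s. if s \<le> t1 then 2 * (U t1 + (s - t1))\<^sup>2 else V s) (cp u))"
    by (rule continuous_on_compose2[OF _ cont_cp subset_UNIV])
  then show ?thesis unfolding gp_def[abs_def] .
qed

lemma cont_gm: "continuous_on {..<0} gm"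
proof -
  have 1: "continuous_on {s \<in> UNIV. t1 \<le> s} (\<lambda>s. 2 * (U t1 - (s - t1))\<^sup>2)" by (intro continuous_intros)
  have "continuous_on UNIV (\<lambda>s. if s \<le> t1 then V s else 2 * (U t1 - (s - t1))\<^sup>2)"
    by (rule continuous_on_cases_le[where h = "\<lambda>s. s", OF contA(2) 1 continuous_on_id]) (simp add: V_t1)
  then have "continuous_on {..<0} (\<lambda>u. (\<lambda>s. if s \<le> t1 then V s else 2 * (U t1 - (s - t1))\<^sup>2) (cm u))"
    by (rule continuous_on_compose2[OF _ cont_cm subset_UNIV])
  then show ?thesis unfolding gm_def[abs_def] .
qed

lemma g_left: "u \<le> U t1 \<Longrightarrow> gp u = 2 * u\<^sup>2" "u \<le> U t1 \<Longrightarrow> gm u = 2 * u\<^sup>2"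
proof -
  assume u: "u \<le> U t1"
  have "hp (t1 + (u - U t1)) = u" using u by (simp add: hp_def)
  then have "cp u = t1 + (u - U t1)" using cp_hp by metis
  then show "gp u = 2 * u\<^sup>2" using u by (simp add: gp_def)
next
  assume u: "u \<le> U t1"
  have "hm (t1 + (U t1 - u)) = u" "t1 + (U t1 - u) \<in> J" using u J_up[OF t1(1)] by (auto simp: hm_def)
  then have "cm u = t1 + (U t1 - u)" using cm_hm by metis
  then show "gm u = 2 * u\<^sup>2" using u V_t1 by (auto simp: gm_def)
qed

lemma gp_right:
  assumes "U t1 < u" "u < 0" shows "cp u > t1" "U (cp u) = u" "gp u = V (cp u)"
proof -
  obtain s where "s > t1" "U s = u" using right_value[OF assms] by blast
  then have "hp s = u" by (simp add: hp_def)
  then have "cp u = s" using cp_hp by metis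
  then show "cp u > t1" "U (cp u) = u" "gp u = V (cp u)" using \<open>s > t1\<close> \<open>U s = u\<close> by (auto simp: gp_def)
qed

lemma gm_right:
  assumes "U t1 < u" "u < 0" shows "cm u < t1" "cm u \<in> J" "U (cm u) = u" "gm u = V (cm u)"
proof -
  obtain s where s: "s \<in> J" "s < t1" "U s = u" using left_value[OF assms] by blast
  then have "hm s = u" by (simp add: hm_def)
  then have "cm u = s" using cm_hm[OF s(1)] by metis
  then show "cm u < t1" "cm u \<in> J" "U (cm u) = u" "gm u = V (cm u)" using s by (auto simp: gm_def)
qed

lemma curve_on_graphs: "s \<in> J \<Longrightarrow> V s = gp (U s) \<or> V s = gm (U s)"
proof -
  assume s: "s \<in> J"
  show ?thesis
  proof (cases "s \<le> t1")
    case True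
    then have "hm s = U s" by (simp add: hm_def)
    then have "cm (U s) = s" using cm_hm[OF s] by metis
    then show ?thesis using True by (simp add: gm_def)
  next
    case False
    then have "hp s = U s" by (simp add: hp_def)
    then have "cp (U s) = s" using cp_hp by metis
    then show ?thesis using False by (simp add: gp_def)
  qed
qed

lemma graphs_on_curve:
  assumes "U t1 \<le> u" "u < 0" "v = gp u \<or> v = gm u" shows "\<exists>c\<in>J. u = U c \<and> v = V c"
proof (cases "u = U t1")
  case True
  then show ?thesis using assms g_left[of u] t1(1) V_t1 by auto
next
  case False
  then have u: "U t1 < u" using assms by simp
  show ?thesis
    using gp_right[OF u assms(2)] gm_right[OF u assms(2)] assms(3) J_up[OF t1(1), of "cp u"]
    by (metis less_imp_le)
qed

lemma g_order: "U t1 < u \<Longrightarrow> u < 0 \<Longrightarrow> gm u < 2 * u\<^sup>2 \<and> 2 * u\<^sup>2 < gp u"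
  using gp_right[of u] gm_right[of u] t1(3)[of "cp u"] P_negative_before[of "cm u"] by (simp add: P_def)

lemma g_le: "u < 0 \<Longrightarrow> gm u \<le> 2 * u\<^sup>2 \<and> 2 * u\<^sup>2 \<le> gp u"
  using g_order[of u] g_left[of u] by (cases "u \<le> U t1") auto

lemma curve_between: "s \<in> J \<Longrightarrow> gm (U s) \<le> V s \<and> V s \<le> gp (U s)"
  using curve_on_graphs[of s] g_le[of "U s"] bounds[of s] by force

lemma g_bounds: "U t1 < u \<Longrightarrow> u < 0 \<Longrightarrow> gp u < - \<alpha> * u \<and> - 5/4 * \<alpha>\<^sup>2 < gm u"
  using gp_right[of u] gm_right[of u] bounds[of "cp u"] bounds[of "cm u"] J_up[OF t1(1), of "cp u"] by force

lemma gm_sign: "U t1 < u \<Longrightarrow> u < 0 \<Longrightarrow> gm u \<ge> 0 \<longleftrightarrow> u \<le> U t2"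
proof -
  assume u: "U t1 < u" "u < 0"
  note c = gm_right[OF u]
  consider "cm u < t2" | "cm u = t2" | "cm u > t2" by linarith
  then show ?thesis
  proof cases
    case 1
    then have "U t2 < U (cm u)" "V (cm u) < 0" using U_dec[OF c(2), of t2] t2 c(2) by auto
    then show ?thesis using c by simp
  next
    case 2
    then show ?thesis using c t2 by auto
  next
    case 3
    then have "U (cm u) < U t2" "V (cm u) > 0" using U_dec[OF t2(1), of "cm u"] t2 c(1) by auto
    then show ?thesis using c by simp
  qed
qed

lemma DERIV_gp:
  assumes u: "U t1 < u" "u < 0"
  shows "DERIV gp u :> Q u (gp u) / P u (gp u)"
proof -
  note c = gp_right[OF u]
  have J: "cp u \<in> J" using c(1) J_up[OF t1(1)] by simp
  have P0: "P (U (cp u)) (V (cp u)) \<noteq> 0" using t1(3)[OF c(1)] by simp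
  have "DERIV cp u :> inverse (P (U (cp u)) (V (cp u)))"
  proof (rule DERIV_inverse_function[where a = "U t1" and b = 0])
    show "DERIV U (cp u) :> P (U (cp u)) (V (cp u))" by (rule J_DERIV[OF J])
    show "isCont cp u" using cont_cp u by (simp add: continuous_on_eq_continuous_at)
  qed (use P0 u gp_right in auto)
  from DERIV_chain2[OF J_DERIV(2)[OF J] this]
  have "DERIV (\<lambda>u. V (cp u)) u :> Q u (gp u) / P u (gp u)" using c by (simp add: divide_inverse)
  then show ?thesis
  proof (rule has_field_derivative_transform_within_open)
    show "V (cp x) = gp x" if "x \<in> {U t1<..<0}" for x using gp_right[of x] that by simp
  qed (use u in auto)
qed

text \<open>Uniqueness of the strong stable manifold: the vertical distance \<open>w\<close> of an orbit to the upper branch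
  satisfies \<open>w' = u\<^sup>2 (1 + 6 u) / P u (gp u) * w\<close>, so it cannot tend to \<open>0\<close> unless it vanishes.\<close>

lemma on_curve_of_limit:
  assumes o: "orbit {a..} u v" and neg: "\<And>s. s \<ge> a \<Longrightarrow> u s < 0"
    and lim: "(u \<longlongrightarrow> 0) at_top" "(v \<longlongrightarrow> 0) at_top"
  shows "\<exists>s\<ge>a. \<exists>c\<in>J. u s = U c \<and> v s = V c"
proof -
  have "\<forall>\<^sub>F s in at_top. u s > - 1/6" using order_tendstoD(1)[OF lim(1), of "- 1/6"] by simp
  then obtain N where N: "\<And>s. s \<ge> N \<Longrightarrow> u s > - 1/6" by (auto simp: eventually_at_top_linorder)
  \<comment> \<open>From here on the orbit is to the right of A, where 1 + 6 u > 0, so the distance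
    \<open>w\<close> cannot shrink.\<close>
  define s0 where "s0 = max a N"
  have s0: "s0 \<ge> a" "\<And>s. s \<ge> s0 \<Longrightarrow> - 1/6 < u s \<and> u s < 0 \<and> U t1 < u s"
    using N neg t1(4) by (force simp: s0_def)+
  have osub: "orbit {s0..b} u v" for b using orbit_subset[OF o] s0 by auto
  define w where "w s = v s - gp (u s)" for s
  define k where "k s = (u s)\<^sup>2 * (1 + 6 * u s) / P (u s) (gp (u s))" for s
  have Pp: "P (u s) (gp (u s)) > 0" if "s \<ge> s0" for s using g_order[of "u s"] s0(2)[OF that] by (simp add: P_def)
  have contg: "continuous_on {s0..b} (\<lambda>s. gp (u s))" for b
    by (rule continuous_on_compose2[OF cont_gp orbit_continuous(1)[OF osub]]) (use s0 in auto)
  have kc: "continuous_on {s0..b} k" for b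
  proof -
    have "continuous_on {s0..b} (\<lambda>s. P (u s) (gp (u s)))"
      unfolding P_def by (intro continuous_intros contg orbit_continuous[OF osub])
    moreover have "\<forall>s\<in>{s0..b}. P (u s) (gp (u s)) \<noteq> 0" using Pp by (metis atLeastAtMost_iff less_irrefl)
    moreover have "continuous_on {s0..b} (\<lambda>s. (u s)\<^sup>2 * (1 + 6 * u s))"
      by (intro continuous_intros orbit_continuous[OF osub])
    ultimately show ?thesis unfolding k_def by (intro continuous_on_divide)
  qed
  have growth: "\<bar>w s0\<bar> \<le> \<bar>w b\<bar>" if b: "s0 \<le> b" for b
  proof -
    have "w b = w s0 * exp (integral {s0..b} k)"
    proof (rule linear_growth_zero[OF b])
      show "continuous_on {s0..b} w" unfolding w_def
        by (intro continuous_intros contg orbit_continuous[OF osub])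
      show "continuous_on {s0..b} k" by (rule kc)
      fix s assume s: "s0 < s" "s < b"
      note u = s0(2)[of s]
      note D = orbit_DERIV_Icc[OF osub s]
      have "DERIV (\<lambda>s. gp (u s)) s :> Q (u s) (gp (u s)) / P (u s) (gp (u s)) * P (u s) (v s)"
        by (rule DERIV_chain2[OF DERIV_gp D(1)]) (use u s in auto)
      then have "DERIV w s :> Q (u s) (v s) - Q (u s) (gp (u s)) / P (u s) (gp (u s)) * P (u s) (v s)"
        unfolding w_def by (intro DERIV_diff D)
      also have "Q (u s) (v s) - Q (u s) (gp (u s)) / P (u s) (gp (u s)) * P (u s) (v s) = k s * w s"
      proof -
        have "Q x y * P x g - Q x g * P x y = x\<^sup>2 * (1 + 6 * x) * (y - g)" for x y g
          unfolding P_def Q_def by (simp add: m power2_eq_square algebra_simps)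
        note eq = this[of "u s" "v s" "gp (u s)"]
        have "Q (u s) (v s) - Q (u s) (gp (u s)) / P (u s) (gp (u s)) * P (u s) (v s) =
          (Q (u s) (v s) * P (u s) (gp (u s)) - Q (u s) (gp (u s)) * P (u s) (v s)) / P (u s) (gp (u s))"
          using Pp[of s] s by (simp add: diff_divide_distrib)
        also have "\<dots> = k s * w s" unfolding eq by (simp add: k_def w_def)
        finally show ?thesis .
      qed
      finally show "DERIV w s :> k s * w s" .
    qed
    moreover have "integral {s0..b} k \<ge> 0"
    proof (rule Henstock_Kurzweil_Integration.integral_nonneg)
      show "k integrable_on {s0..b}" by (intro integrable_continuous_real kc)
      show "0 \<le> k s" if "s \<in> {s0..b}" for s
        unfolding k_def using Pp[of s] s0(2)[of s] that by (intro divide_nonneg_pos mult_nonneg_nonneg) auto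
    qed
    ultimately show ?thesis by (simp add: abs_mult mult_le_cancel_left1)
  qed
  \<comment> \<open>The upper branch is squeezed between 0 and its tangent - \<alpha> u, so
    \<open>w\<close> tends to 0; not shrinking, it must vanish.\<close>
  have "((\<lambda>s. gp (u s)) \<longlongrightarrow> 0) at_top"
  proof (rule tendsto_sandwich[of "\<lambda>_. 0" _ _ "\<lambda>s. - \<alpha> * u s"])
    show "\<forall>\<^sub>F s in at_top. 0 \<le> gp (u s)"
      using eventually_ge_at_top[of a]
    proof eventually_elim
      case (elim s)
      then show ?case using g_le[of "u s"] neg[of s] zero_le_power2[of "u s"] by linarith
    qed
    show "\<forall>\<^sub>F s in at_top. gp (u s) \<le> - \<alpha> * u s"
      using eventually_ge_at_top[of s0] by eventually_elim (use g_bounds s0 in \<open>auto intro: less_imp_le\<close>)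
    show "((\<lambda>s. - \<alpha> * u s) \<longlongrightarrow> 0) at_top" using tendsto_mult[OF tendsto_const[of "- \<alpha>"] lim(1)] by simp
  qed auto
  then have "((\<lambda>s. \<bar>w s\<bar>) \<longlongrightarrow> 0) at_top"
    unfolding w_def using tendsto_rabs[OF tendsto_diff[OF lim(2)]] by force
  then have "\<bar>w s0\<bar> \<le> 0"
    by (rule tendsto_lowerbound) (use growth in \<open>auto simp: eventually_at_top_linorder\<close>)
  then have "v s0 = gp (u s0)" by (simp add: w_def)
  moreover have "U t1 \<le> u s0" "u s0 < 0" using s0(2)[of s0] by auto
  ultimately have "\<exists>c\<in>J. u s0 = U c \<and> v s0 = V c" using graphs_on_curve by blast
  then show ?thesis using s0(1) by blast
qed

text \<open>By uniqueness the orbit is a time shift of the curve as long as the curve exists. If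
  \<open>J\<close> ended within the shifted interval, u would approach 0 there, although it has a
  negative maximum on the compact interval.\<close>

lemma touching_orbit:
  assumes o: "orbit {a..b} u v" and neg: "\<And>s. s \<in> {a..b} \<Longrightarrow> u s < 0"
    and r: "r \<in> {a..b}" and c: "c \<in> J" "u r = U c" "v r = V c" and s: "s \<in> {a..b}"
  shows "s - r + c \<in> J" "u s = U (s - r + c)" "v s = V (s - r + c)"
proof -
  define d where "d = c - r"
  have shift: "orbit {x..y} (\<lambda>s. U (s + d)) (\<lambda>s. V (s + d))" if "x + d \<in> J" for x y
    by (rule orbit_shift[OF oJ]) (use J_up[OF that] in auto)
  have rd: "r + d = c" by (simp add: d_def)
  have "a + d \<in> J"
  proof (rule ccontr)
    assume "a + d \<notin> J"
    then obtain \<sigma> where \<sigma>: "J = {\<sigma><..}" "U \<sigma> = 0" using J by auto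
    have sc: "a + d \<le> \<sigma>" "\<sigma> < c" using \<sigma> c \<open>a + d \<notin> J\<close> by auto
    have "continuous_on {a..b} u" using orbit_continuous[OF o] by simp
    then obtain x where x: "x \<in> {a..b}" "\<And>y. y \<in> {a..b} \<Longrightarrow> u y \<le> u x"
      using continuous_attains_sup[of "{a..b}" u] r by fastforce
    have "U q \<le> u x" if q: "\<sigma> < q" "q < c" for q
    proof -
      have "u (q - d) = U (q - d + d)"
      proof (rule orbit_unique(1)[OF orbit_subset[OF o] shift, of "q - d" b r])
        show "q - d + d \<in> J" using q \<sigma> by simp
      qed (use q sc r rd c d_def in auto)
      moreover have "q - d \<in> {a..b}" using q sc r d_def by auto
      ultimately show ?thesis using x(2)[of "q - d"] by simp
    qed
    then have "U \<sigma> \<le> u x"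
      by (rule isCont_le_right[OF isCont_U sc(2)])
    then show False using \<sigma> neg[OF x(1)] by simp
  qed
  note uniq = orbit_unique[OF o shift[OF this] r _ _ s]
  show "s - r + c \<in> J" using J_up[OF \<open>a + d \<in> J\<close>, of "s + d"] s by (simp add: d_def algebra_simps)
  show "u s = U (s - r + c)" "v s = V (s - r + c)"
    using uniq c rd by (simp_all add: d_def algebra_simps)
qed

text \<open>To the right of \<open>U t1\<close> the graph of \<open>gp\<close> is the curve itself,
  and meeting it would put the earlier orbit on the curve. To the left it is the parabola, which for
  u < - 1/6 is crossed only from P < 0 to P > 0.\<close>

lemma above_invariant:
  assumes g: "good_orbit u v" and s0: "s0 \<ge> 0" and ab: "gp (u s0) < v s0" and s: "s \<ge> s0"
  shows "gp (u s) < v s"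
proof (rule ccontr)
  assume "\<not> gp (u s) < v s"
  have o: "orbit {0..} u v" and neg: "\<And>s. s \<ge> 0 \<Longrightarrow> u s < 0" using g by (auto simp: good_orbit_def)
  have os: "orbit {s0..s} u v" using orbit_subset[OF o] s0 by auto
  define h where "h r = v r - gp (u r)" for r
  have ch: "continuous_on {s0..s} h" unfolding h_def
    by (intro continuous_intros orbit_continuous[OF os] continuous_on_compose2[OF cont_gp orbit_continuous(1)[OF os]])
      (use neg s0 in auto)
  obtain q where q0: "s0 < q" and q: "q \<le> s" "h q = 0" and before: "\<And>r. s0 \<le> r \<Longrightarrow> r < q \<Longrightarrow> h r > 0"
    by (rule first_zero[OF ch]) (use s ab \<open>\<not> gp (u s) < v s\<close> in \<open>auto simp: h_def\<close>)
  have vq: "v q = gp (u q)" using q(2) by (simp add: h_def)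
  have uq: "u q < 0" using neg s0 q0 by simp
  show False
  proof (cases "U t1 \<le> u q")
    case True
    then obtain c where c: "c \<in> J" "u q = U c" "v q = V c" using graphs_on_curve uq vq by blast
    have "orbit {s0..q} u v" using orbit_subset[OF o] s0 by auto
    from touching_orbit[OF this _ _ c, of s0] have "\<exists>c'\<in>J. u s0 = U c' \<and> v s0 = V c'"
      using neg s0 q0 by auto
    then show False using curve_between ab by force
  next
    case False
    then have uq6: "u q < - 1/6" using t1(4) by simp
    have P0: "P (u q) (v q) = 0" using vq g_left[of "u q"] False by (simp add: P_def)
    have int: "q \<in> interior {0..}" using s0 q0 by simp
    have D: "DERIV (\<lambda>s. P (u s) (v s)) q :> - (u q)\<^sup>2 * (1 + 6 * u q)"
      using DERIV_P[OF orbit_DERIV[OF o int]] P0 by simp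
    have pos: "- (u q)\<^sup>2 * (1 + 6 * u q) > 0" using uq6 by (intro mult_neg_neg) auto
    obtain d where d: "d > 0" "\<And>h. 0 < h \<Longrightarrow> h < d \<Longrightarrow> P (u (q - h)) (v (q - h)) < 0"
      using DERIV_pos_inc_left[OF D pos] P0 by auto
    define e where "e = min (d / 2) (q - s0)"
    have e: "0 < e" "e < d" "s0 \<le> q - e" using d q0 by (auto simp: e_def min_def)
    have "gp (u (q - e)) < v (q - e)" using before[of "q - e"] e by (simp add: h_def)
    then show False using d(2)[OF e(1,2)] g_le[of "u (q - e)"] neg[of "q - e"] e s0 by (simp add: P_def)
  qed
qed

lemma good_orbit_limit:
  assumes g: "good_orbit u v" and lim: "(u \<longlongrightarrow> l) at_top"
  shows "(v \<longlongrightarrow> 2 * l\<^sup>2) at_top" "l = 0 \<or> l = - 1/6"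
proof -
  obtain B where B: "\<And>s. s \<ge> 0 \<Longrightarrow> \<bar>u s\<bar> \<le> B \<and> \<bar>v s\<bar> \<le> B" using g by (auto simp: good_orbit_def)
  have o: "orbit {0..} u v" using g by (simp add: good_orbit_def)
  show "(v \<longlongrightarrow> 2 * l\<^sup>2) at_top" "l = 0 \<or> l = - 1/6"
    using equilibrium_limit[of 1 0 u v B l] o B lim by (auto simp: orbit_def)
qed

lemma orbit_mono_Icc:
  assumes o: "orbit {0..} u v" and a: "0 \<le> a" "a \<le> b"
  shows "(\<And>s. s \<ge> a \<Longrightarrow> P (u s) (v s) \<ge> 0) \<Longrightarrow> u a \<le> u b"
    and "(\<And>s. s \<ge> a \<Longrightarrow> P (u s) (v s) \<le> 0) \<Longrightarrow> u b \<le> u a"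
proof -
  have os: "orbit {a..b} u v" using orbit_subset[OF o] a by auto
  show "u a \<le> u b" if "\<And>s. s \<ge> a \<Longrightarrow> P (u s) (v s) \<ge> 0"
    by (rule DERIV_nonneg_imp_increasing_open[OF a(2)])
      (use orbit_DERIV_Icc(1)[OF os] that orbit_continuous[OF os] in \<open>auto intro!: exI\<close>)
  show "u b \<le> u a" if "\<And>s. s \<ge> a \<Longrightarrow> P (u s) (v s) \<le> 0"
    by (rule DERIV_nonpos_imp_decreasing_open[OF a(2)])
      (use orbit_DERIV_Icc(1)[OF os] that orbit_continuous[OF os] in \<open>auto intro!: exI\<close>)
qed

text \<open>Above \<open>gp\<close> the coordinate u does not decrease and stays negative, so it
  tends to 0 or - 1/6. The first limit puts the orbit on the curve; in the second case v would tend
  to 1/18 < \<open>gp (- 1/6)\<close>.\<close>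

lemma not_above:
  assumes g: "good_orbit u v" and s0: "s0 \<ge> 0"
  shows "v s0 \<le> gp (u s0)"
proof (rule ccontr)
  assume "\<not> v s0 \<le> gp (u s0)"
  then have ab: "gp (u s) < v s" if "s \<ge> s0" for s using above_invariant[OF g s0 _ that] by simp
  have o: "orbit {0..} u v" and neg: "\<And>s. s \<ge> 0 \<Longrightarrow> u s < 0" using g by (auto simp: good_orbit_def)
  have P: "P (u s) (v s) \<ge> 0" if "s \<ge> s0" for s
    using ab[OF that] g_le[of "u s"] neg[of s] that s0 by (simp add: P_def)
  obtain l where l: "(u \<longlongrightarrow> l) at_top" "\<And>s. s0 \<le> s \<Longrightarrow> u s \<le> l" "l \<le> 0"
    by (rule monotone_bounded_limit[of s0 u 0])
      (use orbit_mono_Icc(1)[OF o] P neg s0 in \<open>auto intro: less_imp_le\<close>)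
  note lim = good_orbit_limit[OF g l(1)]
  from lim(2) show False
  proof
    assume "l = 0"
    then have "(v \<longlongrightarrow> 0) at_top" using lim(1) by simp
    then obtain s c where "s \<ge> s0" "c \<in> J" "u s = U c" "v s = V c"
      using on_curve_of_limit[of s0 u v] orbit_subset[OF o] neg s0 l(1) \<open>l = 0\<close> by force
    then show False using curve_between[of c] ab[of s] by simp
  next
    assume l6: "l = - 1/6"
    have "((\<lambda>s. gp (u s)) \<longlongrightarrow> gp (- 1/6)) at_top"
      by (rule isCont_tendsto_compose[OF _ l(1)[unfolded l6]])
        (use cont_gp in \<open>simp add: continuous_on_eq_continuous_at\<close>)
    then have "gp (- 1/6) \<le> 2 * l\<^sup>2"
      by (rule tendsto_le[OF trivial_limit_at_top_linorder lim(1)])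
        (use ab in \<open>auto simp: eventually_at_top_linorder intro: less_imp_le\<close>)
    then show False using g_order[of "- 1/6"] t1(4) by (simp add: l6)
  qed
qed

text \<open>It remains to exclude orbits on the parabola left of \<open>U t1\<close> and orbits
  below \<open>gm\<close>. The former enter P > 0 at once, hence the region above \<open>gp\<close>.
  Along the latter u does not increase, so they would converge to A, which lies above
  \<open>gm\<close>.\<close>

lemma good_orbit_classification:
  assumes g: "good_orbit u v"
  shows "(\<exists>c\<in>J. u 0 = U c \<and> v 0 = V c) \<or> gm (u 0) < v 0 \<and> v 0 < gp (u 0)"
proof (rule ccontr)
  assume neither: "\<not> ?thesis"
  have o: "orbit {0..} u v" and neg: "\<And>s. s \<ge> 0 \<Longrightarrow> u s < 0" using g by (auto simp: good_orbit_def)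
  have off: False if "s \<ge> 0" "c \<in> J" "u s = U c" "v s = V c" for s c
  proof -
    have "orbit {0..s} u v" using orbit_subset[OF o] by auto
    from touching_orbit[OF this _ _ that(2-4), of 0] neg that have "\<exists>c\<in>J. u 0 = U c \<and> v 0 = V c" by auto
    then show False using neither by blast
  qed
  have noteq: "v s \<noteq> gm (u s)" if s: "s \<ge> 0" for s
  proof
    assume vs: "v s = gm (u s)"
    show False
    proof (cases "U t1 \<le> u s")
      case True
      then show False using graphs_on_curve[OF True neg[OF s]] vs off[OF s] by blast
    next
      case False
      have u6: "u s < - 1/6" using False t1(4) by simp
      have P0: "P (u s) (v s) = 0" using vs g_left[of "u s"] False by (simp add: P_def)
      have ev: "\<exists>r\<ge>0. u r < U t1 \<and> P (u r) (v r) > 0"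
      proof -
        \<comment> \<open>As s = 0 is allowed, the derivative is only one-sided here, so the
          two-sided formula for P does not apply.\<close>
        have D: "((\<lambda>s. P (u s) (v s)) has_real_derivative - (u s)\<^sup>2 * (1 + 6 * u s)) (at s within {0..})"
        proof -
          have "((\<lambda>s. P (u s) (v s)) has_real_derivative Q (u s) (v s) - 4 * u s * P (u s) (v s)) (at s within {0..})"
            unfolding P_def[of "u _"] using o s
            by (auto simp: orbit_def P_def intro!: derivative_eq_intros)
          moreover have "Q (u s) (v s) - 4 * u s * P (u s) (v s) = - (u s)\<^sup>2 * (1 + 6 * u s)"
          proof -
            have "v s = 2 * (u s)\<^sup>2" using P0 by (simp add: P_def)
            then show ?thesis by (simp add: P_def Q_def) (simp add: m power2_eq_square algebra_simps)
          qed
          ultimately show ?thesis by simp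
        qed
        have pos: "- (u s)\<^sup>2 * (1 + 6 * u s) > 0" using u6 by (intro mult_neg_neg) auto
        obtain d where d: "d > 0" "\<And>h. 0 < h \<Longrightarrow> s + h \<in> {0..} \<Longrightarrow> h < d \<Longrightarrow> P (u s) (v s) < P (u (s + h)) (v (s + h))"
          using has_real_derivative_pos_inc_right[OF D pos] by blast
        have "\<forall>\<^sub>F r in at s within {0..}. u r < U t1"
          using orbit_continuous(1)[OF o] s False
          by (intro order_tendstoD) (auto simp: continuous_on_def)
        then obtain e where e: "e > 0" "\<And>r. r \<in> {0..} \<Longrightarrow> r \<noteq> s \<Longrightarrow> dist r s < e \<Longrightarrow> u r < U t1"
          unfolding eventually_at by blast
        define h where "h = min d e / 2"
        have "0 < h" "h < d" "h < e" using d e by (auto simp: h_def)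
        then show ?thesis using d(2)[of h] e(2)[of "s + h"] s P0 by (intro exI[of _ "s + h"]) (auto simp: dist_real_def)
      qed
      then obtain r where r: "r \<ge> 0" "u r < U t1" "P (u r) (v r) > 0" by blast
      then show False using not_above[OF g r(1)] g_left[of "u r"] by (simp add: P_def)
    qed
  qed
  have "v 0 \<le> gm (u 0)"
  proof (rule ccontr)
    assume gt: "\<not> v 0 \<le> gm (u 0)"
    then have eq: "v 0 = gp (u 0)" using neither not_above[OF g, of 0] by auto
    then have "U t1 < u 0" using gt g_left[of "u 0"] by (cases "u 0 \<le> U t1") auto
    then obtain c where "c \<in> J" "u 0 = U c" "v 0 = V c"
      using graphs_on_curve[of "u 0" "v 0"] eq neg[of 0] by auto
    then show False using off[of 0 c] by simp
  qed
  then have lt0: "v 0 < gm (u 0)" using noteq[of 0] by simp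
  have below: "v s < gm (u s)" if s: "s \<ge> 0" for s
  proof (rule ccontr)
    assume "\<not> v s < gm (u s)"
    have os: "orbit {0..s} u v" using orbit_subset[OF o] by auto
    have "continuous_on {0..s} (\<lambda>r. v r - gm (u r))"
      by (intro continuous_intros orbit_continuous[OF os] continuous_on_compose2[OF cont_gm orbit_continuous(1)[OF os]])
        (use neg in auto)
    then obtain r where "0 \<le> r" "r \<le> s" "v r - gm (u r) = 0"
      using IVT'[of "\<lambda>r. v r - gm (u r)" 0 0 s] lt0 s \<open>\<not> v s < gm (u s)\<close> by auto
    then show False using noteq[of r] by simp
  qed
  obtain B where B: "\<And>s. s \<ge> 0 \<Longrightarrow> \<bar>u s\<bar> \<le> B" using g by (auto simp: good_orbit_def)
  have P: "P (u s) (v s) \<le> 0" if "s \<ge> 0" for s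
    using below[OF that] g_le[of "u s"] neg[OF that] by (simp add: P_def)
  obtain l where l: "(u \<longlongrightarrow> l) at_top" "\<And>s. 0 \<le> s \<Longrightarrow> l \<le> u s"
  proof (rule antimono_bounded_limit[of 0 u "- B"])
    show "- B \<le> u s" if "0 \<le> s" for s using B[OF that] by linarith
    show "u y \<le> u x" if "0 \<le> x" "x \<le> y" for x y
      by (rule orbit_mono_Icc(2)[OF o that]) (use P that in auto)
  qed blast
  note lim = good_orbit_limit[OF g l(1)]
  have l6: "l = - 1/6" using lim(2) l(2)[of 0] neg[of 0] by auto
  have "((\<lambda>s. gm (u s)) \<longlongrightarrow> gm (- 1/6)) at_top"
    by (rule isCont_tendsto_compose[OF _ l(1)[unfolded l6]])
      (use cont_gm in \<open>simp add: continuous_on_eq_continuous_at\<close>)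
  then have "2 * l\<^sup>2 \<le> gm (- 1/6)"
    by (rule tendsto_le[OF trivial_limit_at_top_linorder _ lim(1)])
      (use below in \<open>auto simp: eventually_at_top_linorder intro: less_imp_le\<close>)
  then show False using g_order[of "- 1/6"] t1(4) by (simp add: l6)
qed

lemma open_between: "open {z. fst z < 0 \<and> gm (fst z) < snd z \<and> snd z < gp (fst z)}"
proof -
  define H where "H = {z :: real \<times> real. fst z < 0}"
  have H: "open H" unfolding H_def by (intro open_Collect_less continuous_intros)
  have c: "continuous_on H (\<lambda>z. snd z - gm (fst z))" "continuous_on H (\<lambda>z. gp (fst z) - snd z)"
    by (intro continuous_intros continuous_on_compose2[OF cont_gm] continuous_on_compose2[OF cont_gp]; force simp: H_def)+
  have "open (H \<inter> (\<lambda>z. snd z - gm (fst z)) -` {0<..} \<inter> (H \<inter> (\<lambda>z. gp (fst z) - snd z) -` {0<..}))"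
    by (intro open_Int continuous_open_preimage[OF _ H] c) auto
  also have "H \<inter> (\<lambda>z. snd z - gm (fst z)) -` {0<..} \<inter> (H \<inter> (\<lambda>z. gp (fst z) - snd z) -` {0<..}) =
    {z. fst z < 0 \<and> gm (fst z) < snd z \<and> snd z < gp (fst z)}" by (auto simp: H_def)
  finally show ?thesis .
qed

text \<open>At a first exit the orbit would be on one of the graphs, hence on the curve from the
  start, or on u = 0 with v \<le> 0. There v < 0 would mean that it came from u > 0, and v = 0 is an
  equilibrium, which no other orbit reaches in finite time.\<close>

lemma trapped_orbit:
  assumes p: "p < 0" and q: "gm p < q" "q < gp p"
  obtains u v where "good_orbit u v" "u 0 = p" "v 0 = q"
proof -
  define M where "M = 2 * \<alpha>\<^sup>2"
  have a2: "\<alpha>\<^sup>2 > \<alpha>" using alpha by (simp add: power2_eq_square)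
  have M: "M > 2" "M > \<alpha>" using a2 alpha by (auto simp: M_def)
  obtain u v where u0: "u 0 = p" "v 0 = q"
    and uD: "\<And>s. s \<ge> 0 \<Longrightarrow> (u has_real_derivative 1 * P (clip M (u s)) (clip M (v s))) (at s within {0..})"
    and vD: "\<And>s. s \<ge> 0 \<Longrightarrow> (v has_real_derivative 1 * Q (clip M (u s)) (clip M (v s))) (at s within {0..})"
    using clipped_orbit_exists[of M 1 p q] M by auto
  have cu: "continuous_on {0..} u" and cv: "continuous_on {0..} v"
    using uD vD by (auto intro!: DERIV_continuous_on)
  define D where "D = {z. fst z < 0 \<and> gm (fst z) < snd z \<and> snd z < gp (fst z)}"
  \<comment> \<open>For u \<le> \<open>U t1\<close> both graphs coincide, so the region lies to the
    right of \<open>U t1\<close> and inherits the bounds of the curve.\<close>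
  have D_bounds: "\<bar>x\<bar> < M \<and> \<bar>y\<bar> < M \<and> U t1 < x \<and> y < - \<alpha> * x" if "(x, y) \<in> D" for x y
  proof -
    have x: "x < 0" "gm x < y" "y < gp x" using that by (auto simp: D_def)
    then have ut: "U t1 < x" using g_left[of x] by (cases "x \<le> U t1") auto
    have x2: "- \<alpha> / 2 < x" using bounds[OF t1(1)] ut by linarith
    have y: "y < - \<alpha> * x" "- 5/4 * \<alpha>\<^sup>2 < y" using g_bounds[OF ut x(1)] x by auto
    have "\<alpha> * - x \<le> \<alpha> * (\<alpha> / 2)" using x2 alpha by (intro mult_left_mono) auto
    then have "\<bar>y\<bar> < M" using y a2 alpha unfolding M_def power2_eq_square by linarith
    moreover have "\<bar>x\<bar> < M" using x x2 M alpha by linarith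
    ultimately show ?thesis using ut y by simp
  qed
  have orb: "orbit {0..b} u v" if "\<And>s. s \<in> {0..b} \<Longrightarrow> \<bar>u s\<bar> \<le> M \<and> \<bar>v s\<bar> \<le> M" for b
    unfolding orbit_def
  proof (intro ballI)
    fix s assume s: "s \<in> {0..b}"
    then have "(u has_real_derivative 1 * P (clip M (u s)) (clip M (v s))) (at s within {0..b})"
      "(v has_real_derivative 1 * Q (clip M (u s)) (clip M (v s))) (at s within {0..b})"
      using uD[of s] vD[of s] by (auto intro: DERIV_subset)
    then show "(u has_real_derivative P (u s) (v s)) (at s within {0..b}) \<and>
      (v has_real_derivative Q (u s) (v s)) (at s within {0..b})"
      using that[OF s] by (simp add: clip_id)
  qed
  define z where "z s = (u (max s 0), v (max s 0))" for s
  have cz: "continuous_on UNIV z" unfolding z_def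
    by (intro continuous_on_Pair continuous_on_compose2[OF cu] continuous_on_compose2[OF cv] continuous_intros) auto
  have inD: "(u s, v s) \<in> D" if s: "s \<ge> 0" for s
  proof (rule ccontr)
    assume bad: "(u s, v s) \<notin> D"
    define Z where "Z = {0..} \<inter> z -` (- D)"
    have "closed (z -` (- D))"
      using continuous_closed_preimage[OF cz closed_UNIV, of "- D"] open_between by (simp add: D_def closed_Compl)
    then have "closed Z" unfolding Z_def by (intro closed_Int) auto
    moreover have "s \<in> Z" using bad s by (auto simp: Z_def z_def)
    moreover have bZ: "bdd_below Z" by (auto simp: Z_def)
    ultimately have "Inf Z \<in> Z" using closed_contains_Inf[of Z] by blast
    define r where "r = Inf Z"
    have r: "0 \<le> r" "(u r, v r) \<notin> D" using \<open>Inf Z \<in> Z\<close> unfolding r_def[symmetric] by (auto simp: Z_def z_def)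
    have before: "(u x, v x) \<in> D" if "0 \<le> x" "x < r" for x
    proof -
      have "x \<notin> Z" using that bZ cInf_lower[of x Z] by (auto simp: r_def)
      then show ?thesis using that by (auto simp: Z_def z_def)
    qed
    have r0: "0 < r" using r u0 p q by (cases "r = 0") (auto simp: D_def)
    have lim_le: "g r \<le> B" if g: "continuous_on {0..r} g" and le: "\<And>x. 0 \<le> x \<Longrightarrow> x < r \<Longrightarrow> g x \<le> B" for g :: "real \<Rightarrow> real" and B
    proof (rule ccontr)
      assume "\<not> g r \<le> B"
      then have "g 0 \<le> (g r + B) / 2" "(g r + B) / 2 \<le> g r" "B < (g r + B) / 2" using le[of 0] r0 by auto
      then obtain x where "0 \<le> x" "x \<le> r" "g x = (g r + B) / 2" using IVT'[of g 0 "(g r + B) / 2" r] g r0 by auto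
      then show False using le[of x] \<open>B < (g r + B) / 2\<close> \<open>\<not> g r \<le> B\<close> by (cases "x = r") auto
    qed
    have cur: "continuous_on {0..r} u" "continuous_on {0..r} v"
      using cu cv by (auto intro: continuous_on_subset)
    have ur: "u r \<le> 0" by (rule lim_le[OF cur(1)]) (use before in \<open>auto simp: D_def intro: less_imp_le\<close>)
    have box: "\<bar>u x\<bar> \<le> M \<and> \<bar>v x\<bar> \<le> M" if "x \<in> {0..r}" for x
    proof (cases "x = r")
      case True
      have "\<bar>u r\<bar> \<le> M"
        by (rule lim_le[where g = "\<lambda>x. \<bar>u x\<bar>"]) (use before D_bounds cur in \<open>auto intro!: continuous_intros less_imp_le\<close>)
      moreover have "\<bar>v r\<bar> \<le> M"
        by (rule lim_le[where g = "\<lambda>x. \<bar>v x\<bar>"]) (use before D_bounds cur in \<open>auto intro!: continuous_intros less_imp_le\<close>)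
      ultimately show ?thesis using True by simp
    next
      case False
      then show ?thesis using before[of x] D_bounds[of "u x" "v x"] that by auto
    qed
    note o = orb[OF box]
    show False
    proof (cases "u r < 0")
      case True
      have neg: "u x < 0" if "x \<in> {0..r}" for x using before[of x] True that by (cases "x = r") (auto simp: D_def)
      have cg: "continuous_on {0..r} (\<lambda>x. gm (u x) - v x)" "continuous_on {0..r} (\<lambda>x. v x - gp (u x))"
        by (intro continuous_intros cur continuous_on_compose2[OF cont_gm cur(1)] continuous_on_compose2[OF cont_gp cur(1)];
            use neg in force)+
      have "gm (u r) - v r \<le> 0" by (rule lim_le[OF cg(1)]) (use before in \<open>force simp: D_def\<close>)
      moreover have "v r - gp (u r) \<le> 0" by (rule lim_le[OF cg(2)]) (use before in \<open>force simp: D_def\<close>)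
      ultimately have eq: "v r = gp (u r) \<or> v r = gm (u r)" using r(2) True by (auto simp: D_def)
      have "- u r \<le> - U t1"
        by (rule lim_le[where g = "\<lambda>x. - u x"]) (use before D_bounds cur in \<open>auto intro!: continuous_intros less_imp_le\<close>)
      then have "U t1 \<le> u r" by simp
      from graphs_on_curve[OF this True eq] obtain c where c: "c \<in> J" "u r = U c" "v r = V c" by blast
      have "r \<in> {0..r}" "0 \<in> {0..r}" using r0 by auto
      from touching_orbit[OF o neg this(1) c this(2)] obtain c' where "c' \<in> J" "p = U c'" "q = V c'"
        using u0 by auto
      then show False using curve_on_graphs[of c'] q by auto
    next
      case False
      then have ur0: "u r = 0" using ur by simp
      have "v r + \<alpha> * u r \<le> 0"
        by (rule lim_le[where g = "\<lambda>x. v x + \<alpha> * u x"])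
          (use before D_bounds cur in \<open>force intro!: continuous_intros\<close>)+
      then have vr: "v r \<le> 0" using ur0 by simp
      have "v r = 0"
      proof (rule ccontr)
        assume "v r \<noteq> 0"
        have "r \<in> {0..r}" using r0 by simp
        from box[OF this] have "P (clip M (u r)) (clip M (v r)) = v r" using ur0 by (simp add: clip_id P_def)
        then have "DERIV u r :> v r" using uD[of r] r0 by (simp add: at_within_interior[of r "{0..}"])
        moreover have "v r < 0" using vr \<open>v r \<noteq> 0\<close> by simp
        ultimately obtain d where d: "d > 0" "\<And>h. 0 < h \<Longrightarrow> h < d \<Longrightarrow> u r < u (r - h)"
          using DERIV_neg_dec_left[of u "v r" r] by blast
        define h where "h = min (d / 2) r"
        have "0 < h" "h < d" "h \<le> r" using d r0 by (auto simp: h_def min_def)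
        then show False using d(2)[of h] before[of "r - h"] ur0 by (auto simp: D_def)
      qed
      have "orbit {0..r} (\<lambda>_. 0) (\<lambda>_. 0)" by (rule orbit_const) (simp_all add: P_def Q_def)
      from orbit_unique(1)[OF o this, of r 0] ur0 \<open>v r = 0\<close> u0 p r0 show False by simp
    qed
  qed
  have box: "\<bar>u s\<bar> < M \<and> \<bar>v s\<bar> < M" if "s \<ge> 0" for s using D_bounds[OF inD[OF that]] by simp
  show ?thesis
  proof (rule that[of u v, OF _ u0])
    show "good_orbit u v"
      unfolding good_orbit_def
    proof (intro conjI)
      show "orbit {0..} u v"
        unfolding orbit_def using uD vD box
        by (metis atLeast_iff clip_id less_imp_le mult_1)
      show "\<forall>s\<ge>0. u s < 0" using inD by (auto simp: D_def)
      show "\<exists>B. \<forall>s\<ge>0. \<bar>u s\<bar> \<le> B \<and> \<bar>v s\<bar> \<le> B" using box by (intro exI[of _ M]) (auto intro: less_imp_le)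
    qed
  qed
qed

lemma curve_orbit:
  assumes c: "c \<in> J"
  shows "good_orbit (\<lambda>s. U (s + c)) (\<lambda>s. V (s + c))"
  unfolding good_orbit_def
proof (intro conjI)
  have J: "s + c \<in> J" if "s \<ge> 0" for s using J_up[OF c] that by simp
  show "orbit {0..} (\<lambda>s. U (s + c)) (\<lambda>s. V (s + c))" by (rule orbit_shift[OF oJ]) (use J in auto)
  show "\<forall>s\<ge>0. U (s + c) < 0" using bounds J by blast
  show "\<exists>B. \<forall>s\<ge>0. \<bar>U (s + c)\<bar> \<le> B \<and> \<bar>V (s + c)\<bar> \<le> B"
  proof (intro exI[of _ "\<alpha> + 5/4 * \<alpha>\<^sup>2"] allI impI)
    fix s :: real assume "s \<ge> 0"
    note b = bounds[OF J[OF this]]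
    have "\<alpha> * - U (s + c) \<le> \<alpha> * (\<alpha> / 2)" using b alpha by (intro mult_left_mono) auto
    moreover have "\<alpha>\<^sup>2 \<ge> 0" by simp
    ultimately show "\<bar>U (s + c)\<bar> \<le> \<alpha> + 5/4 * \<alpha>\<^sup>2 \<and> \<bar>V (s + c)\<bar> \<le> \<alpha> + 5/4 * \<alpha>\<^sup>2"
      using b alpha unfolding abs_le_iff power2_eq_square by (intro conjI; linarith)
  qed
qed

lemma follows_curve:
  assumes g: "good_orbit u v" and c: "c \<in> J" "u 0 = U c" "v 0 = V c" and s: "s \<ge> 0"
  shows "u s = U (s + c)" "v s = V (s + c)"
proof -
  have "orbit {0..s} u v" using g by (auto simp: good_orbit_def intro: orbit_subset)
  from touching_orbit(2,3)[OF this _ _ c, of s] g s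
  show "u s = U (s + c)" "v s = V (s + c)" by (auto simp: good_orbit_def)
qed

lemma limit_iff_on_curve:
  assumes g: "good_orbit u v"
  shows "(u \<longlongrightarrow> 0) at_top \<longleftrightarrow> (\<exists>c\<in>J. u 0 = U c \<and> v 0 = V c)"
proof
  assume lim: "(u \<longlongrightarrow> 0) at_top"
  have "(v \<longlongrightarrow> 0) at_top" using good_orbit_limit(1)[OF g lim] by simp
  then obtain s c where s: "s \<ge> 0" "c \<in> J" "u s = U c" "v s = V c"
    using on_curve_of_limit[of 0 u v] g lim by (auto simp: good_orbit_def)
  have "orbit {0..s} u v" using g by (auto simp: good_orbit_def intro: orbit_subset)
  from touching_orbit[OF this _ _ s(2-4), of 0] g s(1)
  show "\<exists>c\<in>J. u 0 = U c \<and> v 0 = V c" by (auto simp: good_orbit_def)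
next
  assume "\<exists>c\<in>J. u 0 = U c \<and> v 0 = V c"
  then obtain c where c: "c \<in> J" "u 0 = U c" "v 0 = V c" by blast
  have "((\<lambda>s. U (s + c)) \<longlongrightarrow> 0) at_top"
    by (rule filterlim_compose[OF U0])
      (use filterlim_tendsto_add_at_top[OF tendsto_const[of c] filterlim_ident] in \<open>simp add: add.commute\<close>)
  then show "(u \<longlongrightarrow> 0) at_top"
  proof (rule Lim_transform_eventually)
    show "\<forall>\<^sub>F s in at_top. U (s + c) = u s"
      using eventually_ge_at_top[of 0] by eventually_elim (use follows_curve(1)[OF g c] in simp)
  qed
qed

text \<open>What matters is that u becomes integrable in s: as df/ds = u f, this keeps f away from
  0.\<close>

lemma exponential_decay:
  assumes g: "good_orbit u v" and lim: "(u \<longlongrightarrow> 0) at_top"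
  shows "\<exists>C. \<forall>s\<ge>0. \<bar>u s\<bar> \<le> C * exp (- \<alpha> * s)"
proof -
  obtain c where c: "c \<in> J" "u 0 = U c" "v 0 = V c" using limit_iff_on_curve[OF g] lim by blast
  obtain B where B: "\<And>s. s \<ge> 0 \<Longrightarrow> \<bar>u s\<bar> \<le> B" using g by (auto simp: good_orbit_def)
  have B0: "B \<ge> 0" using B[of 0] by linarith
  define C where "C = 2 * exp (- \<alpha> * c) + B * exp (\<alpha> * (S - c))"
  have "\<bar>u s\<bar> \<le> C * exp (- \<alpha> * s)" if s: "s \<ge> 0" for s
  proof (cases "s + c \<ge> S")
    case True
    have "\<bar>u s\<bar> \<le> 2 * exp (- \<alpha> * (s + c))" using decay[OF True] follows_curve(1)[OF g c s] by simp
    also have "\<dots> = 2 * exp (- \<alpha> * c) * exp (- \<alpha> * s)" by (simp add: algebra_simps flip: exp_add)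
    also have "\<dots> \<le> C * exp (- \<alpha> * s)" using B0 by (intro mult_right_mono) (auto simp: C_def)
    finally show ?thesis .
  next
    case False
    have "\<bar>u s\<bar> \<le> B * 1" using B[OF s] by simp
    also have "\<dots> \<le> B * (exp (\<alpha> * (S - c)) * exp (- \<alpha> * s))"
    proof (intro mult_left_mono B0)
      have "\<alpha> * (S - c) + - \<alpha> * s = \<alpha> * (S - c - s)" by (simp add: algebra_simps)
      also have "\<dots> \<ge> 0" using False alpha by (intro mult_nonneg_nonneg) auto
      finally show "1 \<le> exp (\<alpha> * (S - c)) * exp (- \<alpha> * s)" unfolding exp_add[symmetric] by simp
    qed
    also have "\<dots> \<le> C * exp (- \<alpha> * s)" by (simp add: C_def algebra_simps)
    finally show ?thesis .
  qed
  then show ?thesis by blast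
qed

end

context similarity_flow
begin

text \<open>The curve itself no longer appears in the statement. As \<open>gm\<close> and
  \<open>gp\<close> agree left of \<open>u\<^sub>1\<close>, the two equivalences together say that
  no good orbit starts there.\<close>

theorem phase_portrait:
  obtains u\<^sub>1 u\<^sub>2 :: real and gm gp :: "real \<Rightarrow> real" where
    "u\<^sub>1 < u\<^sub>2" "u\<^sub>2 < 0"
    "\<And>p. p < 0 \<Longrightarrow> gp p > 0"
    "\<And>p. p \<le> u\<^sub>1 \<Longrightarrow> gm p = gp p"
    "\<And>p. u\<^sub>1 < p \<Longrightarrow> p < 0 \<Longrightarrow> gm p < gp p"
    "\<And>p. u\<^sub>1 < p \<Longrightarrow> p < 0 \<Longrightarrow> gm p \<ge> 0 \<longleftrightarrow> p \<le> u\<^sub>2"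
    "\<And>p q. p < 0 \<Longrightarrow> (\<exists>u v. good_orbit u v \<and> u 0 = p \<and> v 0 = q \<and> (u \<longlongrightarrow> 0) at_top) \<longleftrightarrow>
       u\<^sub>1 \<le> p \<and> (q = gm p \<or> q = gp p)"
    "\<And>p q. p < 0 \<Longrightarrow> (\<exists>u v. good_orbit u v \<and> u 0 = p \<and> v 0 = q \<and> \<not> (u \<longlongrightarrow> 0) at_top) \<longleftrightarrow>
       gm p < q \<and> q < gp p"
    "\<And>u v. good_orbit u v \<Longrightarrow> (u \<longlongrightarrow> 0) at_top \<Longrightarrow> \<exists>C. \<forall>s\<ge>0. \<bar>u s\<bar> \<le> C * exp (- \<alpha> * s)"
proof -
  obtain U V J S where "stable_curve \<alpha> m U V J S"
  proof (rule global_stable_orbit)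
    fix U V :: "real \<Rightarrow> real" and J S
    assume *: "J = UNIV \<or> (\<exists>\<sigma>. J = {\<sigma><..} \<and> U \<sigma> = 0)" "{S..} \<subseteq> J" "continuous_on UNIV U" "continuous_on UNIV V"
      "orbit J U V"
      "\<And>s. s \<in> J \<Longrightarrow> - \<alpha> / 2 < U s \<and> U s < 0 \<and> - 5/4 * \<alpha>\<^sup>2 < V s \<and> V s < - \<alpha> * U s"
      "\<And>s. s \<ge> S \<Longrightarrow> - 1/6 < U s \<and> V s > 0 \<and> P (U s) (V s) > 0 \<and> G (U s) (V s) > 0"
      "\<And>s. s \<ge> S \<Longrightarrow> \<bar>U s\<bar> \<le> 2 * exp (- \<alpha> * s)"
      "(U \<longlongrightarrow> 0) at_top" "(V \<longlongrightarrow> 0) at_top"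
    have "stable_curve \<alpha> m U V J S"
      by (unfold_locales) (fact *)+
    then show thesis by (rule that)
  qed
  then interpret C: stable_curve \<alpha> m U V J S .
  have on: "(\<exists>c\<in>J. p = U c \<and> q = V c) \<longleftrightarrow> U C.t1 \<le> p \<and> (q = C.gm p \<or> q = C.gp p)" if p: "p < 0" for p q
    using C.graphs_on_curve[OF _ p, of q] C.curve_on_graphs C.U_ge by metis
  show ?thesis
  proof (rule that[of "U C.t1" "U C.t2" C.gp C.gm])
    show "U C.t1 < U C.t2" using C.U_dec[OF C.t2(1,2)] by simp
    show "U C.t2 < 0" using C.bounds[OF C.t2(1)] by simp
    show "C.gp p > 0" if "p < 0" for p
    proof -
      have "p\<^sup>2 > 0" using that by simp
      then show ?thesis using C.g_le[OF that] by linarith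
    qed
    show "C.gm p = C.gp p" if "p \<le> U C.t1" for p using C.g_left[OF that] by simp
    show "C.gm p < C.gp p" if "U C.t1 < p" "p < 0" for p using C.g_order[OF that] by linarith
    show "C.gm p \<ge> 0 \<longleftrightarrow> p \<le> U C.t2" if "U C.t1 < p" "p < 0" for p by (rule C.gm_sign[OF that])
    show "(\<exists>u v. good_orbit u v \<and> u 0 = p \<and> v 0 = q \<and> (u \<longlongrightarrow> 0) at_top) \<longleftrightarrow>
       U C.t1 \<le> p \<and> (q = C.gm p \<or> q = C.gp p)" if p: "p < 0" for p q
      unfolding on[OF p, symmetric]
    proof
      assume "\<exists>u v. good_orbit u v \<and> u 0 = p \<and> v 0 = q \<and> (u \<longlongrightarrow> 0) at_top"
      then show "\<exists>c\<in>J. p = U c \<and> q = V c" using C.limit_iff_on_curve by blast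
    next
      assume "\<exists>c\<in>J. p = U c \<and> q = V c"
      then obtain c where c: "c \<in> J" "p = U c" "q = V c" by blast
      note g = C.curve_orbit[OF c(1)]
      have "((\<lambda>s. U (s + c)) \<longlongrightarrow> 0) at_top" using C.limit_iff_on_curve[OF g] c(1) by auto
      then show "\<exists>u v. good_orbit u v \<and> u 0 = p \<and> v 0 = q \<and> (u \<longlongrightarrow> 0) at_top"
        using g c by (intro exI[of _ "\<lambda>s. U (s + c)"] exI[of _ "\<lambda>s. V (s + c)"]) auto
    qed
    show "(\<exists>u v. good_orbit u v \<and> u 0 = p \<and> v 0 = q \<and> \<not> (u \<longlongrightarrow> 0) at_top) \<longleftrightarrow>
       C.gm p < q \<and> q < C.gp p" if p: "p < 0" for p q
    proof
      assume "\<exists>u v. good_orbit u v \<and> u 0 = p \<and> v 0 = q \<and> \<not> (u \<longlongrightarrow> 0) at_top"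
      then show "C.gm p < q \<and> q < C.gp p" using C.limit_iff_on_curve C.good_orbit_classification by metis
    next
      assume q: "C.gm p < q \<and> q < C.gp p"
      then obtain u v where g: "good_orbit u v" "u 0 = p" "v 0 = q" using C.trapped_orbit[OF p] by blast
      moreover have "\<not> (u \<longlongrightarrow> 0) at_top"
        unfolding C.limit_iff_on_curve[OF g(1)] g(2,3) on[OF p] using q by auto
      ultimately show "\<exists>u v. good_orbit u v \<and> u 0 = p \<and> v 0 = q \<and> \<not> (u \<longlongrightarrow> 0) at_top" by blast
    qed
    show "\<exists>C. \<forall>s\<ge>0. \<bar>u s\<bar> \<le> C * exp (- \<alpha> * s)" if "good_orbit u v" "(u \<longlongrightarrow> 0) at_top" for u v
      by (rule C.exponential_decay[OF that])
  qed
qed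

end

section \<open>Solutions of the boundary value problem\<close>

lemma hderiv_eqI:
  assumes "(f has_real_derivative D) (at t within {0..})" "t \<ge> 0" shows "hderiv f t = D"
proof -
  have "at t within {t..t+1} \<noteq> bot" by (simp add: trivial_limit_within islimpt_Icc)
  moreover have "at t within {t..t+1} \<le> at t within {0..}" using assms(2) by (intro at_le) auto
  ultimately have "at t within {0..} \<noteq> bot" by (metis le_bot)
  then show ?thesis
    unfolding hderiv_def using assms(1)
    by (intro vector_derivative_within) (auto simp: has_real_derivative_iff_has_vector_derivative)
qed

lemma has_real_derivative_hderiv:
  assumes "f differentiable_on {0..}" "t \<ge> 0"
  shows "(f has_real_derivative hderiv f t) (at t within {0..})"
  using assms unfolding hderiv_def has_real_derivative_iff_has_vector_derivative differentiable_on_def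
  by (simp add: vector_derivative_works[symmetric])

lemma solutionD:
  assumes "solution m a f"
  shows "f \<in> extensional {0..}" "f 0 = a" "hderiv f 0 = - 1" "(hderiv f \<longlongrightarrow> 0) at_top"
    "\<And>t. t \<ge> 0 \<Longrightarrow> (f has_real_derivative hderiv f t) (at t within {0..})"
    "\<And>t. t \<ge> 0 \<Longrightarrow> (hderiv f has_real_derivative (hderiv ^^ 2) f t) (at t within {0..})"
    "\<And>t. t \<ge> 0 \<Longrightarrow> ((hderiv ^^ 2) f has_real_derivative
       m * (hderiv f t)\<^sup>2 - (m + 1) / 2 * f t * (hderiv ^^ 2) f t) (at t within {0..})"
proof -
  have d: "(hderiv ^^ k) f differentiable_on {0..}" if "k < 3" for k
    using assms that by (simp add: solution_def)
  show "f \<in> extensional {0..}" "f 0 = a" "hderiv f 0 = - 1" "(hderiv f \<longlongrightarrow> 0) at_top"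
    using assms by (simp_all add: solution_def)
  fix t :: real assume t: "t \<ge> 0"
  show "(f has_real_derivative hderiv f t) (at t within {0..})"
    using has_real_derivative_hderiv[OF d[of 0] t] by simp
  show "(hderiv f has_real_derivative (hderiv ^^ 2) f t) (at t within {0..})"
    using has_real_derivative_hderiv[OF d[of 1] t] by (simp add: numeral_2_eq_2)
  have "((hderiv ^^ 2) f has_real_derivative (hderiv ^^ 3) f t) (at t within {0..})"
    using has_real_derivative_hderiv[OF d[of 2] t] by (simp add: numeral_2_eq_2 numeral_3_eq_3)
  moreover have "(hderiv ^^ 3) f t + (m + 1) / 2 * f t * (hderiv ^^ 2) f t - m * (hderiv f t)\<^sup>2 = 0"
    using assms t by (simp add: solution_def)
  then have "(hderiv ^^ 3) f t = m * (hderiv f t)\<^sup>2 - (m + 1) / 2 * f t * (hderiv ^^ 2) f t" by linarith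
  ultimately show "((hderiv ^^ 2) f has_real_derivative
       m * (hderiv f t)\<^sup>2 - (m + 1) / 2 * f t * (hderiv ^^ 2) f t) (at t within {0..})" by simp
qed

lemma solutionI:
  fixes g g1 g2 :: "real \<Rightarrow> real"
  assumes g: "\<And>t. t \<ge> 0 \<Longrightarrow> (g has_real_derivative g1 t) (at t within {0..})"
    "\<And>t. t \<ge> 0 \<Longrightarrow> (g1 has_real_derivative g2 t) (at t within {0..})"
    "\<And>t. t \<ge> 0 \<Longrightarrow> (g2 has_real_derivative m * (g1 t)\<^sup>2 - (m + 1) / 2 * g t * g2 t) (at t within {0..})"
    and bc: "g 0 = a" "g1 0 = - 1" "(g1 \<longlongrightarrow> 0) at_top"
  shows "solution m a (restrict g {0..})" "(hderiv ^^ 2) (restrict g {0..}) 0 = g2 0"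
proof -
  define f where "f = restrict g {0..}"
  define g3 where "g3 t = m * (g1 t)\<^sup>2 - (m + 1) / 2 * g t * g2 t" for t
  have tr: "(h has_real_derivative D) (at t within {0..})"
    if "(h' has_real_derivative D) (at t within {0..})" "t \<ge> 0" "\<And>t. t \<ge> 0 \<Longrightarrow> h t = h' t" for h h' :: "real \<Rightarrow> real" and D t
    using that unfolding has_real_derivative_iff_has_vector_derivative
    by (auto intro: has_vector_derivative_transform)
  have f0: "f t = g t" if "t \<ge> 0" for t using that by (simp add: f_def)
  have D0: "(f has_real_derivative g1 t) (at t within {0..})" if "t \<ge> 0" for t
    using tr[OF g(1)[OF that] that f0] .
  have f1: "hderiv f t = g1 t" if "t \<ge> 0" for t using hderiv_eqI[OF D0[OF that] that] .
  have D1: "(hderiv f has_real_derivative g2 t) (at t within {0..})" if "t \<ge> 0" for t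
    using tr[OF g(2)[OF that] that f1] .
  have f2: "(hderiv ^^ 2) f t = g2 t" if "t \<ge> 0" for t
    using hderiv_eqI[OF D1[OF that] that] by (simp add: numeral_2_eq_2)
  have D2: "((hderiv ^^ 2) f has_real_derivative g3 t) (at t within {0..})" if "t \<ge> 0" for t
    unfolding g3_def using tr[OF g(3)[OF that] that f2] .
  have f3: "(hderiv ^^ 3) f t = g3 t" if "t \<ge> 0" for t
    using hderiv_eqI[OF D2[OF that] that] by (simp add: numeral_2_eq_2 numeral_3_eq_3)
  have diff: "(hderiv ^^ k) f differentiable_on {0..}" if "k < 3" for k
  proof -
    have "\<exists>D. ((hderiv ^^ k) f has_real_derivative D) (at t within {0..})" if "t \<ge> 0" for t
    proof -
      consider "k = 0" | "k = 1" | "k = 2" using \<open>k < 3\<close> by linarith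
      then show ?thesis using D0[OF that] D1[OF that] D2[OF that] by cases auto
    qed
    then show ?thesis unfolding differentiable_on_def
      by (meson atLeast_iff differentiableI has_field_derivative_def)
  qed
  have "(hderiv f \<longlongrightarrow> 0) at_top"
    using bc(3)
  proof (rule Lim_transform_eventually)
    show "\<forall>\<^sub>F t in at_top. g1 t = hderiv f t"
      using eventually_ge_at_top[of 0] by eventually_elim (simp add: f1)
  qed
  then show "solution m a (restrict g {0..})"
    unfolding solution_def f_def[symmetric]
  proof (intro conjI allI impI)
    show "f \<in> extensional {0..}" by (simp add: f_def)
    show "(hderiv ^^ 3) f t + (m + 1) / 2 * f t * (hderiv ^^ 2) f t - m * (hderiv f t)\<^sup>2 = 0" if "t \<ge> 0" for t
      by (simp add: f0[OF that] f1[OF that] f2[OF that] f3[OF that] g3_def)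
    show "f 0 = a" "hderiv f 0 = - 1" using f0[of 0] f1[of 0] bc by simp_all
  qed (use diff in auto)
  show "(hderiv ^^ 2) (restrict g {0..}) 0 = g2 0" using f2[of 0] by (simp add: f_def)
qed

locale similarity_solution = similarity_flow +
  fixes a :: real and f :: "real \<Rightarrow> real"
  assumes a: "a > 0" and sol: "solution m a f"
begin

definition "f1 = hderiv f"
definition "f2 = (hderiv ^^ 2) f"

lemma alpha_m: "(m + 1) / 2 = \<alpha>" using m by simp

lemma D:
  assumes "t \<ge> 0"
  shows "(f has_real_derivative f1 t) (at t within {0..})"
    "(f1 has_real_derivative f2 t) (at t within {0..})"
    "(f2 has_real_derivative m * (f1 t)\<^sup>2 - \<alpha> * f t * f2 t) (at t within {0..})"
  using solutionD(5-7)[OF sol assms] by (simp_all add: f1_def f2_def alpha_m)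

lemma init: "f 0 = a" "f1 0 = - 1" and f1_lim: "(f1 \<longlongrightarrow> 0) at_top"
  using solutionD(2-4)[OF sol] by (simp_all add: f1_def)

lemma DI:
  assumes "t > 0"
  shows "DERIV f t :> f1 t" "DERIV f1 t :> f2 t" "DERIV f2 t :> m * (f1 t)\<^sup>2 - \<alpha> * f t * f2 t"
  using D[of t] assms by (simp_all add: at_within_interior[of t "{0..}"])

lemma cont: "continuous_on {0..} f" "continuous_on {0..} f1" "continuous_on {0..} f2"
  using D by (auto intro!: DERIV_continuous_on)

lemma cont': "x \<ge> 0 \<Longrightarrow> continuous_on {x..y} f" "x \<ge> 0 \<Longrightarrow> continuous_on {x..y} f1" "x \<ge> 0 \<Longrightarrow> continuous_on {x..y} f2"
  using cont by (auto intro: continuous_on_subset)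

section \<open>Sign, positivity and growth of an arbitrary solution\<close>

lemma f2_forward: "0 \<le> x \<Longrightarrow> x \<le> y \<Longrightarrow> f2 x * exp (integral {x..y} (\<lambda>t. - \<alpha> * f t)) \<le> f2 y"
proof (rule linear_growth)
  fix s assume s: "0 \<le> x" "x < s" "s < y"
  show "\<exists>d. DERIV f2 s :> d \<and> d \<ge> - \<alpha> * f s * f2 s"
    by (rule exI, rule conjI, rule DI(3)) (use s m_gt in auto)
qed (auto intro!: continuous_intros cont')

lemma f2_pos_forward: "0 \<le> x \<Longrightarrow> x \<le> y \<Longrightarrow> f2 x > 0 \<Longrightarrow> f2 y > 0"
  using f2_forward[of x y] by (meson exp_gt_zero mult_pos_pos order_less_le_trans)

lemma f2_nonneg_forward: "0 \<le> x \<Longrightarrow> x \<le> y \<Longrightarrow> f2 x \<ge> 0 \<Longrightarrow> f2 y \<ge> 0"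
  using f2_forward[of x y] by (meson exp_ge_zero mult_nonneg_nonneg order_trans)

lemma f1_less:
  assumes "0 \<le> x" "x < y" "\<And>s. x < s \<Longrightarrow> s < y \<Longrightarrow> f2 s > 0" shows "f1 x < f1 y"
  by (rule DERIV_pos_less[OF assms(2) cont'(2)[OF assms(1)], of f2]) (use DI(2) assms in auto)

lemma f1_antimono:
  assumes "0 \<le> x" "x \<le> y" "\<And>s. x < s \<Longrightarrow> s < y \<Longrightarrow> f2 s \<le> 0" shows "f1 y \<le> f1 x"
  by (rule DERIV_nonpos_le[OF assms(2) cont'(2)[OF assms(1)], of f2]) (use DI(2) assms in auto)

lemma f1_neg_of_f2_pos:
  assumes "t \<ge> 0" "f2 t > 0" shows "f1 t < 0"
proof -
  have pos: "f2 s > 0" if "s \<ge> t" for s using f2_pos_forward[of t s] assms that by simp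
  have less: "f1 x < f1 y" if "t \<le> x" "x < y" for x y
    by (rule f1_less) (use that assms pos in auto)
  have "f1 (t + 1) \<le> 0"
    using f1_lim
  proof (rule tendsto_lowerbound)
    show "\<forall>\<^sub>F x in at_top. f1 (t + 1) \<le> f1 x"
      using eventually_gt_at_top[of "t + 1"] by eventually_elim (use less in \<open>force intro: less_imp_le\<close>)
  qed simp
  then show ?thesis using less[of t "t + 1"] by simp
qed

lemma f1_neg: "t \<ge> 0 \<Longrightarrow> f1 t < 0"
proof (cases "f2 t > 0")
  case True
  then show "t \<ge> 0 \<Longrightarrow> f1 t < 0" using f1_neg_of_f2_pos by simp
next
  case False
  assume t: "t \<ge> 0"
  have "f1 t \<le> f1 0"
  proof (rule f1_antimono)
    fix s assume "0 < s" "s < t"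
    then show "f2 s \<le> 0" using f2_pos_forward[of s t] False by (force simp: not_less[symmetric])
  qed (use t in auto)
  then show "f1 t < 0" using init by simp
qed

lemma f2_eventually_pos: "\<exists>t\<ge>0. f2 t > 0"
proof (rule ccontr)
  assume "\<not> ?thesis"
  then have le: "f2 t \<le> 0" if "t \<ge> 0" for t using that by force
  have "f1 t \<le> - 1" if "t \<ge> 0" for t
    using f1_antimono[of 0 t] le that init by simp
  then have "\<forall>\<^sub>F t in at_top. f1 t \<le> - 1" unfolding eventually_at_top_linorder by blast
  from tendsto_upperbound[OF f1_lim this] have "0 \<le> (- 1 :: real)" by simp
  then show False by simp
qed

text \<open>A lower bound c > 0 on f'' lifts f' to 0 at the latest at time x - f' x / c, against f'
  < 0.\<close>

lemma f1_unbounded: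
  assumes "x \<ge> 0" "c > 0" "\<And>t. t \<ge> x \<Longrightarrow> f2 t \<ge> c" shows False
proof -
  define y where "y = x + (- f1 x) / c"
  have "(- f1 x) / c > 0" using f1_neg[OF assms(1)] assms(2) by (intro divide_pos_pos) auto
  then have xy: "x < y" by (simp add: y_def)
  have "f1 x - c * x \<le> f1 y - c * y"
  proof (rule DERIV_nonneg_le[where g = "\<lambda>t. f1 t - c * t" and g' = "\<lambda>t. f2 t - c"])
    show "continuous_on {x..y} (\<lambda>t. f1 t - c * t)" using assms(1) by (intro continuous_intros cont')
    show "DERIV (\<lambda>t. f1 t - c * t) s :> f2 s - c \<and> f2 s - c \<ge> 0" if "x < s" "s < y" for s
      using DI(2)[of s] assms that by (auto intro!: derivative_eq_intros)
  qed (use xy in auto)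
  moreover have "c * y = c * x - f1 x" using assms(2) by (simp add: y_def right_diff_distrib)
  ultimately have "f1 y \<ge> 0" by linarith
  then show False using f1_neg[of y] assms xy by simp
qed

lemma f_decreasing: "0 \<le> x \<Longrightarrow> x < y \<Longrightarrow> f y < f x"
  by (rule DERIV_neg_less[where g = f and g' = f1]) (use DI(1) f1_neg cont' in auto)

text \<open>Where f \<le> 0 and f'' > 0 the equation gives f''' \<ge> 0, so f'' would stay above a
  positive constant.\<close>

lemma f_pos: "t \<ge> 0 \<Longrightarrow> f t > 0"
proof (rule ccontr)
  assume t: "t \<ge> 0" "\<not> f t > 0"
  obtain t' where t': "t' \<ge> 0" "f2 t' > 0" using f2_eventually_pos by blast
  define x where "x = max t t'"
  have x: "x \<ge> 0" "f2 x > 0" using f2_pos_forward[OF t'(1) _ t'(2), of x] t t' by (auto simp: x_def)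
  have fneg: "f s \<le> 0" if "s \<ge> x" for s
    using f_decreasing[OF t(1), of s] t that by (cases "s = t") (auto simp: x_def)
  have "f2 x \<le> f2 y" if "y \<ge> x" for y
  proof (rule DERIV_nonneg_imp_increasing_open[OF that])
    fix s assume s: "x < s" "s < y"
    have "f2 s > 0" using f2_pos_forward[OF x(1) _ x(2), of s] s by simp
    then have "\<alpha> * f s * f2 s \<le> 0" using fneg[of s] s alpha by (simp add: mult_nonneg_nonpos mult_nonpos_nonneg)
    moreover have "m * (f1 s)\<^sup>2 \<ge> 0" using m_gt by simp
    ultimately have "m * (f1 s)\<^sup>2 - \<alpha> * f s * f2 s \<ge> 0" by linarith
    then show "\<exists>y. DERIV f2 s :> y \<and> y \<ge> 0" using DI(3)[of s] s x by fastforce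
  qed (use cont' x in auto)
  then show False using f1_unbounded[OF x] by blast
qed

lemma decreasing_positive_sol: "decreasing_positive f"
  unfolding decreasing_positive_def using f_pos f_decreasing by (auto intro!: monotone_onI)

lemma limit_exists: "positive_limit f \<or> zero_limit f"
proof -
  obtain l where "(f \<longlongrightarrow> l) at_top" "0 \<le> l"
    by (rule antimono_bounded_limit[of 0 f 0])
      (use f_pos f_decreasing in \<open>auto simp: le_less\<close>)
  then show ?thesis by (auto simp: positive_limit_def zero_limit_def le_less)
qed

lemma not_both: "\<not> (positive_limit f \<and> zero_limit f)"
  unfolding positive_limit_def zero_limit_def
  using tendsto_unique[OF trivial_limit_at_top_linorder] by (metis less_irrefl)

text \<open>The equation can be written (f'' + \<alpha> f f')' = (m + \<alpha>) f'^2. If this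
  nondecreasing quantity became positive, f f' < 0 would keep f'' above a positive constant.\<close>

lemma K_nonpos: "t \<ge> 0 \<Longrightarrow> f2 t + \<alpha> * f t * f1 t \<le> 0"
  and K_mono: "0 \<le> x \<Longrightarrow> x \<le> y \<Longrightarrow> f2 x + \<alpha> * f x * f1 x \<le> f2 y + \<alpha> * f y * f1 y"
proof -
  show mono: "f2 x + \<alpha> * f x * f1 x \<le> f2 y + \<alpha> * f y * f1 y" if "0 \<le> x" "x \<le> y" for x y
  proof (rule DERIV_nonneg_imp_increasing_open[OF that(2)])
    fix s assume s: "x < s" "s < y"
    have "DERIV (\<lambda>t. f2 t + \<alpha> * f t * f1 t) s :> (m + \<alpha>) * (f1 s)\<^sup>2"
      using DI[of s] s that by (auto intro!: derivative_eq_intros simp: power2_eq_square algebra_simps)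
    moreover have "(m + \<alpha>) * (f1 s)\<^sup>2 \<ge> 0" using m_gt alpha by simp
    ultimately show "\<exists>d. DERIV (\<lambda>t. f2 t + \<alpha> * f t * f1 t) s :> d \<and> d \<ge> 0" by blast
  qed (use that in \<open>auto intro!: continuous_intros cont'\<close>)
  show "f2 t + \<alpha> * f t * f1 t \<le> 0" if t: "t \<ge> 0"
  proof (rule ccontr)
    assume pos: "\<not> f2 t + \<alpha> * f t * f1 t \<le> 0"
    have "f2 s \<ge> f2 t + \<alpha> * f t * f1 t" if "s \<ge> t" for s
    proof -
      have "\<alpha> * f s * f1 s \<le> 0"
        using f_pos[of s] f1_neg[of s] alpha that t by (simp add: mult_nonneg_nonpos)
      then show ?thesis using mono[OF t that] by linarith
    qed
    from f1_unbounded[OF t _ this] show False using pos by simp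
  qed
qed

text \<open>By the previous bound f' + (\<alpha>/2) f^2 is nonincreasing, and it dominates f', which
  tends to 0. In the plane this says u \<ge> - \<alpha>/2.\<close>

lemma f1_lower: "t \<ge> 0 \<Longrightarrow> f1 t \<ge> - (\<alpha> / 2) * (f t)\<^sup>2"
proof -
  assume t: "t \<ge> 0"
  define L where "L t = f1 t + \<alpha> / 2 * (f t)\<^sup>2" for t
  have anti: "L y \<le> L x" if "0 \<le> x" "x \<le> y" for x y
  proof (rule DERIV_nonpos_imp_decreasing_open[OF that(2)])
    fix s assume s: "x < s" "s < y"
    have "DERIV L s :> f2 s + \<alpha> * f s * f1 s"
      unfolding L_def using DI[of s] s that by (auto intro!: derivative_eq_intros simp: power2_eq_square algebra_simps)
    then show "\<exists>d. DERIV L s :> d \<and> d \<le> 0" using K_nonpos[of s] s that by auto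
  qed (use that in \<open>auto intro!: continuous_intros cont' simp: L_def\<close>)
  have "0 \<le> L t"
  proof (rule tendsto_upperbound[OF f1_lim])
    show "\<forall>\<^sub>F s in at_top. f1 s \<le> L t"
      using eventually_ge_at_top[of t]
    proof eventually_elim
      case (elim s)
      have "f1 s \<le> L s" using alpha by (simp add: L_def)
      then show ?case using anti[OF t elim] by linarith
    qed
  qed simp
  then show "f1 t \<ge> - (\<alpha> / 2) * (f t)\<^sup>2" by (simp add: L_def)
qed

text \<open>This makes the new time s unbounded. The bound on f' gives f \<ge> a exp (- (\<alpha>/2)
  I) with I the integral of f, so a bounded I would keep f above a positive constant.\<close>

lemma integral_unbounded: "\<exists>t\<ge>0. integral {0..t} f \<ge> K"
proof (rule ccontr)
  assume neg: "\<not> ?thesis"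
  have lt: "integral {0..t} f < K" if "t \<ge> 0" for t using neg that by force
  define c where "c = a * exp (- (\<alpha> / 2) * K)"
  have c: "c > 0" using a by (simp add: c_def)
  have "c \<le> f t" if t: "t \<ge> 0" for t
  proof -
    have "f 0 * exp (integral {0..t} (\<lambda>s. - (\<alpha> / 2) * f s)) \<le> f t"
    proof (rule linear_growth[OF t])
      fix s assume s: "0 < s" "s < t"
      show "\<exists>d. DERIV f s :> d \<and> d \<ge> - (\<alpha> / 2) * f s * f s"
        using DI(1)[OF s(1)] f1_lower[of s] s by (auto simp: power2_eq_square)
    qed (auto intro!: continuous_intros cont')
    moreover have "integral {0..t} (\<lambda>s. - (\<alpha> / 2) * f s) = - (\<alpha> / 2) * integral {0..t} f" by simp
    moreover have "- (\<alpha> / 2) * K \<le> - (\<alpha> / 2) * integral {0..t} f"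
      using lt[OF t] alpha by (intro mult_left_mono_neg) auto
    then have "c \<le> f 0 * exp (- (\<alpha> / 2) * integral {0..t} f)"
      unfolding c_def init using a by (intro mult_left_mono) auto
    ultimately show ?thesis by simp
  qed
  moreover define t where "t = max 0 (K / c)"
  have t: "t \<ge> 0" "c * t \<ge> K" using c by (auto simp: t_def max_def field_simps)
  ultimately have "integral {0..t} (\<lambda>_. c) \<le> integral {0..t} f"
    by (intro integral_le integrable_continuous_real cont') auto
  then show False using lt[OF t(1)] t by (simp add: mult.commute)
qed

lemma orbit_of_solution:
  obtains u v where "good_orbit u v" "u 0 = - 1 / a\<^sup>2" "v 0 = f2 0 / a^3"
    "positive_limit f \<Longrightarrow> (u \<longlongrightarrow> 0) at_top"
proof -
  obtain T where T0: "T 0 = 0" and Tnn: "\<And>s. s \<ge> 0 \<Longrightarrow> T s \<ge> 0"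
    and TD: "\<And>s. s \<ge> 0 \<Longrightarrow> (T has_real_derivative 1 / f (T s)) (at s within {0..})"
    and Tlim: "filterlim T at_top at_top"
  proof (rule time_change[OF cont(1) f_pos integral_unbounded])
    fix T assume *: "T 0 = 0" "\<And>s. s \<ge> 0 \<Longrightarrow> T s \<ge> 0"
      "\<And>s. s \<ge> 0 \<Longrightarrow> (T has_real_derivative 1 / f (T s)) (at s within {0..})"
      "filterlim T at_top at_top"
    show thesis by (rule that[OF *])
  qed
  define u where "u s = f1 (T s) / (f (T s))\<^sup>2" for s
  define v where "v s = f2 (T s) / (f (T s))^3" for s
  have TD': "((\<lambda>s. h (T s)) has_real_derivative h' (T s) * (1 / f (T s))) (at s within {0..})"
    if "\<And>t. t \<ge> 0 \<Longrightarrow> (h has_real_derivative h' t) (at t within {0..})" "s \<ge> 0" for h h' s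
  proof -
    have "(h has_real_derivative h' (T s)) (at (T s) within T ` {0..})"
      using that(1)[OF Tnn[OF that(2)]] Tnn by (auto intro: DERIV_subset)
    from DERIV_image_chain[OF this TD[OF that(2)]] show ?thesis by (simp add: o_def)
  qed
  have fT: "f (T s) > 0" if "s \<ge> 0" for s using f_pos[OF Tnn[OF that]] .
  have orb: "orbit {0..} u v"
    unfolding orbit_def
  proof (intro ballI conjI)
    fix s :: real assume "s \<in> {0..}"
    then have s: "s \<ge> 0" by simp
    note d = TD'[OF D(1) s] TD'[OF D(2) s] TD'[OF D(3) s]
    show "(u has_real_derivative P (u s) (v s)) (at s within {0..})"
      unfolding u_def[abs_def] v_def[abs_def] P_def
      by (rule derivative_eq_intros d refl | use fT[OF s] in \<open>simp; fail\<close>)+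
        (use fT[OF s] in \<open>simp add: field_simps power2_eq_square power3_eq_cube\<close>)
    show "(v has_real_derivative Q (u s) (v s)) (at s within {0..})"
      unfolding u_def[abs_def] v_def[abs_def] Q_def
      by (rule derivative_eq_intros d refl | use fT[OF s] in \<open>simp; fail\<close>)+
        (use fT[OF s] in \<open>simp add: field_simps power2_eq_square power3_eq_cube\<close>)
  qed
  have neg: "u s < 0" if "s \<ge> 0" for s
    using f1_neg[OF Tnn[OF that]] fT[OF that] by (simp add: u_def divide_neg_pos)
  have ulow: "u s \<ge> - \<alpha> / 2" if "s \<ge> 0" for s
    using f1_lower[OF Tnn[OF that]] fT[OF that] by (simp add: u_def pos_le_divide_eq)
  have vup: "v s \<le> - \<alpha> * u s" if "s \<ge> 0" for s
    using K_nonpos[OF Tnn[OF that]] fT[OF that]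
    by (simp add: u_def v_def pos_divide_le_eq field_simps power2_eq_square power3_eq_cube)
  \<comment> \<open>f'' can be negative only up to some finite t; there compactness bounds v, and
    afterwards v > 0.\<close>
  obtain B where B: "\<And>s. s \<ge> 0 \<Longrightarrow> v s \<ge> - B"
  proof -
    obtain t where t: "t \<ge> 0" "f2 t > 0" using f2_eventually_pos by blast
    have "compact ((\<lambda>x. f2 x / (f x)^3) ` {0..t})"
      by (intro compact_continuous_image continuous_intros cont') (use f_pos in \<open>auto simp: less_le\<close>)
    then obtain B where B: "\<And>x. x \<in> {0..t} \<Longrightarrow> \<bar>f2 x / (f x)^3\<bar> \<le> B"
      using compact_imp_bounded bounded_iff by (metis (no_types, lifting) imageI real_norm_def)
    have "v s \<ge> - B" if s: "s \<ge> 0" for s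
    proof (cases "T s \<le> t")
      case True
      then have "\<bar>f2 (T s) / (f (T s))^3\<bar> \<le> B" by (intro B) (use Tnn[OF s] in simp)
      then show ?thesis unfolding v_def by linarith
    next
      case False
      then have "f2 (T s) > 0" using f2_pos_forward[OF t(1) _ t(2)] by simp
      then have "v s > 0" using fT[OF s] by (simp add: v_def)
      moreover have "\<bar>f2 0 / (f 0)^3\<bar> \<le> B" by (rule B) (use t(1) in simp)
      then have "B \<ge> 0" by (rule order_trans[OF abs_ge_zero])
      ultimately show ?thesis by simp
    qed
    then show ?thesis by (rule that)
  qed
  have "\<bar>u s\<bar> \<le> \<alpha> + \<alpha>\<^sup>2 + \<bar>B\<bar> \<and> \<bar>v s\<bar> \<le> \<alpha> + \<alpha>\<^sup>2 + \<bar>B\<bar>" if s: "s \<ge> 0" for s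
  proof -
    have "\<alpha> * - u s \<le> \<alpha> * (\<alpha> / 2)" using ulow[OF s] alpha by (intro mult_left_mono) auto
    then have "v s \<le> \<alpha>\<^sup>2" using vup[OF s] alpha zero_le_power2[of \<alpha>] unfolding power2_eq_square by linarith
    moreover have "\<alpha>\<^sup>2 \<ge> 0" by simp
    ultimately show ?thesis using neg[OF s] ulow[OF s] B[OF s] alpha unfolding abs_le_iff by linarith
  qed
  then have good: "good_orbit u v" using orb neg unfolding good_orbit_def by blast
  show ?thesis
  proof (rule that[OF good])
    show "u 0 = - 1 / a\<^sup>2" "v 0 = f2 0 / a^3" by (simp_all add: u_def v_def T0 init)
    assume "positive_limit f"
    then obtain l where l: "l > 0" "(f \<longlongrightarrow> l) at_top" by (auto simp: positive_limit_def)
    have "((\<lambda>t. f1 t / (f t)\<^sup>2) \<longlongrightarrow> 0 / l\<^sup>2) at_top" using l by (intro tendsto_intros f1_lim) auto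
    then have "((\<lambda>t. f1 t / (f t)\<^sup>2) \<longlongrightarrow> 0) at_top" by simp
    from filterlim_compose[OF this Tlim] show "(u \<longlongrightarrow> 0) at_top" by (simp add: u_def[abs_def])
  qed
qed

lemma convex_iff: "convex_on {0..} f \<longleftrightarrow> f2 0 \<ge> 0"
proof
  assume pos: "f2 0 \<ge> 0"
  then have nn: "f2 t \<ge> 0" if "t \<ge> 0" for t using f2_nonneg_forward[of 0 t] that by simp
  show "convex_on {0..} f"
  proof (rule convex_on_of_mono_deriv)
    show "DERIV f x :> f1 x" if "x \<in> interior {0..}" for x using that DI(1) by simp
    show "f1 x \<le> f1 y" if "x \<in> interior {0..}" "y \<in> interior {0..}" "x \<le> y" for x y
      by (rule DERIV_nonneg_le[where g = f1 and g' = f2, OF that(3)]) (use that DI(2) nn cont' in auto)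
  qed (use cont in auto)
next
  assume conv: "convex_on {0..} f"
  show "f2 0 \<ge> 0"
  proof (rule ccontr)
    assume "\<not> f2 0 \<ge> 0"
    then have "\<forall>\<^sub>F t in at 0 within {0..}. f2 t < 0"
      using cont(3) by (intro order_tendstoD) (auto simp: continuous_on_def)
    then obtain e where e: "e > 0" "\<And>t. t > 0 \<Longrightarrow> t < e \<Longrightarrow> f2 t < 0"
      unfolding eventually_at by (auto simp: dist_real_def)
    define x y where "x = e / 3" and "y = e / 2"
    have xy: "0 < x" "x < y" "y < e" using e by (auto simp: x_def y_def)
    have "f1 y < f1 x"
      by (rule DERIV_neg_less[where g = f1 and g' = f2, OF xy(2)]) (use DI(2) e xy cont' in auto)
    \<comment> \<open>Used at interior points only. Adding the two inequalities for x and y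
      contradicts the decrease of f' near 0.\<close>
    have tangent: "f s - f r \<ge> f1 r * (s - r)" if "r > 0" "s > 0" for r s
      using convex_on_imp_above_tangent[OF conv, of r s] that D(1)[of r] by auto
    have "f y - f x \<ge> f1 x * (y - x)" "f x - f y \<ge> f1 y * (x - y)" using tangent xy by auto
    then have "(f1 x - f1 y) * (y - x) \<le> 0" by (simp add: algebra_simps)
    then show False using \<open>f1 y < f1 x\<close> xy by (simp add: mult_le_0_iff)
  qed
qed

lemma convex_solution_iff: "convex_solution m a f \<longleftrightarrow> f2 0 \<ge> 0"
  using sol convex_iff by (simp add: convex_solution_def)

text \<open>Positive values of f'' persist, so f'' is nonpositive before its zero r and nonnegative
  after it; since f'' is eventually positive, such an r exists.\<close>

lemma concave_convex_solution_iff: "concave_convex_solution m a f \<longleftrightarrow> f2 0 < 0"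
proof
  assume neg: "f2 0 < 0"
  obtain t where t: "t \<ge> 0" "f2 t > 0" using f2_eventually_pos by blast
  obtain r where r: "0 \<le> r" "r \<le> t" "f2 r = 0" using IVT'[of f2 0 0 t] neg t cont'(3)[of 0 t] by auto
  have r0: "r > 0" using r neg by (cases "r = 0") auto
  have before: "f2 s \<le> 0" if "0 \<le> s" "s \<le> r" for s
    using f2_pos_forward[OF that] r by force
  have after: "f2 s \<ge> 0" if "r \<le> s" for s using f2_nonneg_forward[OF r(1) that] r by simp
  have "concave_on {0..r} f"
    unfolding concave_on_def
  proof (rule convex_on_of_mono_deriv)
    show "DERIV (\<lambda>x. - f x) x :> - f1 x" if "x \<in> interior {0..r}" for x
      using that DI(1) by (auto intro!: derivative_eq_intros)
    show "- f1 x \<le> - f1 y" if "x \<in> interior {0..r}" "y \<in> interior {0..r}" "x \<le> y" for x y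
      using f1_antimono[of x y] that before by auto
  qed (use cont' in \<open>auto intro!: continuous_intros\<close>)
  moreover have "convex_on {r<..} f"
  proof (rule convex_on_of_mono_deriv)
    show "continuous_on {r<..} f" using cont(1) r by (auto intro: continuous_on_subset)
    show "DERIV f x :> f1 x" if "x \<in> interior {r<..}" for x using that DI(1)[of x] r by (simp add: interior_open)
    show "f1 x \<le> f1 y" if "x \<in> interior {r<..}" "y \<in> interior {r<..}" "x \<le> y" for x y
    proof (rule DERIV_nonneg_imp_increasing_open[OF that(3)])
      show "\<exists>d. DERIV f1 s :> d \<and> d \<ge> 0" if "x < s" "s < y" for s
        using DI(2)[of s] after[of s] that \<open>x \<in> interior {r<..}\<close> r by (auto simp: interior_open)
    qed (use that r cont' in \<open>auto simp: interior_open\<close>)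
  qed auto
  ultimately show "concave_convex_solution m a f"
    unfolding concave_convex_solution_def using sol neg r0 by (auto simp: f2_def)
qed (simp add: concave_convex_solution_def f2_def)

end

section \<open>Correspondence of solutions and orbits\<close>

text \<open>For given m this allows solutions with the same f(0) to be counted by f''(0). The sum E
  of the squared differences of f, f', f'' satisfies E' \<le> K E and starts at 0.\<close>

lemma solution_unique:
  assumes f: "solution m a f" and g: "solution m a g" and eq: "(hderiv ^^ 2) f 0 = (hderiv ^^ 2) g 0"
  shows "f = g"
proof -
  define f1 f2 g1 g2 where "f1 = hderiv f" and "f2 = (hderiv ^^ 2) f" and "g1 = hderiv g" and "g2 = (hderiv ^^ 2) g"
  note fD = solutionD[OF f, folded f1_def f2_def] and gD = solutionD[OF g, folded g1_def g2_def]
  define c where "c = (m + 1) / 2"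
  have cont: "continuous_on {0..} f" "continuous_on {0..} f1" "continuous_on {0..} f2"
    "continuous_on {0..} g" "continuous_on {0..} g1" "continuous_on {0..} g2"
    using fD(5-7) gD(5-7) by (auto intro!: DERIV_continuous_on)
  have "f t = g t" if t: "t \<ge> 0" for t
  proof -
    have ct: "continuous_on {0..t} f" "continuous_on {0..t} f1" "continuous_on {0..t} f2"
      "continuous_on {0..t} g" "continuous_on {0..t} g1" "continuous_on {0..t} g2"
      using cont by (auto intro: continuous_on_subset)
    have bdd: "\<exists>B. \<forall>s\<in>{0..t}. \<bar>h s\<bar> \<le> B" if "continuous_on {0..t} h" for h :: "real \<Rightarrow> real"
      using compact_imp_bounded[OF compact_continuous_image[OF that]] by (auto simp: bounded_iff)
    obtain B1 where B1: "\<And>s. s \<in> {0..t} \<Longrightarrow> \<bar>c * f s\<bar> \<le> B1"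
      using bdd[OF continuous_on_mult[OF continuous_on_const[of _ c] ct(1)]] by blast
    obtain B2 where B2: "\<And>s. s \<in> {0..t} \<Longrightarrow> \<bar>c * g2 s\<bar> \<le> B2"
      using bdd[OF continuous_on_mult[OF continuous_on_const[of _ c] ct(6)]] by blast
    obtain B3 where B3: "\<And>s. s \<in> {0..t} \<Longrightarrow> \<bar>m * (f1 s + g1 s)\<bar> \<le> B3"
      using bdd[OF continuous_on_mult[OF continuous_on_const[of _ m] continuous_on_add[OF ct(2,5)]]] by blast
    define E where "E s = (f s - g s)\<^sup>2 + (f1 s - g1 s)\<^sup>2 + (f2 s - g2 s)\<^sup>2" for s
    define K where "K = 2 + 2 * B1 + B2 + B3"
    have "- E 0 * exp (integral {0..t} (\<lambda>_. K)) \<le> - E t"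
    proof (rule linear_growth[OF t, where g = "\<lambda>s. - E s"])
      show "continuous_on {0..t} (\<lambda>s. - E s)" unfolding E_def by (intro continuous_intros ct)
      fix s assume s: "0 < s" "s < t"
      have D: "DERIV f s :> f1 s" "DERIV f1 s :> f2 s" "DERIV f2 s :> m * (f1 s)\<^sup>2 - c * f s * f2 s"
        "DERIV g s :> g1 s" "DERIV g1 s :> g2 s" "DERIV g2 s :> m * (g1 s)\<^sup>2 - c * g s * g2 s"
        using fD(5-7)[of s] gD(5-7)[of s] s by (simp_all add: at_within_interior[of s "{0..}"] c_def)
      define x y z where "x = f s - g s" and "y = f1 s - g1 s" and "z = f2 s - g2 s"
      define d where "d = 2 * (x * y) + 2 * (y * z)
        + 2 * ((m * (f1 s + g1 s)) * (y * z) - (c * f s) * z\<^sup>2 - (c * g2 s) * (x * z))"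
      have "DERIV (\<lambda>s. - E s) s :> - d"
        unfolding E_def d_def x_def y_def z_def
        by (rule derivative_eq_intros D refl)+ (simp add: power2_eq_square algebra_simps)
      moreover have "d \<le> K * E s"
      proof -
        have s': "s \<in> {0..t}" using s by simp
        have Es: "E s = x\<^sup>2 + y\<^sup>2 + z\<^sup>2" by (simp add: E_def x_def y_def z_def)
        have xy: "2 * \<bar>x * y\<bar> \<le> E s" "2 * \<bar>y * z\<bar> \<le> E s" "2 * \<bar>x * z\<bar> \<le> E s" "z\<^sup>2 \<le> E s"
          using abs_mult_le_sum_squares[of x y] abs_mult_le_sum_squares[of y z] abs_mult_le_sum_squares[of x z]
            zero_le_power2[of x] zero_le_power2[of y] zero_le_power2[of z] unfolding Es by linarith+
        have "(m * (f1 s + g1 s)) * (2 * (y * z)) \<le> \<bar>m * (f1 s + g1 s)\<bar> * (2 * \<bar>y * z\<bar>)"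
          by (rule order_trans[OF abs_ge_self]) (simp add: abs_mult)
        also have "\<dots> \<le> B3 * E s" using B3[OF s'] xy by (intro mult_mono) auto
        finally have 1: "(m * (f1 s + g1 s)) * (2 * (y * z)) \<le> B3 * E s" .
        have "- ((c * g2 s) * (2 * (x * z))) \<le> \<bar>c * g2 s\<bar> * (2 * \<bar>x * z\<bar>)"
          by (rule order_trans[OF abs_ge_minus_self]) (simp add: abs_mult)
        also have "\<dots> \<le> B2 * E s" using B2[OF s'] xy by (intro mult_mono) auto
        finally have 2: "- ((c * g2 s) * (2 * (x * z))) \<le> B2 * E s" .
        have "- ((c * f s) * z\<^sup>2) \<le> \<bar>c * f s\<bar> * z\<^sup>2"
          by (rule order_trans[OF abs_ge_minus_self]) (simp add: abs_mult)
        also have "\<dots> \<le> B1 * E s" using B1[OF s'] xy by (intro mult_mono) auto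
        finally have 3: "- ((c * f s) * z\<^sup>2) \<le> B1 * E s" .
        have "2 * (x * y) \<le> E s" "2 * (y * z) \<le> E s" using xy by linarith+
        moreover have "d = 2 * (x * y) + 2 * (y * z) + (m * (f1 s + g1 s)) * (2 * (y * z))
          + 2 * - ((c * f s) * z\<^sup>2) + - ((c * g2 s) * (2 * (x * z)))"
          by (simp add: d_def algebra_simps)
        moreover have "K * E s = E s + E s + B3 * E s + 2 * (B1 * E s) + B2 * E s"
          by (simp add: K_def algebra_simps)
        ultimately show ?thesis using 1 2 3 by linarith
      qed
      ultimately show "\<exists>d. DERIV (\<lambda>s. - E s) s :> d \<and> d \<ge> K * - E s" by (intro exI[of _ "- d"]) simp
    qed auto
    moreover have "E 0 = 0"
      using fD(2,3) gD(2,3) eq by (simp add: E_def f2_def g2_def)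
    ultimately have "E t \<le> 0" by simp
    moreover have "(f t - g t)\<^sup>2 \<le> E t" by (simp add: E_def)
    ultimately have "(f t - g t)\<^sup>2 \<le> 0" by linarith
    then show ?thesis by simp
  qed
  then show "f = g" using fD(1) gD(1) by (intro extensionalityI[of f "{0..}"]) auto
qed

context similarity_flow
begin

lemma solution_of_orbit:
  assumes a: "a > 0" and g: "good_orbit u v" and u0: "u 0 = - 1 / a\<^sup>2" and v0: "v 0 = b / a^3"
  obtains f where "solution m a f" "(hderiv ^^ 2) f 0 = b"
    "(u \<longlongrightarrow> 0) at_top \<Longrightarrow> positive_limit f" "\<not> (u \<longlongrightarrow> 0) at_top \<Longrightarrow> zero_limit f"
proof -
  have o: "orbit {0..} u v" and neg: "\<And>s. s \<ge> 0 \<Longrightarrow> u s < 0" using g by (auto simp: good_orbit_def)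
  obtain B where B: "\<And>s. s \<ge> 0 \<Longrightarrow> \<bar>u s\<bar> \<le> B \<and> \<bar>v s\<bar> \<le> B" using g by (auto simp: good_orbit_def)
  have B0: "B \<ge> 0" using B[of 0] by force
  have cu: "continuous_on {0..} u" using orbit_continuous(1)[OF o] .
  have cu': "continuous_on {0..s} u" for s using cu by (auto intro: continuous_on_subset)
  \<comment> \<open>From ds = f dt and f' = u f^2 follows df/ds = u f, which determines f as a
    function of s. The original time is the integral of 1/f, unbounded because f \<le> a.\<close>
  define F where "F s = a * exp (integral {0..s} u)" for s
  have Fpos: "F s > 0" for s using a by (simp add: F_def)
  have F0: "F 0 = a" by (simp add: F_def)
  have ID: "((\<lambda>s. integral {0..s} u) has_real_derivative u s) (at s within {0..})" if s: "s \<ge> 0" for s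
  proof -
    have "((\<lambda>s. integral {0..s} u) has_real_derivative u s) (at s within {0..s+1})"
      using s by (intro integral_has_real_derivative cu') auto
    moreover have "at s within {0..s+1} = at s within {0..}"
      using s by (intro at_within_nhd[of _ "{s-1<..<s+1}"]) auto
    ultimately show ?thesis by simp
  qed
  have FD: "(F has_real_derivative u s * F s) (at s within {0..})" if s: "s \<ge> 0" for s
    unfolding F_def by (auto intro!: derivative_eq_intros ID[OF s])
  have Fa: "F s \<le> a" if "s \<ge> 0" for s
  proof -
    have "integral {0..s} u \<le> integral {0..s} (\<lambda>_. 0)"
      by (intro integral_le integrable_continuous_real cu') (use neg in \<open>auto intro: less_imp_le\<close>)
    then show ?thesis unfolding F_def using a by (simp add: mult_le_cancel_left1)
  qed
  have cF: "continuous_on {0..} F" using FD by (auto intro!: DERIV_continuous_on)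
  have cG: "continuous_on {0..} (\<lambda>s. 1 / F s)"
    by (intro continuous_intros cF) (use Fpos in \<open>auto simp: less_le\<close>)
  have int_ge: "integral {0..s} (\<lambda>s. 1 / F s) \<ge> s / a" if s: "s \<ge> 0" for s
  proof -
    have "integral {0..s} (\<lambda>_. 1 / a) \<le> integral {0..s} (\<lambda>s. 1 / F s)"
    proof (intro integral_le integrable_continuous_real)
      show "continuous_on {0..s} (\<lambda>s. 1 / F s)" using cG by (rule continuous_on_subset) auto
      show "1 / a \<le> 1 / F x" if "x \<in> {0..s}" for x using Fa[of x] Fpos[of x] that by (intro divide_left_mono) auto
    qed auto
    then show ?thesis using s by simp
  qed
  have unb: "\<exists>s\<ge>0. integral {0..s} (\<lambda>s. 1 / F s) \<ge> K" for K
  proof -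
    have "integral {0..\<bar>K\<bar> * a} (\<lambda>s. 1 / F s) \<ge> \<bar>K\<bar> * a / a" using a by (intro int_ge) simp
    then have "integral {0..\<bar>K\<bar> * a} (\<lambda>s. 1 / F s) \<ge> K" using a by simp
    then show ?thesis using a by (intro exI[of _ "\<bar>K\<bar> * a"]) simp
  qed
  obtain T where T0: "T 0 = 0" and Tnn: "\<And>t. t \<ge> 0 \<Longrightarrow> T t \<ge> 0"
    and TD: "\<And>t. t \<ge> 0 \<Longrightarrow> (T has_real_derivative F (T t)) (at t within {0..})"
    and Tinv: "\<And>s. s \<ge> 0 \<Longrightarrow> T (integral {0..s} (\<lambda>s. 1 / F s)) = s"
  proof (rule time_change[OF cG _ unb])
    show "1 / F t > 0" for t using Fpos by simp
    fix T assume *: "T 0 = 0" "\<And>s. s \<ge> 0 \<Longrightarrow> T s \<ge> 0"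
      "\<And>s. s \<ge> 0 \<Longrightarrow> (T has_real_derivative 1 / (1 / F (T s))) (at s within {0..})"
      "\<And>t. t \<ge> 0 \<Longrightarrow> T (integral {0..t} (\<lambda>s. 1 / F s)) = t"
    show thesis by (rule that[OF *(1,2) _ *(4)]) (use *(3) in simp_all)
  qed
  have TD': "((\<lambda>t. h (T t)) has_real_derivative h' (T t) * F (T t)) (at t within {0..})"
    if "\<And>s. s \<ge> 0 \<Longrightarrow> (h has_real_derivative h' s) (at s within {0..})" "t \<ge> 0" for h h' t
  proof -
    have "(h has_real_derivative h' (T t)) (at (T t) within T ` {0..})"
      using that(1)[OF Tnn[OF that(2)]] Tnn by (auto intro: DERIV_subset)
    from DERIV_image_chain[OF this TD[OF that(2)]] show ?thesis by (simp add: o_def)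
  qed
  have uD: "(u has_real_derivative P (u s) (v s)) (at s within {0..})"
    and vD: "(v has_real_derivative Q (u s) (v s)) (at s within {0..})" if "s \<ge> 0" for s
    using o that by (auto simp: orbit_def)
  \<comment> \<open>Written with the unsimplified factors that differentiating a power produces, so
    that both identities match directly.\<close>
  have alg1: "P x y * z * z\<^sup>2 + real 2 * (x * z * z * z ^ (2 - Suc 0)) * x = y * z ^ 3" for x y z
    unfolding P_def by (simp add: power2_eq_square power3_eq_cube, simp add: algebra_simps)
  have alg2: "Q x y * z * z ^ 3 + real 3 * (x * z * z * z ^ (3 - Suc 0)) * y = m * (x * z\<^sup>2)\<^sup>2 - \<alpha> * z * (y * z ^ 3)" for x y z
    unfolding Q_def by (simp add: power2_eq_square power3_eq_cube, simp add: algebra_simps)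
  define g0 where "g0 t = F (T t)" for t
  define g1 where "g1 t = u (T t) * (F (T t))\<^sup>2" for t
  define g2 where "g2 t = v (T t) * (F (T t))^3" for t
  have D0: "(g0 has_real_derivative g1 t) (at t within {0..})" if t: "t \<ge> 0" for t
    unfolding g0_def[abs_def] g1_def using TD'[OF FD t] by (simp add: power2_eq_square algebra_simps)
  have D1: "(g1 has_real_derivative g2 t) (at t within {0..})" if t: "t \<ge> 0" for t
    unfolding g1_def[abs_def] g2_def
    by (rule DERIV_cong[OF DERIV_mult[OF TD'[OF uD t] DERIV_power[OF TD'[OF FD t], of 2]] alg1])
  have D2: "(g2 has_real_derivative m * (g1 t)\<^sup>2 - (m + 1) / 2 * g0 t * g2 t) (at t within {0..})" if t: "t \<ge> 0" for t
  proof -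
    have "(m + 1) / 2 = \<alpha>" using m by simp
    then show ?thesis
      unfolding g0_def g1_def g2_def[abs_def]
      using DERIV_cong[OF DERIV_mult[OF TD'[OF vD t] DERIV_power[OF TD'[OF FD t], of 3]] alg2] by simp
  qed
  have pos: "g0 t > 0" for t using Fpos by (simp add: g0_def)
  have le: "g0 t \<le> a" if "t \<ge> 0" for t using Fa[OF Tnn[OF that]] by (simp add: g0_def)
  have anti: "g0 y \<le> g0 x" if xy: "0 \<le> x" "x \<le> y" for x y
  proof (rule DERIV_nonpos_le[OF xy(2)])
    have "continuous_on {0..} g0" using D0 by (auto intro!: DERIV_continuous_on)
    then show "continuous_on {x..y} g0" by (rule continuous_on_subset) (use xy in auto)
    show "DERIV g0 s :> g1 s \<and> g1 s \<le> 0" if "x < s" "s < y" for s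
      using D0[of s] that xy neg[OF Tnn[of s]]
      by (auto simp: at_within_interior[of s "{0..}"] g1_def mult_nonpos_nonneg)
  qed
  obtain l where l: "(g0 \<longlongrightarrow> l) at_top" "l \<ge> 0" "\<And>t. t \<ge> 0 \<Longrightarrow> l \<le> g0 t"
    by (rule antimono_bounded_limit[of 0 g0 0]) (use anti pos in \<open>auto intro: less_imp_le\<close>)
  \<comment> \<open>f converges by monotonicity and f'' = v f^3 is bounded, so the condition at
    infinity follows without knowing how the orbit behaves.\<close>
  have g1_lim: "(g1 \<longlongrightarrow> 0) at_top"
  proof (rule barbalat[OF D0 D1 _ l(1)])
    fix t :: real assume t: "t \<ge> 0"
    have "\<bar>g2 t\<bar> = \<bar>v (T t)\<bar> * (g0 t)^3" using Fpos[of "T t"] by (simp add: g2_def g0_def abs_mult)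
    also have "\<dots> \<le> B * a^3"
      using B[OF Tnn[OF t]] le[OF t] pos[of t] B0 by (intro mult_mono power_mono) auto
    finally show "\<bar>g2 t\<bar> \<le> B * a^3" .
  qed
  define f where "f = restrict g0 {0..}"
  have sol: "solution m a f" "(hderiv ^^ 2) f 0 = g2 0"
    unfolding f_def
    by (rule solutionI[OF D0 D1 D2 _ _ g1_lim]; use a in \<open>simp add: g0_def g1_def T0 F0 u0\<close>)+
  have flim: "(f \<longlongrightarrow> l) at_top"
    using l(1)
  proof (rule Lim_transform_eventually)
    show "\<forall>\<^sub>F t in at_top. g0 t = f t"
      using eventually_ge_at_top[of 0] by eventually_elim (simp add: f_def)
  qed
  show ?thesis
  proof (rule that[of f])
    show "solution m a f" by (rule sol)
    show "(hderiv ^^ 2) f 0 = b" using sol(2) a by (simp add: g2_def T0 F0 v0)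
    show "positive_limit f" if lim: "(u \<longlongrightarrow> 0) at_top"
    proof -
      obtain C where C: "\<And>s. s \<ge> 0 \<Longrightarrow> \<bar>u s\<bar> \<le> C * exp (- \<alpha> * s)"
        using phase_portrait g lim by metis
      have C0: "C \<ge> 0" using C[of 0] by force
      have Fl: "F s \<ge> a * exp (- C / \<alpha>)" if s: "s \<ge> 0" for s
      proof -
        have I: "((\<lambda>s. - (C * exp (- \<alpha> * s))) has_integral (C / \<alpha> * exp (- \<alpha> * s) - C / \<alpha> * exp (- \<alpha> * 0))) {0..s}"
          by (rule fundamental_theorem_of_calculus)
            (use s alpha in \<open>auto intro!: derivative_eq_intros simp flip: has_real_derivative_iff_has_vector_derivative\<close>)
        have "integral {0..s} (\<lambda>s. - (C * exp (- \<alpha> * s))) \<le> integral {0..s} u"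
        proof (rule integral_le)
          show "(\<lambda>s. - (C * exp (- \<alpha> * s))) integrable_on {0..s}" using I by blast
          show "u integrable_on {0..s}" by (intro integrable_continuous_real cu')
          show "- (C * exp (- \<alpha> * x)) \<le> u x" if "x \<in> {0..s}" for x using C[of x] that by (simp add: abs_le_iff)
        qed
        moreover have "C / \<alpha> * exp (- \<alpha> * s) \<ge> 0" using C0 alpha by simp
        ultimately have "- C / \<alpha> \<le> integral {0..s} u" using integral_unique[OF I] by simp
        then show ?thesis unfolding F_def using a by simp
      qed
      have "a * exp (- C / \<alpha>) \<le> l"
        using l(1)
      proof (rule tendsto_lowerbound)
        show "\<forall>\<^sub>F t in at_top. a * exp (- C / \<alpha>) \<le> g0 t"
          using eventually_ge_at_top[of 0] by eventually_elim (use Fl Tnn in \<open>auto simp: g0_def\<close>)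
      qed simp
      moreover have "a * exp (- C / \<alpha>) > 0" using a by simp
      ultimately have "l > 0" by linarith
      then show ?thesis using flim by (auto simp: positive_limit_def)
    qed
    show "zero_limit f" if nlim: "\<not> (u \<longlongrightarrow> 0) at_top"
    proof (rule ccontr)
      assume "\<not> zero_limit f"
      then have l0: "l > 0" using flim l(2) by (auto simp: zero_limit_def le_less)
      \<comment> \<open>For l > 0 the quotient u = f'/f^2 would tend to 0 in the time t, hence also
        in s.\<close>
      have "((\<lambda>t. g1 t / (g0 t)\<^sup>2) \<longlongrightarrow> 0 / l\<^sup>2) at_top"
        using l0 by (intro tendsto_intros g1_lim l(1)) auto
      moreover have "g1 t / (g0 t)\<^sup>2 = u (T t)" for t using Fpos[of "T t"] by (simp add: g1_def g0_def)
      ultimately have uT: "((\<lambda>t. u (T t)) \<longlongrightarrow> 0) at_top" by simp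
      have "filterlim (\<lambda>s. integral {0..s} (\<lambda>s. 1 / F s)) at_top at_top"
      proof (rule filterlim_at_top_mono)
        have "filterlim (\<lambda>s. (1 / a) * s) at_top at_top"
          by (rule filterlim_tendsto_pos_mult_at_top[OF tendsto_const _ filterlim_ident]) (use a in simp)
        then show "filterlim (\<lambda>s. s / a) at_top at_top" by simp
        show "\<forall>\<^sub>F s in at_top. s / a \<le> integral {0..s} (\<lambda>s. 1 / F s)"
          using eventually_ge_at_top[of 0] by eventually_elim (rule int_ge)
      qed
      from filterlim_compose[OF uT this]
      have "((\<lambda>s. u (T (integral {0..s} (\<lambda>s. 1 / F s)))) \<longlongrightarrow> 0) at_top" .
      then have "(u \<longlongrightarrow> 0) at_top"
      proof (rule Lim_transform_eventually)
        show "\<forall>\<^sub>F s in at_top. u (T (integral {0..s} (\<lambda>s. 1 / F s))) = u s"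
          using eventually_ge_at_top[of 0] by eventually_elim (simp add: Tinv)
      qed
      then show False using nlim by simp
    qed
  qed
qed

theorem solution_set:
  obtains u\<^sub>1 u\<^sub>2 :: real and gm gp :: "real \<Rightarrow> real" where
    "u\<^sub>1 < u\<^sub>2" "u\<^sub>2 < 0"
    "\<And>p. p < 0 \<Longrightarrow> gp p > 0"
    "\<And>p. p \<le> u\<^sub>1 \<Longrightarrow> gm p = gp p"
    "\<And>p. u\<^sub>1 < p \<Longrightarrow> p < 0 \<Longrightarrow> gm p < gp p"
    "\<And>p. u\<^sub>1 < p \<Longrightarrow> p < 0 \<Longrightarrow> gm p \<ge> 0 \<longleftrightarrow> p \<le> u\<^sub>2"
    "\<And>a b. a > 0 \<Longrightarrow> (\<exists>f. solution m a f \<and> (hderiv ^^ 2) f 0 = b \<and> positive_limit f) \<longleftrightarrow>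
       u\<^sub>1 \<le> - 1 / a\<^sup>2 \<and> (b = a^3 * gm (- 1 / a\<^sup>2) \<or> b = a^3 * gp (- 1 / a\<^sup>2))"
    "\<And>a b. a > 0 \<Longrightarrow> (\<exists>f. solution m a f \<and> (hderiv ^^ 2) f 0 = b \<and> zero_limit f) \<longleftrightarrow>
       a^3 * gm (- 1 / a\<^sup>2) < b \<and> b < a^3 * gp (- 1 / a\<^sup>2)"
proof -
  obtain u\<^sub>1 u\<^sub>2 :: real and gm gp :: "real \<Rightarrow> real" where
    pp: "u\<^sub>1 < u\<^sub>2" "u\<^sub>2 < 0" "\<And>p. p < 0 \<Longrightarrow> gp p > 0" "\<And>p. p \<le> u\<^sub>1 \<Longrightarrow> gm p = gp p"
    "\<And>p. u\<^sub>1 < p \<Longrightarrow> p < 0 \<Longrightarrow> gm p < gp p" "\<And>p. u\<^sub>1 < p \<Longrightarrow> p < 0 \<Longrightarrow> gm p \<ge> 0 \<longleftrightarrow> p \<le> u\<^sub>2"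
    and on: "\<And>p q. p < 0 \<Longrightarrow> (\<exists>u v. good_orbit u v \<and> u 0 = p \<and> v 0 = q \<and> (u \<longlongrightarrow> 0) at_top) \<longleftrightarrow>
       u\<^sub>1 \<le> p \<and> (q = gm p \<or> q = gp p)"
    and off: "\<And>p q. p < 0 \<Longrightarrow> (\<exists>u v. good_orbit u v \<and> u 0 = p \<and> v 0 = q \<and> \<not> (u \<longlongrightarrow> 0) at_top) \<longleftrightarrow>
       gm p < q \<and> q < gp p"
    by (rule phase_portrait) blast
  have scale: "b / a^3 = q \<longleftrightarrow> b = a^3 * q" "q < b / a^3 \<longleftrightarrow> a^3 * q < b" "b / a^3 < q \<longleftrightarrow> b < a^3 * q"
    if "a > 0" for a b q :: real
    using that by (auto simp: field_simps)
  show ?thesis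
  proof (rule that[OF pp])
    fix a b :: real assume a: "a > 0"
    have p: "- 1 / a\<^sup>2 < 0" using a by simp
    show "(\<exists>f. solution m a f \<and> (hderiv ^^ 2) f 0 = b \<and> positive_limit f) \<longleftrightarrow>
       u\<^sub>1 \<le> - 1 / a\<^sup>2 \<and> (b = a^3 * gm (- 1 / a\<^sup>2) \<or> b = a^3 * gp (- 1 / a\<^sup>2))"
      unfolding scale(1)[OF a, symmetric] on[OF p, symmetric]
    proof
      assume "\<exists>f. solution m a f \<and> (hderiv ^^ 2) f 0 = b \<and> positive_limit f"
      then obtain f where f: "solution m a f" "(hderiv ^^ 2) f 0 = b" "positive_limit f" by blast
      interpret similarity_solution \<alpha> m a f by unfold_locales (use a f in auto)
      from f(3) f(2) show "\<exists>u v. good_orbit u v \<and> u 0 = - 1 / a\<^sup>2 \<and> v 0 = b / a^3 \<and> (u \<longlongrightarrow> 0) at_top"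
        using orbit_of_solution unfolding f2_def by metis
    next
      assume "\<exists>u v. good_orbit u v \<and> u 0 = - 1 / a\<^sup>2 \<and> v 0 = b / a^3 \<and> (u \<longlongrightarrow> 0) at_top"
      then show "\<exists>f. solution m a f \<and> (hderiv ^^ 2) f 0 = b \<and> positive_limit f"
        using solution_of_orbit[OF a] by metis
    qed
    show "(\<exists>f. solution m a f \<and> (hderiv ^^ 2) f 0 = b \<and> zero_limit f) \<longleftrightarrow>
       a^3 * gm (- 1 / a\<^sup>2) < b \<and> b < a^3 * gp (- 1 / a\<^sup>2)"
      unfolding scale(2,3)[OF a, symmetric] off[OF p, symmetric]
    proof
      assume "\<exists>f. solution m a f \<and> (hderiv ^^ 2) f 0 = b \<and> zero_limit f"
      then obtain f where f: "solution m a f" "(hderiv ^^ 2) f 0 = b" "zero_limit f" by blast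
      interpret similarity_solution \<alpha> m a f by unfold_locales (use a f in auto)
      obtain u v where uv: "good_orbit u v" "u 0 = - 1 / a\<^sup>2" "v 0 = b / a^3"
        using orbit_of_solution f(2) unfolding f2_def by metis
      \<comment> \<open>Here uniqueness enters: an orbit tending to 0 would yield a second solution
        with the same f''(0) but a positive limit.\<close>
      have "\<not> (u \<longlongrightarrow> 0) at_top"
      proof
        assume "(u \<longlongrightarrow> 0) at_top"
        then obtain h where "solution m a h" "(hderiv ^^ 2) h 0 = b" "positive_limit h"
          using solution_of_orbit[OF a uv] by metis
        then show False using solution_unique[OF f(1)] f(2,3) not_both by metis
      qed
      then show "\<exists>u v. good_orbit u v \<and> u 0 = - 1 / a\<^sup>2 \<and> v 0 = b / a^3 \<and> \<not> (u \<longlongrightarrow> 0) at_top"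
        using uv by blast
    next
      assume "\<exists>u v. good_orbit u v \<and> u 0 = - 1 / a\<^sup>2 \<and> v 0 = b / a^3 \<and> \<not> (u \<longlongrightarrow> 0) at_top"
      then show "\<exists>f. solution m a f \<and> (hderiv ^^ 2) f 0 = b \<and> zero_limit f"
        using solution_of_orbit[OF a] by metis
    qed
  qed
qed

end

text \<open>The starting line u = - 1/a^2 moves to the right as a grows, so thresholds in u become
  thresholds in a.\<close>

lemma neg_inverse_square_le:
  assumes "a > 0" "w < 0"
  shows "- 1 / a\<^sup>2 \<le> w \<longleftrightarrow> a \<le> 1 / sqrt (- w)" "- 1 / a\<^sup>2 < w \<longleftrightarrow> a < 1 / sqrt (- w)"
proof -
  define s where "s = sqrt (- w)"
  have s: "s > 0" "w = - s\<^sup>2" using assms(2) by (simp_all add: s_def)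
  have "- 1 / a\<^sup>2 \<le> w \<longleftrightarrow> (a * s)\<^sup>2 \<le> 1"
    using assms(1) by (simp add: s(2) field_simps power_mult_distrib)
  also have "\<dots> \<longleftrightarrow> a * s \<le> 1" using assms(1) s(1) by (simp add: abs_square_le_1)
  finally show "- 1 / a\<^sup>2 \<le> w \<longleftrightarrow> a \<le> 1 / sqrt (- w)" using s(1) by (simp add: s_def field_simps)
  have "- 1 / a\<^sup>2 < w \<longleftrightarrow> (a * s)\<^sup>2 < 1"
    using assms(1) by (simp add: s(2) field_simps power_mult_distrib)
  also have "\<dots> \<longleftrightarrow> a * s < 1" using assms(1) s(1) by (simp add: abs_square_less_1)
  finally show "- 1 / a\<^sup>2 < w \<longleftrightarrow> a < 1 / sqrt (- w)" using s(1) by (simp add: s_def field_simps)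
qed

text \<open>For fixed a a solution is identified with its value f''(0). Values strictly between
  \<open>lo a\<close> and \<open>hi a\<close> give limit 0, and for a \<ge> \<open>a\<^sub>1\<close>
  the endpoints give a positive limit. Convexity means f''(0) \<ge> 0; \<open>hi a\<close> is always
  positive, while \<open>lo a\<close> turns negative beyond \<open>a\<^sub>2\<close>.\<close>

theorem theorem5:
  fixes m :: real
  assumes "m > 1"
  shows "\<exists>a\<^sub>1 a\<^sub>2 :: real. 0 < a\<^sub>1 \<and> a\<^sub>1 < a\<^sub>2 \<and>
    (\<forall>a. 0 < a \<and> a < a\<^sub>1 \<longrightarrow> \<not> (\<exists>f. solution m a f)) \<and>
    ((\<exists>!f. solution m a\<^sub>1 f) \<and>
     (\<forall>f. solution m a\<^sub>1 f \<longrightarrow>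
        convex_solution m a\<^sub>1 f \<and> positive_limit f \<and> decreasing_positive f)) \<and>
    (\<forall>a. a\<^sub>1 < a \<and> a \<le> a\<^sub>2 \<longrightarrow>
       card {f. convex_solution m a f \<and> positive_limit f} = 2 \<and>
       infinite {f. convex_solution m a f \<and> zero_limit f} \<and>
       (\<forall>f. convex_solution m a f \<and> (positive_limit f \<or> zero_limit f) \<longrightarrow>
          decreasing_positive f)) \<and>
    (\<forall>a. a\<^sub>2 < a \<longrightarrow>
       (\<exists>!f. concave_convex_solution m a f \<and> positive_limit f) \<and>
       (\<exists>!f. convex_solution m a f \<and> positive_limit f) \<and>
       infinite {f. solution m a f \<and> zero_limit f} \<and>
       (\<forall>f. solution m a f \<and> zero_limit f \<longrightarrow>
          concave_convex_solution m a f \<or> convex_solution m a f) \<and>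
       (\<forall>f. (concave_convex_solution m a f \<or> convex_solution m a f) \<and>
            (positive_limit f \<or> zero_limit f) \<longrightarrow> decreasing_positive f))"
proof -
  interpret similarity_flow "(m + 1) / 2" m by unfold_locales (use assms in \<open>simp_all add: field_simps\<close>)
  obtain u\<^sub>1 u\<^sub>2 :: real and gm gp :: "real \<Rightarrow> real" where u: "u\<^sub>1 < u\<^sub>2" "u\<^sub>2 < 0"
    and gp: "\<And>p. p < 0 \<Longrightarrow> gp p > 0"
    and geq: "\<And>p. p \<le> u\<^sub>1 \<Longrightarrow> gm p = gp p"
    and glt: "\<And>p. u\<^sub>1 < p \<Longrightarrow> p < 0 \<Longrightarrow> gm p < gp p"
    and gsign: "\<And>p. u\<^sub>1 < p \<Longrightarrow> p < 0 \<Longrightarrow> gm p \<ge> 0 \<longleftrightarrow> p \<le> u\<^sub>2"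
    and pos: "\<And>a b. a > 0 \<Longrightarrow> (\<exists>f. solution m a f \<and> (hderiv ^^ 2) f 0 = b \<and> positive_limit f) \<longleftrightarrow>
       u\<^sub>1 \<le> - 1 / a\<^sup>2 \<and> (b = a^3 * gm (- 1 / a\<^sup>2) \<or> b = a^3 * gp (- 1 / a\<^sup>2))"
    and zero: "\<And>a b. a > 0 \<Longrightarrow> (\<exists>f. solution m a f \<and> (hderiv ^^ 2) f 0 = b \<and> zero_limit f) \<longleftrightarrow>
       a^3 * gm (- 1 / a\<^sup>2) < b \<and> b < a^3 * gp (- 1 / a\<^sup>2)"
    by (rule solution_set) blast
  define lo hi where "lo a = a^3 * gm (- 1 / a\<^sup>2)" and "hi a = a^3 * gp (- 1 / a\<^sup>2)" for a
  define c where "c f = (hderiv ^^ 2) f (0::real)" for f :: "real \<Rightarrow> real"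
  note pos = pos[folded lo_def hi_def c_def] and zero = zero[folded lo_def hi_def c_def]
  have props: "decreasing_positive f" "positive_limit f \<or> zero_limit f"
    "convex_solution m a f \<longleftrightarrow> 0 \<le> c f" "concave_convex_solution m a f \<longleftrightarrow> c f < 0"
    if "a > 0" "solution m a f" for a f
  proof -
    interpret S: similarity_solution "(m + 1) / 2" m a f by unfold_locales (use that in auto)
    show "decreasing_positive f" "positive_limit f \<or> zero_limit f"
      "convex_solution m a f \<longleftrightarrow> 0 \<le> c f" "concave_convex_solution m a f \<longleftrightarrow> c f < 0"
      using S.decreasing_positive_sol S.limit_exists S.convex_solution_iff S.concave_convex_solution_iff
      by (auto simp: c_def S.f2_def)
  qed
  have sol_of: "solution m a f" if "convex_solution m a f \<or> concave_convex_solution m a f" for a f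
    using that by (auto simp: convex_solution_def concave_convex_solution_def)
  have uniq: "f = g" if "solution m a f" "solution m a g" "c f = c g" for a f g
    using solution_unique[OF that(1,2)] that(3) by (simp add: c_def)
  define a\<^sub>1 a\<^sub>2 where "a\<^sub>1 = 1 / sqrt (- u\<^sub>1)" and "a\<^sub>2 = 1 / sqrt (- u\<^sub>2)"
  have neg: "- 1 / a\<^sup>2 < 0" if "a > 0" for a :: real using that by simp
  have a1: "- 1 / a\<^sup>2 < u\<^sub>1 \<longleftrightarrow> a < a\<^sub>1" "- 1 / a\<^sup>2 \<le> u\<^sub>1 \<longleftrightarrow> a \<le> a\<^sub>1"
    and a2: "- 1 / a\<^sup>2 \<le> u\<^sub>2 \<longleftrightarrow> a \<le> a\<^sub>2" if "a > 0" for a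
    using neg_inverse_square_le[OF that] u by (simp_all add: a\<^sub>1_def a\<^sub>2_def)
  have a1_pos: "a\<^sub>1 > 0" using u by (simp add: a\<^sub>1_def)
  have a12: "a\<^sub>1 < a\<^sub>2" unfolding a\<^sub>1_def a\<^sub>2_def using u by (intro divide_strict_left_mono) auto
  have hi_pos: "hi a > 0" if "a > 0" for a using gp[OF neg[OF that]] that by (simp add: hi_def)
  have lo_hi: "lo a = hi a" if "a > 0" "a \<le> a\<^sub>1" for a
    using geq that a1(2)[OF that(1)] by (simp add: lo_def hi_def)
  have lo_less: "lo a < hi a" and lo_sign: "0 \<le> lo a \<longleftrightarrow> a \<le> a\<^sub>2" if "a\<^sub>1 < a" for a
  proof -
    have a: "a > 0" using that a1_pos by simp
    have p: "u\<^sub>1 < - 1 / a\<^sup>2" using a1(2)[OF a] that by simp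
    show "lo a < hi a" using glt[OF p neg[OF a]] a by (simp add: lo_def hi_def)
    show "0 \<le> lo a \<longleftrightarrow> a \<le> a\<^sub>2"
      using gsign[OF p neg[OF a]] a2[OF a] a by (simp add: lo_def zero_le_mult_iff)
  qed
  have pos_c: "c f = lo a \<or> c f = hi a" if "a > 0" "solution m a f" "positive_limit f" for a f
    using pos[OF that(1), of "c f"] that by blast
  have pos_ex: "\<exists>f. solution m a f \<and> c f = b \<and> positive_limit f" if "a\<^sub>1 \<le> a" "b = lo a \<or> b = hi a" for a b
    using pos[of a b] a1(1)[of a] a1_pos that by auto
  have zero_c: "lo a < c f \<and> c f < hi a" if "a > 0" "solution m a f" "zero_limit f" for a f
    using zero[OF that(1), of "c f"] that by blast
  \<comment> \<open>Restricting to f''(0) \<ge> 0 lets one statement serve both regimes beyond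
    \<open>a\<^sub>1\<close>, since the interval from max 0 (lo a) to hi a is nonempty in
    each.\<close>
  have zero_inf: "infinite {f. solution m a f \<and> zero_limit f \<and> c f \<ge> 0}" if "a\<^sub>1 < a" for a
  proof
    have a: "a > 0" using that a1_pos by simp
    assume "finite {f. solution m a f \<and> zero_limit f \<and> c f \<ge> 0}"
    then have fin: "finite (c ` {f. solution m a f \<and> zero_limit f \<and> c f \<ge> 0})" by (rule finite_imageI)
    have "{max 0 (lo a)<..<hi a} \<subseteq> c ` {f. solution m a f \<and> zero_limit f \<and> c f \<ge> 0}"
    proof
      fix b assume b: "b \<in> {max 0 (lo a)<..<hi a}"
      then obtain f where "solution m a f" "c f = b" "zero_limit f" using zero[OF a, of b] by auto
      then show "b \<in> c ` {f. solution m a f \<and> zero_limit f \<and> c f \<ge> 0}" using b by auto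
    qed
    then have "finite {max 0 (lo a)<..<hi a}" using fin by (rule finite_subset)
    moreover have "max 0 (lo a) < hi a" using lo_less[OF that] hi_pos[OF a] by simp
    ultimately show False using infinite_Ioo by blast
  qed
  show ?thesis
  proof (rule exI[of _ a\<^sub>1], rule exI[of _ a\<^sub>2], intro conjI allI impI)
    show "0 < a\<^sub>1" "a\<^sub>1 < a\<^sub>2" by fact+
  next
    fix a assume a: "0 < a \<and> a < a\<^sub>1"
    show "\<not> (\<exists>f. solution m a f)"
    proof
      assume "\<exists>f. solution m a f"
      then obtain f where f: "solution m a f" by blast
      have "\<not> zero_limit f" using zero_c[of a f] lo_hi[of a] a f by auto
      moreover have "\<not> positive_limit f" using pos[of a "c f"] a1(1)[of a] a f by auto
      ultimately show False using props(2)[of a f] a f by blast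
    qed
  next
    \<comment> \<open>At \<open>a\<^sub>1\<close> the endpoints coincide, so the interval of values
      with limit 0 is empty.\<close>
    have *: "positive_limit f \<and> c f = hi a\<^sub>1" if f: "solution m a\<^sub>1 f" for f
    proof -
      have "\<not> zero_limit f" using zero_c[OF a1_pos f] lo_hi[OF a1_pos] by auto
      then have "positive_limit f" using props(2)[OF a1_pos f] by blast
      then show ?thesis using pos_c[OF a1_pos f] lo_hi[OF a1_pos] by auto
    qed
    obtain f where "solution m a\<^sub>1 f" using pos_ex[of a\<^sub>1 "hi a\<^sub>1"] by blast
    then show "\<exists>!f. solution m a\<^sub>1 f" using * uniq by (intro ex1I[of _ f]) metis+
    fix g assume g: "solution m a\<^sub>1 g"
    show "convex_solution m a\<^sub>1 g" using props(3)[OF a1_pos g] *[OF g] hi_pos[OF a1_pos] by simp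
    show "positive_limit g" using *[OF g] by simp
    show "decreasing_positive g" using props(1)[OF a1_pos g] .
  next
    fix a assume aa: "a\<^sub>1 < a \<and> a \<le> a\<^sub>2"
    then have a: "a > 0" using a1_pos by simp
    have lo: "lo a < hi a" "0 \<le> lo a" using lo_less[of a] lo_sign[of a] aa by auto
    obtain f where f: "solution m a f" "c f = lo a" "positive_limit f" using pos_ex[of a "lo a"] aa by auto
    obtain g where g: "solution m a g" "c g = hi a" "positive_limit g" using pos_ex[of a "hi a"] aa by auto
    have "{h. convex_solution m a h \<and> positive_limit h} = {f, g}"
    proof (intro set_eqI iffI)
      fix h assume "h \<in> {h. convex_solution m a h \<and> positive_limit h}"
      then have h: "solution m a h" "positive_limit h" using sol_of by auto
      then show "h \<in> {f, g}" using pos_c[OF a h] uniq[OF h(1) f(1)] uniq[OF h(1) g(1)] f(2) g(2) by auto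
    next
      fix h assume "h \<in> {f, g}"
      then show "h \<in> {h. convex_solution m a h \<and> positive_limit h}"
        using props(3)[OF a f(1)] props(3)[OF a g(1)] f g lo by auto
    qed
    moreover have "f \<noteq> g" using f(2) g(2) lo by auto
    ultimately show "card {f. convex_solution m a f \<and> positive_limit f} = 2" by simp
    have "{f. solution m a f \<and> zero_limit f \<and> c f \<ge> 0} \<subseteq> {f. convex_solution m a f \<and> zero_limit f}"
      using props(3)[OF a] by auto
    then show "infinite {f. convex_solution m a f \<and> zero_limit f}"
      using zero_inf[of a] aa finite_subset by blast
    show "decreasing_positive h" if "convex_solution m a h \<and> (positive_limit h \<or> zero_limit h)" for h
      using props(1)[OF a] sol_of that by blast
  next
    fix a assume aa: "a\<^sub>2 < a"
    then have a1a: "a\<^sub>1 < a" using a12 by simp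
    then have a: "a > 0" using a1_pos by simp
    have lo: "lo a < hi a" "lo a < 0" using lo_less[OF a1a] lo_sign[OF a1a] aa by auto
    obtain f where f: "solution m a f" "c f = lo a" "positive_limit f" using pos_ex[of a "lo a"] a1a by auto
    obtain g where g: "solution m a g" "c g = hi a" "positive_limit g" using pos_ex[of a "hi a"] a1a by auto
    show "\<exists>!f. concave_convex_solution m a f \<and> positive_limit f"
    proof (rule ex1I[of _ f])
      show "concave_convex_solution m a f \<and> positive_limit f" using props(4)[OF a f(1)] f lo by simp
      fix h assume h: "concave_convex_solution m a h \<and> positive_limit h"
      then have hs: "solution m a h" using sol_of by blast
      then have "c h < 0" using props(4)[OF a hs] h by simp
      then have "c h = lo a" using pos_c[OF a hs] h hi_pos[OF a] by auto
      then show "h = f" using uniq[OF hs f(1)] f(2) by simp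
    qed
    show "\<exists>!f. convex_solution m a f \<and> positive_limit f"
    proof (rule ex1I[of _ g])
      show "convex_solution m a g \<and> positive_limit g" using props(3)[OF a g(1)] g hi_pos[OF a] by simp
      fix h assume h: "convex_solution m a h \<and> positive_limit h"
      then have hs: "solution m a h" using sol_of by blast
      then have "c h \<ge> 0" using props(3)[OF a hs] h by simp
      then have "c h = hi a" using pos_c[OF a hs] h lo by auto
      then show "h = g" using uniq[OF hs g(1)] g(2) by simp
    qed
    have "{f. solution m a f \<and> zero_limit f \<and> c f \<ge> 0} \<subseteq> {f. solution m a f \<and> zero_limit f}" by auto
    then show "infinite {f. solution m a f \<and> zero_limit f}"
      using zero_inf[OF a1a] finite_subset by blast
    show "concave_convex_solution m a h \<or> convex_solution m a h" if "solution m a h \<and> zero_limit h" for h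
      using props(3,4)[OF a, of h] that by auto
    show "decreasing_positive h"
      if "(concave_convex_solution m a h \<or> convex_solution m a h) \<and> (positive_limit h \<or> zero_limit h)" for h
      using props(1)[OF a] sol_of that by blast
  qed
qed

end
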